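(* Let $d\ge 2$. There is a constant $C>0$ depending only on $d$ such that for each $l=1,\dots,d$ and all $u\in\dot{\mathrm{BV}}(\mathbb{R}^d)$, $$\|[Du]_l\|_{DS_{d-1}(\mathbb{R}^d)}\le C\,|Du|(\mathbb{R}^d).$$
   Context: $\dot{\mathrm{BV}}(\mathbb{R}^d)=\{u\in L^1_{loc}(\mathbb{R}^d): Du\in M_b(\mathbb{R}^d;\mathbb{R}^d)\}$, where $Du$ is the distributional gradient and $M_b(\mathbb{R}^d;\mathbb{R}^d)$ is the space of $\mathbb{R}^d$-valued finite Radon measures on $\mathbb{R}^d$ (with total variation norm); $M_b(\mathbb{R}^d)$ is the space of finite signed Radon measures. $|Du|$ is the total variation measure of $Du$ and $[Du]_l$ is the $l$-th component of $Du$. A signed measure $\mu$ on $\mathbb{R}^d$ of finite total variation is a $\beta$-atom if there exists a cube $Q\subset\mathbb{R}^d$ with sides parallel to the coordinate axes and side length $l(Q)$ such that (1) $\operatorname{supp}\mu\subset Q$; (2) $\mu(Q)=0$; (3) $\operatorname{ess\,sup}_{x\in\mathbb{R}^d,\,t>0}|t^{(d-\beta)/2}\,p_t*\mu(x)|\le \frac{1}{l(Q)^{\beta}}$; (4) $|\mu|(\mathbb{R}^d)\le 1$. Here $p_t$ is the heat kernel, $p_t*\mu(x)=\frac{1}{(4\pi t)^{d/2}}\int_{\mathbb{R}^d}e^{-|x-y|^2/4t}\,d\mu(y)$. The space $DS_\beta(\mathbb{R}^d)$ consists of all $\mu\in M_b(\mathbb{R}^d)$ that can be written as $\mu=\lim_{n\to\infty}\sum_{i=1}^n\lambda_{i,n}\mu_{i,n}$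 (weak-star limit of measures, i.e. against continuous functions vanishing at infinity), where the $\mu_{i,n}$ are $\beta$-atoms, the $\lambda_{i,n}$ are scalars, and $\limsup_{n\to\infty}\sum_{i=1}^n|\lambda_{i,n}|<+\infty$. The norm $\|\mu\|_{DS_\beta(\mathbb{R}^d)}$ is the infimum of $\limsup_{n\to\infty}\sum_{i=1}^n|\lambda_{i,n}|$ over all such representations of $\mu$. In particular, the inequality includes the assertion that $[Du]_l\in DS_{d-1}(\mathbb{R}^d)$. *)

theory Defs
  imports "HOL-Analysis.Analysis" "HOL-Probability.Essential_Supremum"
begin

section \<open>Finite signed and vector-valued Borel measures\<close>

text \<open>
  A measure is a set function on the Borel sets with values in a normed space.  As for
  \<^const>\<open>emeasure\<close>, the value on a non-Borel set is \<open>0\<close> by convention, so that two measures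
  are equal iff they agree on the Borel sets.  On \<open>\<real>\<^sup>d\<close> every finite Borel measure is a Radon
  measure.
\<close>

definition total_variation ::
  "('a::topological_space set \<Rightarrow> 'b::real_normed_vector) \<Rightarrow> 'a set \<Rightarrow> ennreal" where
  "total_variation \<mu> A =
     (SUP F\<in>{F :: nat \<Rightarrow> 'a set. range F \<subseteq> sets borel \<and> disjoint_family F \<and> (\<Union>i. F i) = A}.
        \<Sum>i. ennreal (norm (\<mu> (F i))))"

definition finite_measures ::
  "('a::topological_space set \<Rightarrow> 'b::real_normed_vector) set" where
  "finite_measures = {\<mu>.
     (\<forall>A. A \<notin> sets borel \<longrightarrow> \<mu> A = 0) \<and>
     (\<forall>F :: nat \<Rightarrow> 'a set. range F \<subseteq> sets borel \<longrightarrow> disjoint_family F \<longrightarrow>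
        (\<lambda>i. \<mu> (F i)) sums \<mu> (\<Union>i. F i)) \<and>
     total_variation \<mu> UNIV < \<infinity>}"

text \<open>Jordan decomposition \<open>\<mu>\<^sup>+ = (|\<mu>| + \<mu>) / 2\<close>, \<open>\<mu>\<^sup>- = (|\<mu>| - \<mu>) / 2\<close>.\<close>

definition pos_part :: "('a::topological_space set \<Rightarrow> real) \<Rightarrow> 'a measure" where
  "pos_part \<mu> = measure_of UNIV (sets borel)
     (\<lambda>A. ennreal ((enn2real (total_variation \<mu> A) + \<mu> A) / 2))"

definition neg_part :: "('a::topological_space set \<Rightarrow> real) \<Rightarrow> 'a measure" where
  "neg_part \<mu> = measure_of UNIV (sets borel)
     (\<lambda>A. ennreal ((enn2real (total_variation \<mu> A) - \<mu> A) / 2))"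

definition signed_integral ::
  "('a::topological_space set \<Rightarrow> real) \<Rightarrow> ('a \<Rightarrow> real) \<Rightarrow> real" where
  "signed_integral \<mu> f = (LINT x|pos_part \<mu>. f x) - (LINT x|neg_part \<mu>. f x)"

definition measure_support ::
  "('a::topological_space set \<Rightarrow> 'b::real_normed_vector) \<Rightarrow> 'a set" where
  "measure_support \<mu> = {x. \<forall>U. open U \<longrightarrow> x \<in> U \<longrightarrow> total_variation \<mu> U > 0}"

definition weak_star_limit ::
  "(nat \<Rightarrow> 'a::real_normed_vector set \<Rightarrow> real) \<Rightarrow> ('a set \<Rightarrow> real) \<Rightarrow> bool" where
  "weak_star_limit \<mu>s \<mu> \<longleftrightarrow>
     (\<forall>f :: 'a \<Rightarrow> real. continuous_on UNIV f \<longrightarrow> (f \<longlongrightarrow> 0) at_infinity \<longrightarrow>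
        (\<lambda>n. signed_integral (\<mu>s n) f) \<longlonglongrightarrow> signed_integral \<mu> f)"


section \<open>Functions of bounded variation\<close>

definition partial_deriv :: "'n \<Rightarrow> (real^'n \<Rightarrow> real) \<Rightarrow> real^'n \<Rightarrow> real" where
  "partial_deriv i f x = frechet_derivative f (at x) (axis i 1)"

primrec C_k :: "nat \<Rightarrow> (real^'n \<Rightarrow> real) \<Rightarrow> bool" where
  "C_k 0 f \<longleftrightarrow> continuous_on UNIV f"
| "C_k (Suc k) f \<longleftrightarrow> f differentiable_on UNIV \<and> (\<forall>i. C_k k (partial_deriv i f))"

definition test_functions :: "(real^'n \<Rightarrow> real) set" where
  "test_functions = {\<phi>. (\<forall>k. C_k k \<phi>) \<and> compact (closure {x. \<phi> x \<noteq> 0})}"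

definition locally_integrable :: "(real^'n \<Rightarrow> real) \<Rightarrow> bool" where
  "locally_integrable u \<longleftrightarrow> (\<forall>K. compact K \<longrightarrow> u absolutely_integrable_on K)"

definition component :: "'n \<Rightarrow> ('a set \<Rightarrow> real^'n) \<Rightarrow> 'a set \<Rightarrow> real" where
  "component l \<nu> A = \<nu> A $ l"

definition distributional_gradient ::
  "(real^'n \<Rightarrow> real) \<Rightarrow> ((real^'n) set \<Rightarrow> real^'n) \<Rightarrow> bool" where
  "distributional_gradient u \<nu> \<longleftrightarrow>
     (\<forall>\<phi>\<in>test_functions. \<forall>i.
        (LINT x|lebesgue. u x * partial_deriv i \<phi> x) = - signed_integral (component i \<nu>) \<phi>)"

definition BV_dot :: "(real^'n \<Rightarrow> real) set" where
  "BV_dot = {u. locally_integrable u \<and> (\<exists>\<nu>\<in>finite_measures. distributional_gradient u \<nu>)}"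


section \<open>Atoms and the spaces \<open>DS\<^sub>\<beta>\<close>\<close>

definition heat_extension :: "real \<Rightarrow> ((real^'n) set \<Rightarrow> real) \<Rightarrow> real^'n \<Rightarrow> real" where
  "heat_extension t \<mu> x =
     1 / (4 * pi * t) powr (real CARD('n) / 2) *
       signed_integral \<mu> (\<lambda>y. exp (- ((norm (x - y))\<^sup>2 / (4 * t))))"

definition is_atom :: "real \<Rightarrow> ((real^'n) set \<Rightarrow> real) \<Rightarrow> bool" where
  "is_atom \<beta> \<mu> \<longleftrightarrow> \<mu> \<in> finite_measures \<and>
     (\<exists>(a :: real^'n) (s :: real). s > 0 \<and>
        (let Q = cbox a (a + (\<chi> i. s)) in
           measure_support \<mu> \<subseteq> Q \<and>
           \<mu> Q = 0 \<and>
           esssup (restrict_space lborel (UNIV \<times> {0<..}))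
             (\<lambda>(x, t). ennreal \<bar>t powr ((real CARD('n) - \<beta>) / 2) * heat_extension t \<mu> x\<bar>)
             \<le> ennreal (1 / s powr \<beta>) \<and>
           total_variation \<mu> UNIV \<le> 1))"

definition atomic_representation ::
  "real \<Rightarrow> ((real^'n) set \<Rightarrow> real) \<Rightarrow> (nat \<Rightarrow> nat \<Rightarrow> real) \<Rightarrow>
     (nat \<Rightarrow> nat \<Rightarrow> (real^'n) set \<Rightarrow> real) \<Rightarrow> bool" where
  "atomic_representation \<beta> \<mu> c m \<longleftrightarrow>
     (\<forall>n. \<forall>i\<in>{1..n}. is_atom \<beta> (m i n)) \<and>
     weak_star_limit (\<lambda>n A. \<Sum>i=1..n. c i n * m i n A) \<mu> \<and>
     limsup (\<lambda>n. ennreal (\<Sum>i=1..n. \<bar>c i n\<bar>)) < \<infinity>"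

definition DS :: "real \<Rightarrow> ((real^'n) set \<Rightarrow> real) set" where
  "DS \<beta> = {\<mu>\<in>finite_measures. \<exists>c m. atomic_representation \<beta> \<mu> c m}"

definition DS_norm :: "real \<Rightarrow> ((real^'n) set \<Rightarrow> real) \<Rightarrow> ennreal" where
  "DS_norm \<beta> \<mu> =
     Inf {limsup (\<lambda>n. ennreal (\<Sum>i=1..n. \<bar>c i n\<bar>)) | c m. atomic_representation \<beta> \<mu> c m}"

end

theory Submission
  imports Defs "HOL-Probability.Distributions" "HOL-Real_Asymp.Real_Asymp"
begin

text \<open>
  The size condition on atoms is automatic for directional derivatives of bounded functions:
  \<open>\<surd>t p\<^sub>t * \<partial>\<^sub>l f = \<surd>t (\<partial>\<^sub>l p\<^sub>t) * f\<close> is bounded by a constant times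
  \<open>sup \<bar>f\<bar>\<close>.  So if \<open>F\<close> lies in a cube of side \<open>s\<close>, then \<open>\<partial>\<^sub>l 1\<^sub>F\<close> is an atom up to the factor
  \<open>s\<^bsup>d-1\<^esup> + \<bar>\<partial>\<^sub>l 1\<^sub>F\<bar>\<close>, and it is enough to write \<open>u\<close> as a superposition of such indicators
  with total cost at most \<open>C \<bar>Du\<bar>\<close>.  This is done for lattice approximations of \<open>u\<close> by local averages:
  the coarea formula reduces to sets, and a dyadic stopping-time argument (Gustin's boxing
  inequality) cuts a finite set into pieces inside disjoint cubes \<open>P\<close>, each of which is paid for by the
  perimeter within \<open>P\<close>.
\<close>

section \<open>Signed measures\<close>

text \<open>The lattice replaces the fine theory of sets of finite perimeter by finite sums: the
  relative isoperimetric inequality comes from a Poincare inequality proved by counting. Two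
  obstacles shape the rest. The discrete gradient must not cost more than a multiple of |Du|; the
  averages are therefore taken against bumps whose lattice differences are, up to scale, partial
  derivatives of test functions that again sum to at most 1. And u need be neither integrable nor
  compactly supported, whereas boxing wants finite support of density at most 1/2 in a dyadic cube;
  the lattice function is therefore recentred by its mean over a large cube and cut off there, and
  the Poincare inequality at that scale keeps the cost under control. In the constant \<open>2 ^ (2
  * CARD('n) + 2) * (1 + 7 * real CARD('n)) * real CARD('n)\<close>, with d for the dimension, the
  power of 2 combines 2^(d+3) from boxing and 2^(d-1) from enlarging the supporting cubes, 1 + 7 d
  is the price of the cut-off, and the last d adds up the coordinate directions.\<close>

lemma suminf_swap_ennreal:
  fixes f :: "nat \<Rightarrow> nat \<Rightarrow> ennreal"
  shows "(\<Sum>i. \<Sum>j. f i j) = (\<Sum>j. \<Sum>i. f i j)"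
proof -
  have "(\<Sum>i. \<Sum>j. f i j) = (\<integral>\<^sup>+i. (\<Sum>j. f i j) \<partial>count_space UNIV)"
    by (simp add: nn_integral_count_space_nat)
  also have "\<dots> = (\<Sum>j. \<integral>\<^sup>+i. f i j \<partial>count_space UNIV)"
    by (subst nn_integral_suminf) auto
  finally show ?thesis by (simp add: nn_integral_count_space_nat)
qed

text \<open>The triangle inequality passes to the limit of partial sums. Absolute convergence is not
  assumed, so the right-hand side may be infinite.\<close>

lemma ennreal_norm_sums_le:
  fixes f :: "nat \<Rightarrow> 'b::real_normed_vector"
  assumes "f sums s"
  shows "ennreal (norm s) \<le> (\<Sum>i. ennreal (norm (f i)))"
proof (rule tendsto_upperbound)
  show "(\<lambda>n. ennreal (norm (\<Sum>i<n. f i))) \<longlonglongrightarrow> ennreal (norm s)"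
    using assms by (intro tendsto_ennrealI tendsto_norm) (simp add: sums_def)
  have "ennreal (norm (\<Sum>i<n. f i)) \<le> (\<Sum>i. ennreal (norm (f i)))" for n
  proof -
    have "ennreal (norm (\<Sum>i<n. f i)) \<le> ennreal (\<Sum>i<n. norm (f i))"
      by (intro ennreal_leI norm_sum)
    also have "\<dots> = (\<Sum>i<n. ennreal (norm (f i)))" by (simp add: sum_ennreal)
    also have "\<dots> \<le> (\<Sum>i. ennreal (norm (f i)))" by (intro sum_le_suminf) auto
    finally show ?thesis .
  qed
  then show "\<forall>\<^sub>F n in sequentially. ennreal (norm (\<Sum>i<n. f i)) \<le> (\<Sum>i. ennreal (norm (f i)))"
    by simp
qed simp

context
  fixes \<mu> :: "'a::topological_space set \<Rightarrow> 'b::real_normed_vector"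
  assumes mu: "\<mu> \<in> finite_measures"
begin

lemma finite_measure_sums:
  "range F \<subseteq> sets borel \<Longrightarrow> disjoint_family F \<Longrightarrow> (\<lambda>i. \<mu> (F i)) sums \<mu> (\<Union>i. F (i::nat))"
  using mu by (auto simp: finite_measures_def)

text \<open>The empty set is a countable disjoint union of copies of itself, and a constant series
  converges only if its term is 0.\<close>

lemma finite_measure_empty: "\<mu> {} = 0"
proof -
  have "(\<lambda>i::nat. \<mu> {}) sums \<mu> {}"
    using finite_measure_sums[of "\<lambda>_. {}"] by (simp add: disjoint_family_on_def)
  then have "summable (\<lambda>i::nat. \<mu> {})" by (rule sums_summable)
  then show ?thesis by (simp only: summable_const_iff)
qed

lemma finite_measure_nonborel: "A \<notin> sets borel \<Longrightarrow> \<mu> A = 0"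
  using mu by (auto simp: finite_measures_def)

lemma total_variation_ge:
  assumes "range F \<subseteq> sets borel" "disjoint_family F" "(\<Union>i. F i) = A"
  shows "(\<Sum>i. ennreal (norm (\<mu> (F i)))) \<le> total_variation \<mu> A"
  unfolding total_variation_def using assms by (intro SUP_upper) auto

lemma norm_le_total_variation: "ennreal (norm (\<mu> A)) \<le> total_variation \<mu> A"
proof (cases "A \<in> sets borel")
  case True
  have "(\<Sum>i. ennreal (norm (\<mu> (if i = 0 then A else {})))) = ennreal (norm (\<mu> A))"
    by (subst suminf_finite[of "{0}"]) (auto simp: finite_measure_empty)
  moreover have "(\<Sum>i::nat. ennreal (norm (\<mu> (if i = 0 then A else {})))) \<le> total_variation \<mu> A"
    using True by (intro total_variation_ge) (auto simp: disjoint_family_on_def split: if_splits)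
  ultimately show ?thesis by simp
qed (simp add: finite_measure_nonborel)

text \<open>A partition of \<open>A\<close> becomes one of \<open>B\<close> when
  \<open>B - A\<close> is put in front, which can only add to the sum.\<close>

lemma total_variation_mono:
  assumes "A \<subseteq> B" "A \<in> sets borel" "B \<in> sets borel"
  shows "total_variation \<mu> A \<le> total_variation \<mu> B"
  unfolding total_variation_def[of _ A]
proof (intro SUP_least, clarsimp)
  fix F :: "nat \<Rightarrow> 'a set" assume F: "range F \<subseteq> sets borel" "disjoint_family F" "A = (\<Union>i. F i)"
  define G where "G i = (case i of 0 \<Rightarrow> B - A | Suc j \<Rightarrow> F j)" for i
  have "disjoint_family G"
    using F(2,3) unfolding disjoint_family_on_def G_def by (auto split: nat.splits)
  moreover have "(\<Union>i. G i) = B"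
  proof -
    have "(\<Union>i. G i) = G 0 \<union> (\<Union>i. G (Suc i))"
      by (metis (no_types) UNIV_nat_eq image_insert image_image Union_insert)
    then show ?thesis using assms F(3) by (auto simp: G_def)
  qed
  moreover have "range G \<subseteq> sets borel" using F(1) assms by (auto simp: G_def split: nat.splits)
  ultimately have G: "(\<Sum>i. ennreal (norm (\<mu> (G i)))) \<le> total_variation \<mu> B"
    by (intro total_variation_ge)
  have "(\<Sum>i. ennreal (norm (\<mu> (F i)))) = (\<Sum>i. ennreal (norm (\<mu> (G (Suc i)))))"
    by (simp add: G_def)
  also have "\<dots> \<le> (\<Sum>i. ennreal (norm (\<mu> (G i))))"
  proof (intro suminf_le_const)
    fix n
    have "(\<Sum>i<n. ennreal (norm (\<mu> (G (Suc i))))) \<le> (\<Sum>i<Suc n. ennreal (norm (\<mu> (G i))))"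
      unfolding sum.lessThan_Suc_shift by simp
    also have "\<dots> \<le> (\<Sum>i. ennreal (norm (\<mu> (G i))))" by (intro sum_le_suminf) auto
    finally show "(\<Sum>i<n. ennreal (norm (\<mu> (G (Suc i))))) \<le> (\<Sum>i. ennreal (norm (\<mu> (G i))))" .
  qed simp
  finally show "(\<Sum>i. ennreal (norm (\<mu> (F i)))) \<le> total_variation \<mu> B"
    using G by simp
qed

lemma total_variation_finite: "A \<in> sets borel \<Longrightarrow> total_variation \<mu> A < \<infinity>"
  using total_variation_mono[of A UNIV] mu by (auto simp: finite_measures_def)

text \<open>For one inequality, near-optimal partitions of the \<open>A i\<close>, with errors
  forming a geometric series, are glued into one partition of the union. For the other, a partition
  of the union is cut along the \<open>A i\<close> and the double series is summed in the other
  order.\<close>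

lemma total_variation_suminf:
  assumes A: "range A \<subseteq> sets borel" "disjoint_family A"
  shows "(\<Sum>i. total_variation \<mu> (A i)) = total_variation \<mu> (\<Union>i. A i)"
proof (rule antisym)
  have Ab: "A i \<in> sets borel" for i using A by auto
  show "(\<Sum>i. total_variation \<mu> (A i)) \<le> total_variation \<mu> (\<Union>i. A i)"
  proof (rule ennreal_le_epsilon)
    fix e :: real assume e: "0 < e"
    have "\<exists>F. range F \<subseteq> sets borel \<and> disjoint_family F \<and> (\<Union>j. F j) = A i \<and>
        total_variation \<mu> (A i) \<le> (\<Sum>j. ennreal (norm (\<mu> (F j)))) + ennreal (e * (1/2)^Suc i)" for i
    proof -
      let ?S = "{F :: nat \<Rightarrow> 'a set. range F \<subseteq> sets borel \<and> disjoint_family F \<and> (\<Union>j. F j) = A i}"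
      have "(\<lambda>j::nat. if j = 0 then A i else {}) \<in> ?S"
        using Ab[of i] by (auto simp: disjoint_family_on_def split: if_splits)
      then have ne: "?S \<noteq> {}" by blast
      have "\<exists>F\<in>?S. total_variation \<mu> (A i) < (\<Sum>j. ennreal (norm (\<mu> (F j)))) + ennreal (e * (1/2)^Suc i)"
        by (rule SUP_approx_ennreal[OF _ ne total_variation_def])
          (use e total_variation_finite[OF Ab[of i]] in auto)
      then show ?thesis by (blast intro: less_imp_le)
    qed
    then obtain F where F: "\<And>i. range (F i) \<subseteq> sets borel" "\<And>i. disjoint_family (F i)"
        "\<And>i. (\<Union>j. F i j) = A i"
        "\<And>i. total_variation \<mu> (A i) \<le> (\<Sum>j. ennreal (norm (\<mu> (F i j)))) + ennreal (e * (1/2)^Suc i)"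
      by metis
    define H where "H k = (case prod_decode k of (i, j) \<Rightarrow> F i j)" for k
    have sub: "F i j \<subseteq> A i" for i j using F(3) by blast
    have H1: "range H \<subseteq> sets borel" using F(1) by (auto simp: H_def split: prod.splits)
    have disj: "F i j \<inter> F i' j' = {}" if "(i, j) \<noteq> (i', j')" for i j i' j'
    proof (cases "i = i'")
      case True then show ?thesis using that F(2)[of i] by (auto simp: disjoint_family_on_def)
    next
      case False
      then have "A i \<inter> A i' = {}" using A(2) by (auto simp: disjoint_family_on_def)
      then show ?thesis using sub by blast
    qed
    have H2: "disjoint_family H"
      unfolding disjoint_family_on_def
    proof (intro ballI impI)
      fix m n :: nat assume "m \<noteq> n"
      then have "prod_decode m \<noteq> prod_decode n" by (metis prod_decode_inverse)
      then show "H m \<inter> H n = {}"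
        using disj[of "fst (prod_decode m)" "snd (prod_decode m)" "fst (prod_decode n)" "snd (prod_decode n)"]
        by (simp add: H_def split_beta)
    qed
    have H3: "(\<Union>k. H k) = (\<Union>i. A i)"
    proof
      show "(\<Union>k. H k) \<subseteq> (\<Union>i. A i)" using sub by (fastforce simp: H_def split: prod.splits)
      show "(\<Union>i. A i) \<subseteq> (\<Union>k. H k)"
      proof
        fix x assume "x \<in> (\<Union>i. A i)"
        then obtain i j where "x \<in> F i j" using F(3) by blast
        then have "x \<in> H (prod_encode (i, j))" by (simp add: H_def)
        then show "x \<in> (\<Union>k. H k)" by blast
      qed
    qed
    have "(\<Sum>i. total_variation \<mu> (A i)) \<le> (\<Sum>i. (\<Sum>j. ennreal (norm (\<mu> (F i j)))) + ennreal (e * (1/2)^Suc i))"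
      by (intro suminf_le F(4)) auto
    also have "\<dots> = (\<Sum>i. \<Sum>j. ennreal (norm (\<mu> (F i j)))) + (\<Sum>i. ennreal (e * (1/2)^Suc i))"
      by (intro suminf_add[symmetric]) auto
    also have "(\<Sum>i. ennreal (e * (1/2)^Suc i)) = ennreal e"
      using e power_half_series by (intro suminf_ennreal_eq) (auto dest: sums_mult[where c=e])
    also have "(\<Sum>i. \<Sum>j. ennreal (norm (\<mu> (F i j)))) = (\<Sum>k. ennreal (norm (\<mu> (H k))))"
      unfolding H_def
      by (subst suminf_ennreal_2dimen[of _ "\<lambda>(i,j). ennreal (norm (\<mu> (F i j)))", symmetric])
         (auto simp: split_beta)
    also have "\<dots> \<le> total_variation \<mu> (\<Union>i. A i)"
      using H1 H2 H3 by (rule total_variation_ge)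
    finally show "(\<Sum>i. total_variation \<mu> (A i)) \<le> total_variation \<mu> (\<Union>i. A i) + ennreal e"
      by (simp add: add_right_mono)
  qed
  show "total_variation \<mu> (\<Union>i. A i) \<le> (\<Sum>i. total_variation \<mu> (A i))"
    unfolding total_variation_def[of _ "\<Union>i. A i"]
  proof (intro SUP_least, clarsimp)
    fix F :: "nat \<Rightarrow> 'a set"
    assume F: "range F \<subseteq> sets borel" "disjoint_family F" "(\<Union>i. F i) = (\<Union>i. A i)"
    have "ennreal (norm (\<mu> (F j))) \<le> (\<Sum>i. ennreal (norm (\<mu> (F j \<inter> A i))))" for j
    proof (rule ennreal_norm_sums_le)
      have "(\<Union>i. F j \<inter> A i) = F j" using F(3) by blast
      then show "(\<lambda>i. \<mu> (F j \<inter> A i)) sums \<mu> (F j)"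
        using finite_measure_sums[of "\<lambda>i. F j \<inter> A i"] F(1) A
        by (fastforce simp: disjoint_family_on_def)
    qed
    then have "(\<Sum>j. ennreal (norm (\<mu> (F j)))) \<le> (\<Sum>j. \<Sum>i. ennreal (norm (\<mu> (F j \<inter> A i))))"
      by (intro suminf_le) auto
    also have "\<dots> = (\<Sum>i. \<Sum>j. ennreal (norm (\<mu> (F j \<inter> A i))))" by (rule suminf_swap_ennreal)
    also have "\<dots> \<le> (\<Sum>i. total_variation \<mu> (A i))"
    proof (intro suminf_le allI total_variation_ge)
      fix i
      show "range (\<lambda>j. F j \<inter> A i) \<subseteq> sets borel" using F(1) Ab by auto
      show "disjoint_family (\<lambda>j. F j \<inter> A i)" using F(2) by (fastforce simp: disjoint_family_on_def)
      show "(\<Union>j. F j \<inter> A i) = A i" using F(3) by blast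
    qed auto
    finally show "(\<Sum>j. ennreal (norm (\<mu> (F j)))) \<le> (\<Sum>i. total_variation \<mu> (A i))" .
  qed
qed

end

text \<open>Equality of two differences of measures is recast as equality of sums, because extended
  nonnegative reals have no well-behaved subtraction. It then passes from sets to functions through
  simple functions and monotone limits.\<close>

lemma nn_integral_add_measures_cong:
  fixes f :: "'a::topological_space \<Rightarrow> ennreal"
  assumes [measurable_cong]: "sets P = sets borel" "sets Q = sets borel" "sets P' = sets borel" "sets Q' = sets borel"
    and eq: "\<And>A. A \<in> sets borel \<Longrightarrow> emeasure P A + emeasure Q A = emeasure P' A + emeasure Q' A"
    and f: "f \<in> borel_measurable borel"
  shows "(\<integral>\<^sup>+x. f x \<partial>P) + (\<integral>\<^sup>+x. f x \<partial>Q) = (\<integral>\<^sup>+x. f x \<partial>P') + (\<integral>\<^sup>+x. f x \<partial>Q')"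
  using f
proof (induction rule: borel_measurable_induct)
  case (cong f g)
  then show ?case by simp
next
  case (set A)
  then show ?case using eq[of A] assms(1-4) by simp
next
  case (mult u c)
  note [measurable] = mult(2)
  show ?case using mult by (simp add: nn_integral_cmult distrib_left[symmetric])
next
  case (add u v)
  note [measurable] = add(1,4)
  show ?case using add by (simp add: nn_integral_add) (metis (no_types, lifting) add.assoc add.left_commute)
next
  case (seq U)
  note [measurable] = seq(1)
  have M: "(\<integral>\<^sup>+x. Sup (range U) x \<partial>M) = (SUP i. \<integral>\<^sup>+x. U i x \<partial>M)" if [measurable_cong]: "sets M = sets borel" for M
    using seq(3) by (simp add: nn_integral_monotone_convergence_SUP image_comp)
  have I: "incseq (\<lambda>i. \<integral>\<^sup>+x. U i x \<partial>M)" for M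
    using seq(3) by (auto simp: incseq_def le_fun_def intro!: nn_integral_mono)
  show ?case
    using seq.IH unfolding M[OF assms(1)] M[OF assms(2)] M[OF assms(3)] M[OF assms(4)]
    by (simp add: ennreal_SUP_add[symmetric] I)
qed

context
  fixes \<nu> :: "'a::topological_space set \<Rightarrow> real"
  assumes nonneg: "\<And>A. A \<in> sets borel \<Longrightarrow> 0 \<le> \<nu> A"
    and sums: "\<And>F :: nat \<Rightarrow> 'a set. range F \<subseteq> sets borel \<Longrightarrow> disjoint_family F \<Longrightarrow>
      (\<lambda>i. \<nu> (F i)) sums \<nu> (\<Union>i. F i)"
begin

text \<open>\<open>measure_of\<close> falls back to the zero measure unless its argument is
  countably additive; this discharges that condition for set functions with real values.\<close>

lemma emeasure_measure_of_real:
  assumes "A \<in> sets borel"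
  shows "emeasure (measure_of UNIV (sets borel) (\<lambda>A. ennreal (\<nu> A))) A = ennreal (\<nu> A)"
proof (rule emeasure_measure_of_sigma[OF _ _ _ assms])
  show "sigma_algebra UNIV (sets (borel :: 'a measure))"
    by (metis sets.sigma_algebra_axioms space_borel)
  have "(\<lambda>i::nat. \<nu> {}) sums \<nu> {}"
    using sums[of "\<lambda>_. {}"] by (simp add: disjoint_family_on_def)
  then have "\<nu> {} = 0" by (metis sums_summable summable_const_iff)
  then show "positive (sets borel) (\<lambda>A. ennreal (\<nu> A))" by (simp add: positive_def)
  show "countably_additive (sets borel) (\<lambda>A. ennreal (\<nu> A))"
    unfolding countably_additive_def
    by (intro allI impI suminf_ennreal_eq sums nonneg) auto
qed

lemma sets_measure_of_real: "sets (measure_of UNIV (sets borel) (\<lambda>A. ennreal (\<nu> A))) = sets (borel::'a measure)"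
  by (metis sets.sets_measure_of_eq space_borel)

end

section \<open>Total variation as a real number, Jordan parts, and integration\<close>

definition tv :: "('a::topological_space set \<Rightarrow> 'b::real_normed_vector) \<Rightarrow> 'a set \<Rightarrow> real" where
  "tv \<mu> A = enn2real (total_variation \<mu> A)"

lemma tv_nonneg[simp]: "0 \<le> tv \<mu> A" by (simp add: tv_def)

lemma ennreal_tv: "\<mu> \<in> finite_measures \<Longrightarrow> A \<in> sets borel \<Longrightarrow> ennreal (tv \<mu> A) = total_variation \<mu> A"
  using total_variation_finite[of \<mu> A] by (simp add: tv_def)

lemma signed_integral_cmult: "signed_integral \<mu> (\<lambda>x. c * f x) = c * signed_integral \<mu> f"
  unfolding signed_integral_def by (simp add: algebra_simps)

context
  fixes \<mu> :: "'a::topological_space set \<Rightarrow> real"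
  assumes mu: "\<mu> \<in> finite_measures"
begin

lemma abs_le_tv: "A \<in> sets borel \<Longrightarrow> \<bar>\<mu> A\<bar> \<le> tv \<mu> A"
  using norm_le_total_variation[OF mu, of A] ennreal_tv[OF mu, of A]
  by (simp add: ennreal_le_iff[symmetric] del: ennreal_le_iff)

lemma tv_sums:
  assumes "range F \<subseteq> sets borel" "disjoint_family F"
  shows "(\<lambda>i. tv \<mu> (F i)) sums tv \<mu> (\<Union>i. F (i::nat))"
proof -
  have F: "F i \<in> sets borel" for i using assms by auto
  then have U: "(\<Union>i. F i) \<in> sets borel" by auto
  have *: "(\<Sum>i. ennreal (tv \<mu> (F i))) = ennreal (tv \<mu> (\<Union>i. F i))"
    using total_variation_suminf[OF mu assms] F U by (simp add: ennreal_tv[OF mu])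
  then have "summable (\<lambda>i. tv \<mu> (F i))"
    by (intro summable_suminf_not_top) auto
  then show ?thesis using * by (simp add: suminf_ennreal2 sums_iff suminf_nonneg)
qed

text \<open>The absolute value of \<open>\<mu> A\<close> is at most \<open>tv \<mu> A\<close>, so
  both half-sums are nonnegative and countably additive, and the Jordan parts take the values
  announced in their definitions.\<close>

lemma
  shows sets_pos_part: "sets (pos_part \<mu>) = sets borel"
    and sets_neg_part: "sets (neg_part \<mu>) = sets borel"
    and emeasure_pos_part: "A \<in> sets borel \<Longrightarrow> emeasure (pos_part \<mu>) A = ennreal ((tv \<mu> A + \<mu> A) / 2)"
    and emeasure_neg_part: "A \<in> sets borel \<Longrightarrow> emeasure (neg_part \<mu>) A = ennreal ((tv \<mu> A - \<mu> A) / 2)"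
proof -
  have 1: "0 \<le> (tv \<mu> A + \<mu> A) / 2" "0 \<le> (tv \<mu> A - \<mu> A) / 2" if "A \<in> sets borel" for A
    using abs_le_tv[OF that] by auto
  have 2: "(\<lambda>i. (tv \<mu> (F i) + \<mu> (F i)) / 2) sums ((tv \<mu> (\<Union>i. F i) + \<mu> (\<Union>i. F i)) / 2)"
    "(\<lambda>i. (tv \<mu> (F i) - \<mu> (F i)) / 2) sums ((tv \<mu> (\<Union>i. F i) - \<mu> (\<Union>i. F i)) / 2)"
    if "range F \<subseteq> sets borel" "disjoint_family F" for F :: "nat \<Rightarrow> 'a set"
    using tv_sums[OF that] finite_measure_sums[OF mu that]
    by (auto intro!: sums_divide sums_add sums_diff)
  show "sets (pos_part \<mu>) = sets borel" "sets (neg_part \<mu>) = sets borel"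
    unfolding pos_part_def neg_part_def tv_def[symmetric]
    by (rule sets_measure_of_real; use 1 2 in auto)+
  show "A \<in> sets borel \<Longrightarrow> emeasure (pos_part \<mu>) A = ennreal ((tv \<mu> A + \<mu> A) / 2)"
    "A \<in> sets borel \<Longrightarrow> emeasure (neg_part \<mu>) A = ennreal ((tv \<mu> A - \<mu> A) / 2)"
    unfolding pos_part_def neg_part_def tv_def[symmetric]
    by (rule emeasure_measure_of_real; use 1 2 in auto)+
qed

lemma finite_measure_pos_part: "finite_measure (pos_part \<mu>)"
  and finite_measure_neg_part: "finite_measure (neg_part \<mu>)"
proof -
  have sp: "space (pos_part \<mu>) = UNIV" "space (neg_part \<mu>) = UNIV"
    using sets_eq_imp_space_eq[OF sets_pos_part] sets_eq_imp_space_eq[OF sets_neg_part] by auto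
  show "finite_measure (pos_part \<mu>)" "finite_measure (neg_part \<mu>)"
    by (auto intro!: finite_measureI simp: sp emeasure_pos_part emeasure_neg_part)
qed

lemma measure_pos_part: "A \<in> sets borel \<Longrightarrow> measure (pos_part \<mu>) A = (tv \<mu> A + \<mu> A) / 2"
  and measure_neg_part: "A \<in> sets borel \<Longrightarrow> measure (neg_part \<mu>) A = (tv \<mu> A - \<mu> A) / 2"
  using abs_le_tv[of A] by (auto simp: measure_def emeasure_pos_part emeasure_neg_part)

lemma integrable_pos_neg_part:
  fixes f :: "'a \<Rightarrow> real"
  assumes [measurable]: "f \<in> borel_measurable borel" and B: "\<And>x. \<bar>f x\<bar> \<le> B"
  shows "integrable (pos_part \<mu>) f" "integrable (neg_part \<mu>) f"
proof -
  interpret P: finite_measure "pos_part \<mu>" by (rule finite_measure_pos_part)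
  interpret N: finite_measure "neg_part \<mu>" by (rule finite_measure_neg_part)
  show "integrable (pos_part \<mu>) f"
    by (rule P.integrable_const_bound[where B=B]) (use B sets_pos_part in \<open>auto simp: measurable_cong_sets[of "pos_part \<mu>" borel]\<close>)
  show "integrable (neg_part \<mu>) f"
    by (rule N.integrable_const_bound[where B=B]) (use B sets_neg_part in \<open>auto simp: measurable_cong_sets[of "neg_part \<mu>" borel]\<close>)
qed

lemma signed_integral_add:
  fixes f g :: "'a \<Rightarrow> real"
  assumes "f \<in> borel_measurable borel" "\<And>x. \<bar>f x\<bar> \<le> B" "g \<in> borel_measurable borel" "\<And>x. \<bar>g x\<bar> \<le> B'"
  shows "signed_integral \<mu> (\<lambda>x. f x + g x) = signed_integral \<mu> f + signed_integral \<mu> g"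
  unfolding signed_integral_def
  using integrable_pos_neg_part[OF assms(1,2)] integrable_pos_neg_part[OF assms(3,4)] by simp

lemma signed_integral_sum:
  fixes f :: "'i \<Rightarrow> 'a \<Rightarrow> real"
  assumes "finite I" "\<And>i. i \<in> I \<Longrightarrow> f i \<in> borel_measurable borel" "\<And>i x. i \<in> I \<Longrightarrow> \<bar>f i x\<bar> \<le> B i"
  shows "signed_integral \<mu> (\<lambda>x. \<Sum>i\<in>I. f i x) = (\<Sum>i\<in>I. signed_integral \<mu> (f i))"
  using integrable_pos_neg_part[OF assms(2,3)]
  unfolding signed_integral_def by (simp add: sum_subtractf)

text \<open>The two Jordan parts add up to the total variation measure. Asking for a bound on the
  sum at each point, instead of one on each \<open>f i\<close>, suits partitions of unity with
  arbitrarily many members.\<close>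

lemma sum_abs_signed_integral_le:
  fixes f :: "'i \<Rightarrow> 'a \<Rightarrow> real"
  assumes I: "finite I" and f: "\<And>i. i \<in> I \<Longrightarrow> f i \<in> borel_measurable borel"
    and B: "\<And>x. (\<Sum>i\<in>I. \<bar>f i x\<bar>) \<le> B"
  shows "(\<Sum>i\<in>I. \<bar>signed_integral \<mu> (f i)\<bar>) \<le> B * tv \<mu> UNIV"
proof -
  have B1: "\<bar>f i x\<bar> \<le> B" if "i \<in> I" for i x
    using member_le_sum[of i I "\<lambda>i. \<bar>f i x\<bar>"] that I B[of x] by auto
  have i: "integrable (pos_part \<mu>) (f i)" "integrable (neg_part \<mu>) (f i)" if "i \<in> I" for i
    using integrable_pos_neg_part[OF f[OF that] B1[OF that]] .
  interpret P: finite_measure "pos_part \<mu>" by (rule finite_measure_pos_part)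
  interpret N: finite_measure "neg_part \<mu>" by (rule finite_measure_neg_part)
  have sp: "space (pos_part \<mu>) = UNIV" "space (neg_part \<mu>) = UNIV"
    using sets_eq_imp_space_eq[OF sets_pos_part] sets_eq_imp_space_eq[OF sets_neg_part] by auto
  have "(\<Sum>i\<in>I. \<bar>signed_integral \<mu> (f i)\<bar>) \<le> (\<Sum>i\<in>I. (LINT x|pos_part \<mu>. \<bar>f i x\<bar>) + (LINT x|neg_part \<mu>. \<bar>f i x\<bar>))"
    unfolding signed_integral_def
    by (intro sum_mono order.trans[OF abs_triangle_ineq4] add_mono integral_abs_bound)
  also have "\<dots> = (LINT x|pos_part \<mu>. (\<Sum>i\<in>I. \<bar>f i x\<bar>)) + (LINT x|neg_part \<mu>. (\<Sum>i\<in>I. \<bar>f i x\<bar>))"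
    using i by (simp add: sum.distrib)
  also have "\<dots> \<le> (LINT x|pos_part \<mu>. B) + (LINT x|neg_part \<mu>. B)"
    using i B by (intro add_mono integral_mono) auto
  also have "\<dots> = B * (measure (pos_part \<mu>) UNIV + measure (neg_part \<mu>) UNIV)"
    by (simp add: sp algebra_simps)
  also have "\<dots> = B * tv \<mu> UNIV"
    by (simp add: measure_pos_part measure_neg_part field_simps)
  finally show ?thesis .
qed

lemma abs_signed_integral_le:
  fixes f :: "'a \<Rightarrow> real"
  assumes f: "f \<in> borel_measurable borel" and B: "\<And>x. \<bar>f x\<bar> \<le> B"
  shows "\<bar>signed_integral \<mu> f\<bar> \<le> B * tv \<mu> UNIV"
  using sum_abs_signed_integral_le[of "{()}" "\<lambda>_. f" B] assms by simp

text \<open>Cross-adding turns two splittings of \<open>\<mu>\<close> into equal sums: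
  \<open>pos_part \<mu>\<close> plus \<open>N\<close> against \<open>P\<close> plus
  \<open>neg_part \<mu>\<close>. Hence any splitting into finite measures computes the integral that
  is defined through the Jordan one.\<close>

lemma signed_integral_eq_diff:
  fixes f :: "'a \<Rightarrow> real"
  assumes [measurable_cong]: "sets P = sets borel" "sets N = sets borel" and fin: "finite_measure P" "finite_measure N"
    and eq: "\<And>A. A \<in> sets borel \<Longrightarrow> \<mu> A = measure P A - measure N A"
    and f[measurable]: "f \<in> borel_measurable borel" and B: "\<And>x. \<bar>f x\<bar> \<le> B"
  shows "signed_integral \<mu> f = (LINT x|P. f x) - (LINT x|N. f x)"
proof -
  interpret P: finite_measure P by fact
  interpret N: finite_measure N by fact
  have iP: "integrable P f"
    by (rule P.integrable_const_bound[where B=B]) (use B in auto)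
  have iN: "integrable N f"
    by (rule N.integrable_const_bound[where B=B]) (use B in auto)
  note ip = integrable_pos_neg_part[OF f B]
  have *: "(\<integral>\<^sup>+x. g x \<partial>pos_part \<mu>) + (\<integral>\<^sup>+x. g x \<partial>N) = (\<integral>\<^sup>+x. g x \<partial>P) + (\<integral>\<^sup>+x. g x \<partial>neg_part \<mu>)"
    if "g \<in> borel_measurable borel" for g
  proof (rule nn_integral_add_measures_cong[OF sets_pos_part assms(2,1) sets_neg_part _ that])
    fix A :: "'a set" assume A: "A \<in> sets borel"
    have "0 \<le> (tv \<mu> A + \<mu> A) / 2" "0 \<le> (tv \<mu> A - \<mu> A) / 2" using abs_le_tv[OF A] by auto
    moreover have "(tv \<mu> A + \<mu> A) / 2 + measure N A = measure P A + (tv \<mu> A - \<mu> A) / 2"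
      using eq[OF A] by (simp add: field_simps)
    ultimately show "emeasure (pos_part \<mu>) A + emeasure N A = emeasure P A + emeasure (neg_part \<mu>) A"
      by (simp add: emeasure_pos_part[OF A] emeasure_neg_part[OF A] P.emeasure_eq_measure
        N.emeasure_eq_measure ennreal_plus[symmetric] del: ennreal_plus)
  qed
  have fin: "(\<integral>\<^sup>+x. ennreal (g x) \<partial>M) = ennreal (enn2real (\<integral>\<^sup>+x. ennreal (g x) \<partial>M))"
    if "integrable M g" for M :: "'a measure" and g
  proof -
    have "(\<integral>\<^sup>+x. ennreal (g x) \<partial>M) \<le> (\<integral>\<^sup>+x. ennreal (norm (g x)) \<partial>M)"
      by (intro nn_integral_mono ennreal_leI) simp
    also have "\<dots> < \<infinity>" using that by (simp add: integrable_iff_bounded)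
    finally show ?thesis by simp
  qed
  define e where "e M g = enn2real (\<integral>\<^sup>+x. ennreal (g x) \<partial>M)" for M and g :: "'a \<Rightarrow> real"
  have **: "e (pos_part \<mu>) g + e N g = e P g + e (neg_part \<mu>) g"
    if "g \<in> borel_measurable borel" "integrable (pos_part \<mu>) g" "integrable N g" "integrable P g" "integrable (neg_part \<mu>) g" for g
  proof -
    have "ennreal (e (pos_part \<mu>) g) + ennreal (e N g) = ennreal (e P g) + ennreal (e (neg_part \<mu>) g)"
      unfolding e_def using *[of "\<lambda>x. ennreal (g x)"] that by (simp add: fin[symmetric])
    then show ?thesis
      by (simp add: ennreal_plus[symmetric] e_def del: ennreal_plus)
  qed
  \<comment> \<open>A real integral is the difference of the nonnegative integrals of
    \<open>f\<close> and of its negative, so the cross-added identity is used once for each.\<close>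
  show ?thesis
    unfolding signed_integral_def real_lebesgue_integral_def[OF ip(1)] real_lebesgue_integral_def[OF ip(2)]
      real_lebesgue_integral_def[OF iP] real_lebesgue_integral_def[OF iN]
    using **[of f] **[of "\<lambda>x. - f x"] ip iP iN by (simp add: e_def)
qed

end

section \<open>Measures with a density\<close>

lemma integrable_bounded_mult:
  fixes f h :: "'a \<Rightarrow> real"
  assumes h: "integrable M h" and f: "f \<in> borel_measurable M" and B: "\<And>x. \<bar>f x\<bar> \<le> B"
  shows "integrable M (\<lambda>x. f x * h x)"
proof (rule Bochner_Integration.integrable_bound)
  show "integrable M (\<lambda>x. B * h x)" using h by simp
  have "\<bar>f x\<bar> * \<bar>h x\<bar> \<le> \<bar>B\<bar> * \<bar>h x\<bar>" for x using B[of x] by (intro mult_right_mono) auto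
  then show "AE x in M. norm (f x * h x) \<le> norm (B * h x)" by (simp add: abs_mult)
  show "(\<lambda>x. f x * h x) \<in> borel_measurable M" using f h by auto
qed

text \<open>The measure h dx. The value 0 off the Borel sets is the convention built into
  \<open>finite_measures\<close>.\<close>

definition density_sm :: "('a::euclidean_space \<Rightarrow> real) \<Rightarrow> 'a set \<Rightarrow> real" where
  "density_sm h A = (if A \<in> sets borel then LINT x|lborel. indicator A x * h x else 0)"

context
  fixes h :: "'a::euclidean_space \<Rightarrow> real"
  assumes h: "integrable lborel h"
begin

lemma integrable_indicator_density: "A \<in> sets borel \<Longrightarrow> integrable lborel (\<lambda>x. indicator A x * h x)"
  using integrable_mult_indicator[of A lborel h] h by simp

lemma abs_density_sm_le:
  assumes A: "A \<in> sets borel"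
  shows "ennreal \<bar>density_sm h A\<bar> \<le> (\<integral>\<^sup>+x. indicator A x * ennreal \<bar>h x\<bar> \<partial>lborel)"
proof -
  have "\<bar>density_sm h A\<bar> \<le> (LINT x|lborel. \<bar>indicator A x * h x\<bar>)"
    using A by (simp add: density_sm_def)
  then have "ennreal \<bar>density_sm h A\<bar> \<le> ennreal (LINT x|lborel. \<bar>indicator A x * h x\<bar>)"
    by (rule ennreal_leI)
  also have "\<dots> = (\<integral>\<^sup>+x. ennreal \<bar>indicator A x * h x\<bar> \<partial>lborel)"
    using integrable_indicator_density[OF A] by (intro nn_integral_eq_integral[symmetric]) auto
  also have "\<dots> = (\<integral>\<^sup>+x. indicator A x * ennreal \<bar>h x\<bar> \<partial>lborel)"
    by (intro nn_integral_cong) (auto simp: indicator_def)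
  finally show ?thesis .
qed

lemma suminf_abs_density_sm_le:
  assumes F: "range F \<subseteq> sets borel" "disjoint_family F"
  shows "(\<Sum>i. ennreal \<bar>density_sm h (F i)\<bar>) \<le> (\<integral>\<^sup>+x. indicator (\<Union>i. F (i::nat)) x * ennreal \<bar>h x\<bar> \<partial>lborel)"
proof -
  have [measurable]: "F i \<in> sets borel" for i using F(1) by auto
  have [measurable]: "h \<in> borel_measurable borel" using h by auto
  have "(\<Sum>i. ennreal \<bar>density_sm h (F i)\<bar>) \<le> (\<Sum>i. \<integral>\<^sup>+x. indicator (F i) x * ennreal \<bar>h x\<bar> \<partial>lborel)"
    by (intro suminf_le abs_density_sm_le) auto
  also have "\<dots> = (\<integral>\<^sup>+x. (\<Sum>i. indicator (F i) x * ennreal \<bar>h x\<bar>) \<partial>lborel)"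
    by (rule nn_integral_suminf[symmetric]) measurable
  also have "\<dots> = (\<integral>\<^sup>+x. indicator (\<Union>i. F i) x * ennreal \<bar>h x\<bar> \<partial>lborel)"
    by (intro nn_integral_cong) (simp add: suminf_indicator[OF F(2), symmetric])
  finally show ?thesis .
qed

lemma density_sm_sums:
  assumes F: "range F \<subseteq> sets borel" "disjoint_family F"
  shows "(\<lambda>i. density_sm h (F i)) sums density_sm h (\<Union>i. F (i::nat))"
proof -
  have Fb: "F i \<in> sets borel" for i using F by auto
  have U: "(\<Union>i. F i) \<in> sets borel" using Fb by auto
  have "(\<integral>\<^sup>+x. indicator (\<Union>i. F i) x * ennreal \<bar>h x\<bar> \<partial>lborel) \<le> (\<integral>\<^sup>+x. ennreal \<bar>h x\<bar> \<partial>lborel)"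
    by (intro nn_integral_mono) (auto simp: indicator_def)
  also have "\<dots> < \<infinity>" using h by (simp add: integrable_iff_bounded)
  finally have "(\<Sum>i. ennreal \<bar>density_sm h (F i)\<bar>) \<noteq> \<infinity>"
    using suminf_abs_density_sm_le[OF F] by (auto simp: top_unique)
  then have "summable (\<lambda>i. \<bar>density_sm h (F i)\<bar>)" by (intro summable_suminf_not_top) auto
  then have "summable (\<lambda>i. density_sm h (F i))" by (rule summable_rabs_cancel)
  moreover have "density_sm h (\<Union>i. F i) = (\<Sum>i. density_sm h (F i))"
    using lebesgue_integral_countable_add[of F lborel h] F(2) Fb U integrable_indicator_density[OF U]
    by (auto simp: density_sm_def set_lebesgue_integral_def set_integrable_def disjoint_family_on_def)
  ultimately show ?thesis by (simp add: sums_iff)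
qed

lemma total_variation_density_sm_le:
  "total_variation (density_sm h) A \<le> (\<integral>\<^sup>+x. indicator A x * ennreal \<bar>h x\<bar> \<partial>lborel)"
  unfolding total_variation_def
proof (rule SUP_least)
  fix F :: "nat \<Rightarrow> 'a set"
  assume "F \<in> {F. range F \<subseteq> sets borel \<and> disjoint_family F \<and> (\<Union>i. F i) = A}"
  then show "(\<Sum>i. ennreal (norm (density_sm h (F i)))) \<le> (\<integral>\<^sup>+x. indicator A x * ennreal \<bar>h x\<bar> \<partial>lborel)"
    unfolding real_norm_def by clarify (rule suminf_abs_density_sm_le)
qed

lemma density_sm_finite: "density_sm h \<in> finite_measures"
proof -
  have "total_variation (density_sm h) UNIV \<le> (\<integral>\<^sup>+x. ennreal \<bar>h x\<bar> \<partial>lborel)"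
    using total_variation_density_sm_le[of UNIV] by simp
  also have "\<dots> < \<infinity>" using h by (simp add: integrable_iff_bounded)
  finally show ?thesis
    using density_sm_sums by (auto simp: finite_measures_def density_sm_def)
qed

text \<open>The positive and negative parts of \<open>h\<close> are densities of two finite measures
  whose difference is \<open>density_sm h\<close>. Every such splitting gives the same integral, so
  the Jordan parts never have to be identified.\<close>

lemma signed_integral_density_sm:
  fixes f :: "'a \<Rightarrow> real"
  assumes f[measurable]: "f \<in> borel_measurable borel" and B: "\<And>x. \<bar>f x\<bar> \<le> B"
  shows "signed_integral (density_sm h) f = (LINT x|lborel. f x * h x)"
proof -
  have hm[measurable]: "h \<in> borel_measurable borel" using h by auto
  have hp: "integrable lborel (\<lambda>x. max 0 (h x))" "integrable lborel (\<lambda>x. max 0 (- h x))"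
    using h by auto
  let ?P = "density lborel (\<lambda>x. ennreal (max 0 (h x)))" and ?N = "density lborel (\<lambda>x. ennreal (max 0 (- h x)))"
  have fin: "finite_measure (density lborel (\<lambda>x. ennreal (g x)))"
    if "integrable lborel g" "\<And>x. 0 \<le> g x" for g :: "'a \<Rightarrow> real"
    using that by (intro finite_measureI) (auto simp: emeasure_density integrable_iff_bounded)
  have meas: "measure (density lborel (\<lambda>x. ennreal (g x))) A = (LINT x|lborel. indicator A x * g x)"
    if "integrable lborel g" "\<And>x. 0 \<le> g x" "A \<in> sets borel" for g :: "'a \<Rightarrow> real" and A
  proof -
    have "emeasure (density lborel (\<lambda>x. ennreal (g x))) A = (\<integral>\<^sup>+x. ennreal (indicator A x * g x) \<partial>lborel)"
      using that by (auto simp: emeasure_density intro!: nn_integral_cong split: split_indicator)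
    also have "\<dots> = ennreal (LINT x|lborel. indicator A x * g x)"
      using that integrable_mult_indicator[of A lborel g]
      by (intro nn_integral_eq_integral) auto
    finally show ?thesis
      using that by (simp add: measure_def integral_nonneg_AE)
  qed
  have fi: "integrable lborel (\<lambda>x. g x * f x)" if "integrable lborel g" for g :: "'a \<Rightarrow> real"
    using integrable_bounded_mult[where f=f, OF that _ B] by (simp add: mult.commute)
  have "signed_integral (density_sm h) f = (LINT x|?P. f x) - (LINT x|?N. f x)"
  proof (rule signed_integral_eq_diff[OF density_sm_finite _ _ fin fin _ f B])
    fix A :: "'a set" assume A: "A \<in> sets borel"
    have "density_sm h A = (LINT x|lborel. indicator A x * max 0 (h x) - indicator A x * max 0 (- h x))"
      using A unfolding density_sm_def by (simp only: if_True) (intro Bochner_Integration.integral_cong refl, simp add: max_def)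
    also have "\<dots> = (LINT x|lborel. indicator A x * max 0 (h x)) - (LINT x|lborel. indicator A x * max 0 (- h x))"
      using integrable_mult_indicator[of A lborel, OF _ hp(1)] integrable_mult_indicator[of A lborel, OF _ hp(2)] A
      by (intro Bochner_Integration.integral_diff) simp_all
    finally show "density_sm h A = measure ?P A - measure ?N A"
      using A hp by (simp add: meas)
  qed (use hp in auto)
  also have "\<dots> = (LINT x|lborel. max 0 (h x) * f x) - (LINT x|lborel. max 0 (- h x) * f x)"
    by (simp add: integral_real_density)
  also have "\<dots> = (LINT x|lborel. max 0 (h x) * f x - max 0 (- h x) * f x)"
    using fi hp by (intro Bochner_Integration.integral_diff[symmetric]) auto
  also have "\<dots> = (LINT x|lborel. f x * h x)"
    by (intro Bochner_Integration.integral_cong) (auto simp: max_def)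
  finally show ?thesis .
qed

end

lemma density_sm_add:
  "integrable lborel h \<Longrightarrow> integrable lborel k \<Longrightarrow> density_sm (\<lambda>x. h x + k x) A = density_sm h A + density_sm k A"
  by (simp add: density_sm_def distrib_left integrable_indicator_density)

lemma density_sm_cmult: "density_sm (\<lambda>x. c * h x) A = c * density_sm h A"
  by (simp add: density_sm_def mult.left_commute)

section \<open>Discrete boxing inequality\<close>

text \<open>Half-open, so that a cube of side 2 s is the disjoint union of cubes of side s. A
  lattice point stands for a mesh cell, hence s points per direction for side s.\<close>

definition cube :: "('n \<Rightarrow> int) \<Rightarrow> nat \<Rightarrow> ('n \<Rightarrow> int) set" where
  "cube c s = {x. \<forall>i. c i \<le> x i \<and> x i < c i + int s}"

definition shift :: "'n \<Rightarrow> ('n \<Rightarrow> int) \<Rightarrow> 'n \<Rightarrow> int" where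
  "shift i x = x(i := x i + 1)"

text \<open>Only edges with both ends in \<open>Q\<close> count. This makes the variation
  superadditive over disjoint cubes, which is what lets disjoint cubes be paid for
  independently.\<close>

definition dir_variation :: "('n \<Rightarrow> int) set \<Rightarrow> 'n \<Rightarrow> (('n \<Rightarrow> int) \<Rightarrow> real) \<Rightarrow> real" where
  "dir_variation Q i g = (\<Sum>x\<in>{x\<in>Q. shift i x \<in> Q}. \<bar>g (shift i x) - g x\<bar>)"

definition variation :: "('n::finite \<Rightarrow> int) set \<Rightarrow> (('n \<Rightarrow> int) \<Rightarrow> real) \<Rightarrow> real" where
  "variation Q g = (\<Sum>i\<in>UNIV. dir_variation Q i g)"

lemma dir_variation_nonneg: "0 \<le> dir_variation Q i g"
  by (simp add: dir_variation_def sum_nonneg)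

lemma dir_variation_le_variation: "dir_variation Q i g \<le> variation Q g"
  unfolding variation_def by (rule member_le_sum) (auto simp: dir_variation_nonneg)

lemma variation_nonneg: "0 \<le> variation Q g"
  by (simp add: variation_def sum_nonneg dir_variation_nonneg)

lemma finite_card_lattice_box:
  fixes A :: "'n::finite \<Rightarrow> int set"
  assumes "\<And>i. finite (A i)"
  shows "finite {x. \<forall>i. x i \<in> A i}" "card {x. \<forall>i. x i \<in> A i} = (\<Prod>i\<in>UNIV. card (A i))"
proof -
  have *: "{x. \<forall>i. x i \<in> A i} = PiE UNIV A" by (auto simp: PiE_def Pi_def)
  show "finite {x. \<forall>i. x i \<in> A i}" "card {x. \<forall>i. x i \<in> A i} = (\<Prod>i\<in>UNIV. card (A i))"
    unfolding * using assms by (auto simp: finite_PiE card_PiE)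
qed

lemma cube_eq: "cube c s = {x. \<forall>i. x i \<in> {c i..<c i + int s}}"
  by (auto simp: cube_def)

lemma finite_cube [simp]: "finite (cube (c :: 'n::finite \<Rightarrow> int) s)"
  unfolding cube_eq by (rule finite_card_lattice_box) simp

lemma card_cube: "card (cube (c :: 'n::finite \<Rightarrow> int) s) = s ^ CARD('n)"
  unfolding cube_eq by (subst finite_card_lattice_box) auto

section \<open>A Poincare inequality on lattice cubes\<close>

text \<open>Telescoping along the interval. The guard \<open>m + 1 < e\<close> drops the step that
  would leave it, in agreement with the edges counted by \<open>dir_variation\<close>.\<close>

lemma abs_diff_le_sum_steps:
  fixes f :: "int \<Rightarrow> real"
  assumes "a \<in> {c..<e}" "b \<in> {c..<e}"
  shows "\<bar>f b - f a\<bar> \<le> (\<Sum>m\<in>{c..<e}. if m + 1 < e then \<bar>f (m + 1) - f m\<bar> else 0)"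
proof -
  have *: "\<bar>f b - f a\<bar> \<le> (\<Sum>m\<in>{c..<e}. if m + 1 < e then \<bar>f (m + 1) - f m\<bar> else 0)"
    if ab: "a \<le> b" "c \<le> a" "b < e" for a b
  proof -
    have "\<bar>f b - f a\<bar> \<le> (\<Sum>m\<in>{a..<b}. \<bar>f (m + 1) - f m\<bar>)"
      using ab(1)
    proof (induction b rule: int_ge_induct)
      case (step i)
      have "{a..<i+1} = insert i {a..<i}" using step by auto
      then show ?case using step by auto
    qed simp
    also have "\<dots> = (\<Sum>m\<in>{a..<b}. if m + 1 < e then \<bar>f (m + 1) - f m\<bar> else 0)"
      using ab by (intro sum.cong) auto
    also have "\<dots> \<le> (\<Sum>m\<in>{c..<e}. if m + 1 < e then \<bar>f (m + 1) - f m\<bar> else 0)"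
      using ab by (intro sum_mono2) auto
    finally show ?thesis .
  qed
  show ?thesis
    using *[of a b] *[of b a] assms by (cases "a \<le> b") (auto simp: abs_minus_commute)
qed

text \<open>Replacing one coordinate of \<open>z\<close> moves along a line of \<open>s\<close>
  points and changes \<open>g\<close> by at most the total of the steps on that line. Summation over
  \<open>w\<close> gives the factor \<open>card (cube c s)\<close>, and each edge is met once for
  each of the \<open>s\<close> points on its line.\<close>

lemma sum_line_diff_le:
  fixes c :: "'n::finite \<Rightarrow> int"
  shows "(\<Sum>z\<in>cube c s. \<Sum>w\<in>cube c s. \<bar>g (z(i := w i)) - g z\<bar>)
    \<le> real (card (cube c s)) * real s * dir_variation (cube c s) i g"
proof -
  let ?Q = "cube c s" and ?I = "{c i..<c i + int s}"
  define D where "D x = (if shift i x \<in> ?Q then \<bar>g (shift i x) - g x\<bar> else 0)" for x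
  have "\<bar>g (z(i := w i)) - g z\<bar> \<le> (\<Sum>m\<in>?I. D (z(i := m)))" if "z \<in> ?Q" "w \<in> ?Q" for z w
  proof -
    have zw: "z i \<in> ?I" "w i \<in> ?I" using that by (auto simp: cube_def)
    have "\<bar>g (z(i := w i)) - g (z(i := z i))\<bar> \<le>
        (\<Sum>m\<in>?I. if m + 1 < c i + int s then \<bar>g (z(i := m + 1)) - g (z(i := m))\<bar> else 0)"
      using abs_diff_le_sum_steps[OF zw, of "\<lambda>m. g (z(i := m))"] by simp
    also have "\<dots> = (\<Sum>m\<in>?I. D (z(i := m)))"
      using that by (intro sum.cong refl) (auto simp: D_def shift_def cube_def)
    finally show ?thesis by simp
  qed
  then have "(\<Sum>z\<in>?Q. \<Sum>w\<in>?Q. \<bar>g (z(i := w i)) - g z\<bar>) \<le> (\<Sum>z\<in>?Q. \<Sum>w\<in>?Q. \<Sum>m\<in>?I. D (z(i := m)))"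
    by (intro sum_mono)
  also have "\<dots> = real (card ?Q) * (\<Sum>z\<in>?Q. \<Sum>m\<in>?I. D (z(i := m)))"
    by (simp add: sum_distrib_left)
  also have "(\<Sum>z\<in>?Q. \<Sum>m\<in>?I. D (z(i := m))) = (\<Sum>(z, m)\<in>?Q \<times> ?I. D (z(i := m)))"
    by (simp add: sum.cartesian_product)
  \<comment> \<open>The involution that exchanges \<open>z i\<close> with \<open>m\<close> leaves a
    summand depending on \<open>z\<close> alone.\<close>
  also have "\<dots> = (\<Sum>(z, m)\<in>?Q \<times> ?I. D z)"
    by (rule sum.reindex_bij_witness[where i="\<lambda>(z, m). (z(i := m), z i)" and j="\<lambda>(z, m). (z(i := m), z i)"])
       (auto simp: cube_def)
  also have "\<dots> = real s * (\<Sum>z\<in>?Q. D z)"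
    by (simp add: sum.cartesian_product[symmetric] sum_distrib_left)
  also have "(\<Sum>z\<in>?Q. D z) = dir_variation ?Q i g"
    unfolding dir_variation_def D_def by (intro sum.mono_neutral_cong_right) auto
  finally show ?thesis by (simp only: mult.assoc)
qed

text \<open>The stations of a path from \<open>x\<close> to \<open>y\<close> that replaces one
  coordinate after another.\<close>

definition mix :: "'n set \<Rightarrow> ('n \<Rightarrow> int) \<Rightarrow> ('n \<Rightarrow> int) \<Rightarrow> 'n \<Rightarrow> int" where
  "mix S x y = (\<lambda>i. if i \<in> S then y i else x i)"

text \<open>Two points are joined by changing coordinates one at a time. Exchanging the coordinates
  in \<open>S\<close> between the two points is an involution on pairs, and it turns the step in
  direction \<open>i\<close> into a change of the single coordinate \<open>i\<close> of one point,
  which the estimate on lines handles.\<close>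

lemma lattice_poincare:
  fixes c :: "'n::finite \<Rightarrow> int"
  shows "(\<Sum>x\<in>cube c s. \<Sum>y\<in>cube c s. \<bar>g y - g x\<bar>) \<le> real (card (cube c s)) * real s * variation (cube c s) g"
proof -
  let ?Q = "cube c s"
  have "(\<Sum>x\<in>?Q. \<Sum>y\<in>?Q. \<bar>g (mix S x y) - g x\<bar>)
      \<le> real (card (cube c s)) * real s * (\<Sum>i\<in>S. dir_variation ?Q i g)" for S :: "'n set"
    using finite[of S]
  proof (induction S rule: finite_induct)
    case empty
    then show ?case by (simp add: mix_def)
  next
    case (insert i S)
    have "(\<Sum>x\<in>?Q. \<Sum>y\<in>?Q. \<bar>g (mix (insert i S) x y) - g (mix S x y)\<bar>)
        = (\<Sum>(x, y)\<in>?Q \<times> ?Q. \<bar>g (mix (insert i S) x y) - g (mix S x y)\<bar>)"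
      by (simp add: sum.cartesian_product)
    also have "\<dots> = (\<Sum>(z, w)\<in>?Q \<times> ?Q. \<bar>g (z(i := w i)) - g z\<bar>)"
    proof (rule sum.reindex_bij_witness[where i="\<lambda>(x, y). (mix S x y, mix S y x)" and j="\<lambda>(x, y). (mix S x y, mix S y x)"])
      fix a assume "a \<in> ?Q \<times> ?Q"
      show "(case case a of (x, y) \<Rightarrow> (mix S x y, mix S y x) of (z, w) \<Rightarrow> \<bar>g (z(i := w i)) - g z\<bar>)
          = (case a of (x, y) \<Rightarrow> \<bar>g (mix (insert i S) x y) - g (mix S x y)\<bar>)"
      proof -
        have "(mix S x y)(i := mix S y x i) = mix (insert i S) x y" for x y
          using insert by (auto simp: mix_def)
        then show ?thesis by (simp add: split_beta)
      qed
    qed (auto simp: mix_def cube_def)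
    also have "\<dots> = (\<Sum>z\<in>?Q. \<Sum>w\<in>?Q. \<bar>g (z(i := w i)) - g z\<bar>)"
      by (simp add: sum.cartesian_product)
    also have "\<dots> \<le> real (card ?Q) * real s * dir_variation ?Q i g" by (rule sum_line_diff_le)
    finally have *: "(\<Sum>x\<in>?Q. \<Sum>y\<in>?Q. \<bar>g (mix (insert i S) x y) - g (mix S x y)\<bar>)
        \<le> real (card ?Q) * real s * dir_variation ?Q i g" .
    have "(\<Sum>x\<in>?Q. \<Sum>y\<in>?Q. \<bar>g (mix (insert i S) x y) - g x\<bar>) \<le>
       (\<Sum>x\<in>?Q. \<Sum>y\<in>?Q. \<bar>g (mix (insert i S) x y) - g (mix S x y)\<bar> + \<bar>g (mix S x y) - g x\<bar>)"
      by (intro sum_mono) simp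
    then show ?case using * insert by (simp add: sum.distrib algebra_simps)
  qed
  from this[of UNIV] show ?thesis by (simp add: mix_def variation_def)
qed

section \<open>Boundary edges and priced sums of boxed sets\<close>

text \<open>Edges in direction \<open>l\<close> across the boundary of \<open>F\<close>, each named
  by its lower end: the discrete perimeter seen in direction \<open>l\<close>.\<close>

definition jumps :: "'n \<Rightarrow> ('n \<Rightarrow> int) set \<Rightarrow> ('n \<Rightarrow> int) set" where
  "jumps l F = {x. (shift l x \<in> F) \<noteq> (x \<in> F)}"

lemma inj_shift: "inj (shift (l::'n))"
  by (rule inj_on_inverseI[where g="\<lambda>x. x(l := x l - 1)"]) (simp add: shift_def)

lemma finite_jumps: "finite F \<Longrightarrow> finite (jumps l F)"
proof -
  assume "finite F"
  then have "finite (F \<union> shift l -` F)" by (auto intro: finite_vimageI inj_shift)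
  then show ?thesis by (rule rev_finite_subset) (auto simp: jumps_def)
qed

lemma card_face:
  fixes c :: "'n::finite \<Rightarrow> int"
  shows "finite {x. x l = v \<and> (\<forall>i. i \<noteq> l \<longrightarrow> c i \<le> x i \<and> x i < c i + int s)}"
    and "card {x. x l = v \<and> (\<forall>i. i \<noteq> l \<longrightarrow> c i \<le> x i \<and> x i < c i + int s)} = s ^ (CARD('n) - 1)"
proof -
  define A where "A i = (if i = l then {v} else {c i..<c i + int s})" for i
  have *: "{x. x l = v \<and> (\<forall>i. i \<noteq> l \<longrightarrow> c i \<le> x i \<and> x i < c i + int s)} = {x. \<forall>i. x i \<in> A i}"
    unfolding A_def by auto
  have "(\<Prod>i\<in>UNIV. card (A i)) = s ^ (CARD('n) - 1)"
    by (subst prod.remove[of _ l]) (auto simp: A_def)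
  then show "finite {x. x l = v \<and> (\<forall>i. i \<noteq> l \<longrightarrow> c i \<le> x i \<and> x i < c i + int s)}"
    "card {x. x l = v \<and> (\<forall>i. i \<noteq> l \<longrightarrow> c i \<le> x i \<and> x i < c i + int s)} = s ^ (CARD('n) - 1)"
    unfolding * by (subst finite_card_lattice_box; auto simp: A_def)+
qed

text \<open>A jump of the truncated set is either a jump of \<open>E\<close> along an edge inside
  the cube or an edge through one of the two faces orthogonal to direction \<open>l\<close>. Named
  by lower ends, the faces sit at coordinates \<open>c l - 1\<close> and
  \<open>c l + int s - 1\<close>.\<close>

lemma card_jumps_le:
  fixes c :: "'n::finite \<Rightarrow> int"
  shows "real (card (jumps l (E \<inter> cube c s))) \<le> dir_variation (cube c s) l (indicator E) + 2 * real s ^ (CARD('n) - 1)"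
proof -
  let ?Q = "cube c s"
  let ?face = "\<lambda>v. {x. x l = v \<and> (\<forall>i. i \<noteq> l \<longrightarrow> c i \<le> x i \<and> x i < c i + int s)}"
  let ?in = "{x\<in>?Q. shift l x \<in> ?Q \<and> (shift l x \<in> E) \<noteq> (x \<in> E)}"
  have "jumps l (E \<inter> ?Q) \<subseteq> ?in \<union> (?face (c l - 1) \<union> ?face (c l + int s - 1))"
  proof
    fix x assume x: "x \<in> jumps l (E \<inter> ?Q)"
    consider "x \<in> ?Q" "shift l x \<in> ?Q" | "x \<in> ?Q" "shift l x \<notin> ?Q" | "x \<notin> ?Q" "shift l x \<in> ?Q"
      using x by (auto simp: jumps_def)
    then show "x \<in> ?in \<union> (?face (c l - 1) \<union> ?face (c l + int s - 1))"
    proof cases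
      case 1 then show ?thesis using x by (auto simp: jumps_def)
    next
      case 2
      then have "x l = c l + int s - 1"
        by (auto simp: cube_def shift_def split: if_splits dest!: spec[of _ l])
      then show ?thesis using 2 by (auto simp: cube_def)
    next
      case 3
      have o: "c i \<le> x i \<and> x i < c i + int s" if "i \<noteq> l" for i
        using 3(2) that unfolding cube_def shift_def by (auto dest!: spec[of _ i])
      have "c l \<le> x l + 1" "x l + 1 < c l + int s"
        using 3(2) unfolding cube_def shift_def by (auto dest!: spec[of _ l])
      moreover have "\<not> (c l \<le> x l \<and> x l < c l + int s)" using 3(1) o unfolding cube_def by force
      ultimately have "x l = c l - 1" by auto
      then show ?thesis using o by auto
    qed
  qed
  then have "card (jumps l (E \<inter> ?Q)) \<le> card (?in \<union> (?face (c l - 1) \<union> ?face (c l + int s - 1)))"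
    by (intro card_mono finite_UnI card_face) auto
  also have "\<dots> \<le> card ?in + (card (?face (c l - 1)) + card (?face (c l + int s - 1)))"
    by (meson add_left_mono card_Un_le order_trans)
  also have "\<dots> = card ?in + 2 * s ^ (CARD('n) - 1)" by (simp add: card_face)
  finally have "card (jumps l (E \<inter> ?Q)) \<le> card ?in + 2 * s ^ (CARD('n) - 1)" .
  then have "real (card (jumps l (E \<inter> ?Q))) \<le> real (card ?in + 2 * s ^ (CARD('n) - 1))"
    by (rule of_nat_mono)
  also have "real (card ?in) = dir_variation ?Q l (indicator E)"
  proof -
    have "real (card ?in) = (\<Sum>x\<in>?in. 1)" by simp
    also have "\<dots> = dir_variation ?Q l (indicator E)"
      unfolding dir_variation_def by (intro sum.mono_neutral_cong_left) (auto simp: indicator_def)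
    finally show ?thesis .
  qed
  then have "real (card ?in + 2 * s ^ (CARD('n) - 1)) = dir_variation ?Q l (indicator E) + 2 * real s ^ (CARD('n) - 1)"
    by simp
  finally show ?thesis .
qed

text \<open>Finite combinations of indicators of sets inside cubes, with \<open>B\<close> an upper
  bound for the total price. The price of a term, side to the power d - 1 plus number of jumps, is
  up to scaling the normalisation that turns the derivative of the indicator in direction
  \<open>l\<close> into an atom.\<close>

inductive box_sum :: "'n::finite \<Rightarrow> (('n \<Rightarrow> int) \<Rightarrow> real) \<Rightarrow> real \<Rightarrow> bool" for l where
  zero: "0 \<le> B \<Longrightarrow> box_sum l (\<lambda>_. 0) B"
| step: "box_sum l g B \<Longrightarrow> F \<subseteq> cube c s \<Longrightarrow> 0 < s \<Longrightarrow>
    B + \<bar>a\<bar> * (real s ^ (CARD('n) - 1) + real (card (jumps l F))) \<le> B' \<Longrightarrow>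
    box_sum l (\<lambda>x. g x + a * indicator F x) B'"

lemma box_sum_mono: "box_sum l g B \<Longrightarrow> B \<le> B' \<Longrightarrow> box_sum l g B'"
proof (induction arbitrary: B' rule: box_sum.induct)
  case (step g B1 F c s a B2)
  then show ?case by (intro box_sum.step[OF step.hyps(1-3)]) auto
qed (auto intro: box_sum.zero)

lemma box_sum_add:
  assumes "box_sum l g B" "box_sum l g' B'"
  shows "box_sum l (\<lambda>x. g x + g' x) (B + B')"
  using assms(2)
proof (induction rule: box_sum.induct)
  case (zero B')
  then show ?case using box_sum_mono[OF assms(1), of "B + B'"] by simp
next
  case (step g' B1 F c s a B2)
  show ?case
    using box_sum.step[OF step.IH step.hyps(2,3), of a "B + B2"] step.hyps(4) by (simp add: add.assoc)
qed

lemma box_sum_cmult: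
  fixes l :: "'n::finite"
  shows "box_sum l g B \<Longrightarrow> box_sum l (\<lambda>x. r * g x) (\<bar>r\<bar> * B)"
proof (induction rule: box_sum.induct)
  case (zero B)
  then show ?case by (auto intro: box_sum.zero)
next
  case (step g B1 F c s a B2)
  have "\<bar>r\<bar> * (B1 + \<bar>a\<bar> * (real s ^ (CARD('n) - 1) + real (card (jumps l F)))) \<le> \<bar>r\<bar> * B2"
    using step.hyps(4) by (intro mult_left_mono) auto
  then show ?case
    using box_sum.step[OF step.IH step.hyps(2,3), of "r * a" "\<bar>r\<bar> * B2"]
    by (simp add: algebra_simps abs_mult)
qed

lemma box_sum_sum:
  assumes "finite I" "\<And>i. i \<in> I \<Longrightarrow> box_sum l (g i) (B i)"
  shows "box_sum l (\<lambda>x. \<Sum>i\<in>I. g i x) (\<Sum>i\<in>I. B i)"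
  using assms by (induction rule: finite_induct) (auto intro: box_sum.zero box_sum_add)

section \<open>Dyadic subdivision and the isoperimetric alternative\<close>

text \<open>The index \<open>b\<close> of a child is a 0-1 vector; these vectors are themselves
  written as \<open>cube (\<lambda>_. 0) 2\<close>, so their finiteness is that of a cube.\<close>

definition subcube_corner :: "('n \<Rightarrow> int) \<Rightarrow> nat \<Rightarrow> ('n \<Rightarrow> int) \<Rightarrow> 'n \<Rightarrow> int" where
  "subcube_corner c s b = (\<lambda>i. c i + int s * b i)"

lemma subcube_unique:
  assumes "x \<in> cube (subcube_corner c s b) s" "x \<in> cube (subcube_corner c s b') s"
  shows "b = b'"
proof
  fix i
  have 1: "c i + int s * b i \<le> x i" "x i < c i + int s * b i + int s"
      "c i + int s * b' i \<le> x i" "x i < c i + int s * b' i + int s"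
    using assms by (auto simp: cube_def subcube_corner_def)
  have "int s * b i < int s * (b' i + 1)" "int s * b' i < int s * (b i + 1)"
    using 1 by (simp_all add: algebra_simps)
  then show "b i = b' i" by (simp add: mult_less_cancel_left)
qed

lemma subcube_subset:
  assumes "b \<in> cube (\<lambda>_. 0) 2"
  shows "cube (subcube_corner c s b) s \<subseteq> cube c (2 * s)"
proof
  fix x assume x: "x \<in> cube (subcube_corner c s b) s"
  show "x \<in> cube c (2 * s)"
    unfolding cube_def
  proof (clarify)
    fix i
    have "b i = 0 \<or> b i = 1" using assms by (auto simp: cube_def dest!: spec[of _ i])
    moreover have "c i + int s * b i \<le> x i" "x i < c i + int s * b i + int s"
      using x by (auto simp: cube_def subcube_corner_def)
    ultimately show "c i \<le> x i \<and> x i < c i + int (2 * s)" by auto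
  qed
qed

lemma cube_subcube:
  assumes "x \<in> cube c (2 * s)"
  shows "\<exists>b\<in>cube (\<lambda>_. 0) 2. x \<in> cube (subcube_corner c s b) s"
proof
  define b where "b i = (if x i < c i + int s then 0 else (1::int))" for i
  show "b \<in> cube (\<lambda>_. 0) 2" by (auto simp: cube_def b_def)
  show "x \<in> cube (subcube_corner c s b) s"
  proof -
    have "c i \<le> x i" "x i < c i + 2 * int s" for i using assms by (auto simp: cube_def)
    then show ?thesis by (auto simp: cube_def b_def subcube_corner_def algebra_simps)
  qed
qed

lemma indicator_subcubes:
  fixes c :: "'n::finite \<Rightarrow> int"
  shows "indicator (E \<inter> cube c (2 * s)) x = (\<Sum>b\<in>cube (\<lambda>_. 0) 2. indicator (E \<inter> cube (subcube_corner c s b) s) x :: real)"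
proof (cases "x \<in> E \<inter> cube c (2 * s)")
  case True
  then obtain b where b: "b \<in> cube (\<lambda>_. 0) 2" "x \<in> cube (subcube_corner c s b) s"
    using cube_subcube by blast
  have "(\<Sum>b\<in>cube (\<lambda>_. 0) 2. indicator (E \<inter> cube (subcube_corner c s b) s) x :: real) =
     (\<Sum>b'\<in>cube (\<lambda>_. 0) 2. if b' = b then 1 else 0)"
  proof (intro sum.cong refl)
    fix b' assume "b' \<in> cube (\<lambda>_::'n. 0) 2"
    show "indicator (E \<inter> cube (subcube_corner c s b') s) x = (if b' = b then 1 else 0 :: real)"
      using b(2) True subcube_unique[OF b(2), of b'] by (cases "b' = b") (auto simp: indicator_def)
  qed
  then show ?thesis using b True by simp
next
  case False
  then show ?thesis
    using subcube_subset[of _ c s] by (auto simp: indicator_def intro!: sum.neutral[symmetric])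
qed

text \<open>Children are disjoint, so their inner edges are distinct edges of the parent. Edges that
  join two children are lost, hence only an inequality.\<close>

lemma sum_variation_subcubes_le:
  fixes c :: "'n::finite \<Rightarrow> int"
  shows "(\<Sum>b\<in>cube (\<lambda>_. 0) 2. variation (cube (subcube_corner c s b) s) g) \<le> variation (cube c (2 * s)) g"
proof -
  let ?R = "\<lambda>b. cube (subcube_corner c s b) s" and ?Q = "cube c (2 * s)"
  have "(\<Sum>b\<in>cube (\<lambda>_. 0) 2. dir_variation (?R b) i g) \<le> dir_variation ?Q i g" for i
  proof -
    have "(\<Sum>b\<in>cube (\<lambda>_. 0) 2. dir_variation (?R b) i g)
       = (\<Sum>x\<in>(\<Union>b\<in>cube (\<lambda>_. 0) 2. {x \<in> ?R b. shift i x \<in> ?R b}). \<bar>g (shift i x) - g x\<bar>)"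
      unfolding dir_variation_def
      by (rule sum.UNION_disjoint[symmetric]) (auto dest: subcube_unique)
    also have "\<dots> \<le> dir_variation ?Q i g"
      unfolding dir_variation_def using subcube_subset[of _ c s] by (intro sum_mono2) auto
    finally show ?thesis .
  qed
  then show ?thesis unfolding variation_def by (subst sum.swap) (intro sum_mono)
qed

text \<open>For an indicator the double sum in the Poincare inequality counts ordered pairs with
  exactly one point in \<open>E\<close>. If the density lies between 2^(-d-1) and 1/2, these are a
  fixed fraction of all pairs, and dividing by the number of points leaves s^(d-1) against the
  variation.\<close>

lemma relative_isoperimetric:
  fixes c :: "'n::finite \<Rightarrow> int"
  assumes half: "2 * card (E \<inter> cube c s) \<le> card (cube c s)" and s: "0 < s"
    and big: "card (cube c s) \<le> 2 ^ (CARD('n) + 1) * card (E \<inter> cube c s)"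
  shows "real s ^ (CARD('n) - 1) \<le> 2 ^ (CARD('n) + 1) * variation (cube c s) (indicator E)"
proof -
  let ?Q = "cube c s" and ?D = "2 ^ (CARD('n) + 1) :: real"
  define q where "q = real (card ?Q)"
  define p where "p = real (card (E \<inter> ?Q))"
  have qpos: "q > 0" unfolding q_def card_cube using s by simp
  have pq: "2 * p \<le> q" using half unfolding p_def q_def by linarith
  have "real (card ?Q) \<le> real (2 ^ (CARD('n) + 1) * card (E \<inter> ?Q))" by (rule of_nat_mono[OF big])
  then have bigr: "q \<le> ?D * p" unfolding p_def q_def by simp
  have sp: "(\<Sum>y\<in>?Q. indicator E y) = p"
    unfolding p_def by (simp add: sum.If_cases indicator_def Int_def conj_commute)
  have "(\<Sum>y\<in>?Q. \<bar>indicator E y - indicator E x\<bar>) = indicator E x * (q - p) + (1 - indicator E x) * p" for x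
  proof -
    have "(\<Sum>y\<in>?Q. \<bar>indicator E y - indicator E x\<bar>) =
      (\<Sum>y\<in>?Q. indicator E x * (1 - indicator E y) + (1 - indicator E x) * indicator E y :: real)"
      by (intro sum.cong) (auto simp: indicator_def)
    also have "\<dots> = indicator E x * (q - p) + (1 - indicator E x) * p"
      by (simp add: sum.distrib sum_distrib_left[symmetric] sum_subtractf sp q_def)
    finally show ?thesis .
  qed
  then have "(\<Sum>x\<in>?Q. \<Sum>y\<in>?Q. \<bar>indicator E y - indicator E x :: real\<bar>) = p * (q - p) + (q - p) * p"
    by (simp add: sum.distrib sum_distrib_right[symmetric] sum_subtractf sp q_def)
  then have le: "2 * p * (q - p) \<le> q * real s * variation ?Q (indicator E)"
    using lattice_poincare[of "indicator E" c s] by (simp add: q_def algebra_simps)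
  \<comment> \<open>Both density bounds enter in this chain: q is at most \<open>?D\<close> times p,
    and then q is at most 2 (q - p).\<close>
  have "q * q \<le> ?D * p * q" using bigr qpos by (intro mult_right_mono) auto
  also have "\<dots> \<le> ?D * p * (2 * (q - p))" using pq p_def by (intro mult_left_mono) auto
  also have "\<dots> = ?D * (2 * p * (q - p))" by simp
  also have "\<dots> \<le> ?D * (q * real s * variation ?Q (indicator E))" using le by (intro mult_left_mono) auto
  finally have "q * q \<le> q * (?D * real s * variation ?Q (indicator E))" by (simp add: algebra_simps)
  then have "q \<le> ?D * real s * variation ?Q (indicator E)" using qpos by simp
  moreover have "q = real s * real s ^ (CARD('n) - 1)"
    unfolding q_def card_cube by (simp add: power_Suc[symmetric] del: power_Suc)
  ultimately have "real s * real s ^ (CARD('n) - 1) \<le> real s * (?D * variation ?Q (indicator E))"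
    by (simp add: algebra_simps)
  then show ?thesis using s by simp
qed

text \<open>A cube in which \<open>E\<close> has density at most \<open>1/2\<close> is kept if the density exceeds
  \<open>2\<^bsup>-d-1\<^esup>\<close>, where the relative isoperimetric inequality pays for it; otherwise
  all its dyadic children again have density at most \<open>1/2\<close>.\<close>

lemma boxing:
  fixes c :: "'n::finite \<Rightarrow> int"
  assumes "2 * card (E \<inter> cube c (2 ^ k)) \<le> card (cube c (2 ^ k))"
  shows "box_sum l (indicator (E \<inter> cube c (2 ^ k))) (2 ^ (CARD('n) + 3) * variation (cube c (2 ^ k)) (indicator E))"
  using assms
proof (induction k arbitrary: c)
  case 0
  \<comment> \<open>A cube with a single point and density at most 1/2 contains no point of
    \<open>E\<close>.\<close>
  then have "2 * card (E \<inter> cube c (2 ^ 0)) \<le> 1" by (simp add: card_cube)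
  then have "card (E \<inter> cube c (2 ^ 0)) = 0" by linarith
  then have "E \<inter> cube c (2 ^ 0) = {}" by (subst (asm) card_0_eq) auto
  then have "indicator (E \<inter> cube c (2 ^ 0)) = (\<lambda>_. 0 :: real)" by (auto simp: indicator_def)
  then show ?case by (simp only:) (intro box_sum.zero mult_nonneg_nonneg variation_nonneg, simp)
next
  case (Suc k)
  let ?Q = "cube c (2 ^ Suc k)" and ?v = "variation (cube c (2 ^ Suc k)) (indicator E)"
  show ?case
  proof (cases "2 ^ (CARD('n) + 1) * card (E \<inter> ?Q) \<le> card ?Q")
    case True
    let ?R = "\<lambda>b. cube (subcube_corner c (2 ^ k) b) (2 ^ k)"
    have "2 * card (E \<inter> ?R b) \<le> card (?R b)" if "b \<in> cube (\<lambda>_. 0) 2" for b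
    proof -
      have "card (E \<inter> ?R b) \<le> card (E \<inter> ?Q)"
        using subcube_subset[OF that, of c "2^k"] by (intro card_mono) auto
      moreover have "card ?Q = 2 ^ CARD('n) * card (?R b)"
        by (simp add: card_cube power_mult_distrib)
      ultimately have "2 ^ CARD('n) * (2 * card (E \<inter> ?R b)) \<le> 2 ^ CARD('n) * card (?R b)"
        using True by (simp add: algebra_simps)
      then show ?thesis by simp
    qed
    then have "box_sum l (\<lambda>x. \<Sum>b\<in>cube (\<lambda>_. 0) 2. indicator (E \<inter> ?R b) x)
        (\<Sum>b\<in>cube (\<lambda>_. 0) 2. 2 ^ (CARD('n) + 3) * variation (?R b) (indicator E))"
      using Suc.IH by (intro box_sum_sum) auto
    moreover have "(\<Sum>b\<in>cube (\<lambda>_. 0) 2. 2 ^ (CARD('n) + 3) * variation (?R b) (indicator E))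
        \<le> 2 ^ (CARD('n) + 3) * ?v"
      using sum_variation_subcubes_le[of c "2^k"] by (simp add: sum_distrib_left[symmetric])
    moreover have "(\<lambda>x. \<Sum>b\<in>cube (\<lambda>_. 0) 2. indicator (E \<inter> ?R b) x :: real) = indicator (E \<inter> ?Q)"
      using indicator_subcubes[of E c "2^k"] by (simp add: fun_eq_iff)
    ultimately show ?thesis by (simp only:) (rule box_sum_mono)
  next
    case False
    define S where "S = real (2 ^ Suc k) ^ (CARD('n) - 1)"
    have S: "S \<le> 2 ^ (CARD('n) + 1) * ?v"
      unfolding S_def using Suc.prems False by (intro relative_isoperimetric) auto
    have J: "real (card (jumps l (E \<inter> ?Q))) \<le> ?v + 2 * S"
      using card_jumps_le[of l E c "2 ^ Suc k"] dir_variation_le_variation[of ?Q l "indicator E"] by (simp add: S_def)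
    have "?v \<le> 2 ^ (CARD('n) + 1) * ?v" using variation_nonneg[of ?Q "indicator E"]
      mult_right_mono[of 1 "2 ^ (CARD('n) + 1)" ?v] one_le_power[of "2::real" "CARD('n) + 1"] by linarith
    \<comment> \<open>The price is at most 3 S + v, where v is the variation. As S is at most
      2^(d+1) v, this is at most four times 2^(d+1) v, whence the exponent d + 3.\<close>
    then have "0 + \<bar>1\<bar> * (S + real (card (jumps l (E \<inter> ?Q)))) \<le> 2 ^ (CARD('n) + 3) * ?v"
      using S J by (simp add: power_add)
    from box_sum.step[where c=c, OF box_sum.zero[OF order_refl] _ _ this[unfolded S_def]]
    show ?thesis by simp
  qed
qed

text \<open>The layer-cake (coarea) decomposition: subtracting the least positive value on the support
  does not create cancellation in the variation.\<close>

lemma box_sum_nonneg: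
  fixes c :: "'n::finite \<Rightarrow> int"
  assumes "\<And>x. 0 \<le> g x" "{x. g x \<noteq> 0} \<subseteq> cube c (2 ^ k)"
    "2 * card {x. g x \<noteq> 0} \<le> card (cube c (2 ^ k))"
  shows "box_sum l g (2 ^ (CARD('n) + 3) * variation (cube c (2 ^ k)) g)"
  using assms
proof (induction "card {x. g x \<noteq> 0}" arbitrary: g rule: less_induct)
  case less
  let ?Q = "cube c (2 ^ k)" and ?K = "2 ^ (CARD('n) + 3) :: real"
  define E where "E = {x. g x \<noteq> 0}"
  have fin: "finite E" using less.prems(2) unfolding E_def by (rule finite_subset) simp
  show ?case
  proof (cases "E = {}")
    case True
    then have "g = (\<lambda>_. 0)" by (auto simp: E_def)
    then show ?thesis by (simp only:) (intro box_sum.zero mult_nonneg_nonneg variation_nonneg, simp)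
  next
    case False
    define v where "v = Min (g ` E)"
    have "v \<in> g ` E" unfolding v_def using False fin by (intro Min_in) auto
    then obtain x0 where x0: "x0 \<in> E" "g x0 = v" by auto
    have vpos: "v > 0" using x0 less.prems(1)[of x0] by (auto simp: E_def)
    have vle: "v \<le> g x" if "x \<in> E" for x unfolding v_def using that fin by simp
    define g' where "g' x = g x - v * indicator E x" for x
    have g0: "g x = 0" if "x \<notin> E" for x using that by (simp add: E_def)
    have sub: "{x. g' x \<noteq> 0} \<subseteq> E - {x0}" using x0 g0 by (auto simp: g'_def indicator_def split: if_splits)
    then have lt: "card {x. g' x \<noteq> 0} < card E"
      using fin x0 by (meson card_Diff1_less card_mono finite_Diff le_less_trans)
    have "box_sum l g' (?K * variation ?Q g')"
    proof (rule less.hyps)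
      show "0 \<le> g' x" for x using vle[of x] less.prems(1)[of x] by (auto simp: g'_def indicator_def)
      show "{x. g' x \<noteq> 0} \<subseteq> ?Q" using sub less.prems(2) by (auto simp: E_def)
      show "card {x. g' x \<noteq> 0} < card {x. g x \<noteq> 0}" using lt by (simp add: E_def)
      then show "2 * card {x. g' x \<noteq> 0} \<le> card ?Q" using less.prems(3) by simp
    qed
    moreover have "box_sum l (\<lambda>x. v * indicator (E \<inter> ?Q) x) (\<bar>v\<bar> * (?K * variation ?Q (indicator E)))"
    proof (intro box_sum_cmult boxing)
      have "E \<inter> ?Q = E" using less.prems(2) by (auto simp: E_def)
      then show "2 * card (E \<inter> ?Q) \<le> card ?Q" using less.prems(3) by (simp add: E_def)
    qed
    ultimately have "box_sum l (\<lambda>x. g' x + v * indicator (E \<inter> ?Q) x)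
        (?K * variation ?Q g' + \<bar>v\<bar> * (?K * variation ?Q (indicator E)))"
      by (rule box_sum_add)
    moreover have "(\<lambda>x. g' x + v * indicator (E \<inter> ?Q) x) = g"
      using less.prems(2) by (auto simp: g'_def E_def indicator_def fun_eq_iff)
    moreover have "variation ?Q g = variation ?Q g' + v * variation ?Q (indicator E)"
    proof -
      have "\<bar>g y - g x\<bar> = \<bar>g' y - g' x\<bar> + v * \<bar>indicator E y - indicator E x\<bar>" for x y
        using vle[of x] vle[of y] g0[of x] g0[of y] vpos by (auto simp: g'_def indicator_def)
      then show ?thesis
        by (simp add: variation_def dir_variation_def sum.distrib sum_distrib_left)
    qed
    ultimately show ?thesis using vpos by (simp add: algebra_simps)
  qed
qed

text \<open>Positive and negative parts are boxed separately, their supports inheriting the density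
  bound. No variation is wasted: along every edge the absolute increments of the two parts add up to
  that of \<open>g\<close>.\<close>

lemma box_sum_variation:
  fixes c :: "'n::finite \<Rightarrow> int"
  assumes "{x. g x \<noteq> 0} \<subseteq> cube c (2 ^ k)" "2 * card {x. g x \<noteq> 0} \<le> card (cube c (2 ^ k))"
  shows "box_sum l g (2 ^ (CARD('n) + 3) * variation (cube c (2 ^ k)) g)"
proof -
  let ?Q = "cube c (2 ^ k)" and ?K = "2 ^ (CARD('n) + 3) :: real"
  have fin: "finite {x. g x \<noteq> 0}" using assms(1) by (rule finite_subset) simp
  have card: "2 * card {x. h x \<noteq> 0} \<le> card ?Q" "{x. h x \<noteq> 0} \<subseteq> ?Q" if "\<And>x. g x = 0 \<Longrightarrow> h x = 0" for h :: "_ \<Rightarrow> real"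
  proof -
    have "{x. h x \<noteq> 0} \<subseteq> {x. g x \<noteq> 0}" using that by auto
    then show "2 * card {x. h x \<noteq> 0} \<le> card ?Q" "{x. h x \<noteq> 0} \<subseteq> ?Q"
      using card_mono[OF fin, of "{x. h x \<noteq> 0}"] assms by (linarith, blast)
  qed
  have 1: "box_sum l (\<lambda>x. max 0 (g x)) (?K * variation ?Q (\<lambda>x. max 0 (g x)))"
    by (intro box_sum_nonneg card) auto
  have 2: "box_sum l (\<lambda>x. max 0 (- g x)) (?K * variation ?Q (\<lambda>x. max 0 (- g x)))"
    by (intro box_sum_nonneg card) auto
  have "box_sum l (\<lambda>x. max 0 (g x) + (- 1) * max 0 (- g x))
      (?K * variation ?Q (\<lambda>x. max 0 (g x)) + \<bar>- 1\<bar> * (?K * variation ?Q (\<lambda>x. max 0 (- g x))))"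
    by (rule box_sum_add[OF 1 box_sum_cmult[OF 2]])
  moreover have "(\<lambda>x. max 0 (g x) + (- 1) * max 0 (- g x)) = g" by (auto simp: max_def)
  moreover have "variation ?Q g = variation ?Q (\<lambda>x. max 0 (g x)) + variation ?Q (\<lambda>x. max 0 (- g x))"
  proof -
    have "\<bar>b - a\<bar> = \<bar>max 0 b - max 0 a\<bar> + \<bar>max 0 (- b) - max 0 (- a)\<bar>" for a b :: real
      by (auto simp: max_def)
    then show ?thesis unfolding variation_def dir_variation_def sum.distrib[symmetric] by (intro sum.cong refl)
  qed
  ultimately show ?thesis by (simp add: algebra_simps)
qed

section \<open>Smooth partitions of unity\<close>

text \<open>Derivatives are asserted to exist, not computed by an operator, so each closure property
  simply exhibits them. Products over the coordinates later carry this notion over to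
  \<open>C_k\<close>.\<close>

primrec smooth1 :: "nat \<Rightarrow> (real \<Rightarrow> real) \<Rightarrow> bool" where
  "smooth1 0 f \<longleftrightarrow> continuous_on UNIV f"
| "smooth1 (Suc k) f \<longleftrightarrow> (\<exists>f'. (\<forall>x. (f has_real_derivative f' x) (at x)) \<and> smooth1 k f')"

lemma smooth1_SucI: "(\<And>x. (f has_real_derivative f' x) (at x)) \<Longrightarrow> smooth1 k f' \<Longrightarrow> smooth1 (Suc k) f"
  by auto

lemma continuous_on_of_deriv: "(\<And>x. (f has_real_derivative f' x) (at x)) \<Longrightarrow> continuous_on UNIV f"
  by (intro continuous_at_imp_continuous_on ballI DERIV_isCont)

lemma smooth1_Suc_imp: "smooth1 (Suc k) f \<Longrightarrow> smooth1 k f"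
proof (induction k arbitrary: f)
  case 0
  then show ?case by (auto intro: continuous_on_of_deriv)
next
  case (Suc k)
  then obtain f' where f': "\<And>x. (f has_real_derivative f' x) (at x)" "smooth1 (Suc k) f'" by auto
  then show ?case using Suc.IH[OF f'(2)] by (blast intro: smooth1_SucI)
qed

lemma smooth1_add: "smooth1 k f \<Longrightarrow> smooth1 k g \<Longrightarrow> smooth1 k (\<lambda>x. f x + g x)"
proof (induction k arbitrary: f g)
  case (Suc k)
  then obtain f' g' where "\<And>x. (f has_real_derivative f' x) (at x)" "smooth1 k f'"
    "\<And>x. (g has_real_derivative g' x) (at x)" "smooth1 k g'" by auto
  then show ?case using Suc.IH by (intro smooth1_SucI[of _ "\<lambda>x. f' x + g' x"] DERIV_add)
qed (auto intro: continuous_intros)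

lemma smooth1_mult: "smooth1 k f \<Longrightarrow> smooth1 k g \<Longrightarrow> smooth1 k (\<lambda>x. f x * g x)"
proof (induction k arbitrary: f g)
  case (Suc k)
  then obtain f' g' where *: "\<And>x. (f has_real_derivative f' x) (at x)" "smooth1 k f'"
    "\<And>x. (g has_real_derivative g' x) (at x)" "smooth1 k g'" by auto
  have "smooth1 k f" "smooth1 k g" using Suc.prems smooth1_Suc_imp by auto
  then show ?case using * Suc.IH
    by (intro smooth1_SucI[of _ "\<lambda>x. f' x * g x + g' x * f x"] DERIV_mult smooth1_add)
qed (auto intro: continuous_intros)

lemma smooth1_const: "smooth1 k (\<lambda>_. c)"
  by (induction k arbitrary: c) (auto intro!: exI[of _ "\<lambda>_. 0"])

lemma smooth1_affine: "smooth1 k f \<Longrightarrow> smooth1 k (\<lambda>x. f (a * x + b))"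
proof (induction k arbitrary: f)
  case 0
  then show ?case by (auto intro!: continuous_on_compose2[of UNIV f] continuous_intros)
next
  case (Suc k)
  then obtain f' where *: "\<And>x. (f has_real_derivative f' x) (at x)" "smooth1 k f'" by auto
  have "((\<lambda>x. f (a * x + b)) has_real_derivative a * f' (a * x + b)) (at x)" for x
    by (rule DERIV_cong[OF DERIV_chain2[OF *(1)]]) (auto intro!: derivative_eq_intros)
  then show ?case using Suc.IH[OF *(2)]
    by (intro smooth1_SucI[of _ "\<lambda>x. a * f' (a * x + b)"] smooth1_mult smooth1_const)
qed

section \<open>A smooth step function\<close>

text \<open>The classical flat function e^(-1/x) times a polynomial in 1/x: the whole family, unlike
  its first member, is closed under differentiation.\<close>

definition flat_exp :: "real poly \<Rightarrow> real \<Rightarrow> real" where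
  "flat_exp p x = (if x > 0 then poly p (1 / x) * exp (- (1 / x)) else 0)"

lemma power_le_fact_exp:
  fixes t :: real assumes "0 \<le> t"
  shows "t ^ m * exp (- t) \<le> fact m"
proof -
  have "(\<Sum>i\<in>{m}. t ^ i / fact i) \<le> (\<Sum>i. t ^ i / fact i)"
    using assms summable_exp[of t] by (intro sum_le_suminf) (auto simp: field_simps)
  then have "t ^ m / fact m \<le> exp t" by (simp add: exp_def field_simps)
  then show ?thesis by (simp add: field_simps exp_minus)
qed

text \<open>The quadratic bound is what forces the derivative 0 at the origin. With t = 1/x it
  amounts to boundedness of t^2 p(t) e^(-t), obtained term by term from t^m e^(-t) \<le> m!.\<close>

lemma flat_exp_le: "\<exists>C. \<forall>x. \<bar>flat_exp p x\<bar> \<le> C * x\<^sup>2"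
proof (intro exI allI)
  fix x :: real
  let ?C = "\<Sum>i\<le>degree p. \<bar>coeff p i\<bar> * fact (i + 2)"
  show "\<bar>flat_exp p x\<bar> \<le> ?C * x\<^sup>2"
  proof (cases "x > 0")
    case True
    define t where "t = 1 / x"
    have t: "t > 0" using True by (simp add: t_def)
    have "t\<^sup>2 * \<bar>poly p t * exp (- t)\<bar> = \<bar>\<Sum>i\<le>degree p. coeff p i * (t ^ (i + 2) * exp (- t))\<bar>"
    proof -
      have "t\<^sup>2 * (poly p t * exp (- t)) = (\<Sum>i\<le>degree p. coeff p i * (t ^ (i + 2) * exp (- t)))"
        unfolding poly_altdef sum_distrib_right sum_distrib_left
        by (intro sum.cong refl) (simp add: power2_eq_square)
      then show ?thesis by (metis abs_mult abs_power2)
    qed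
    also have "\<dots> \<le> (\<Sum>i\<le>degree p. \<bar>coeff p i\<bar> * (t ^ (i + 2) * exp (- t)))"
      using t by (intro order.trans[OF sum_abs] sum_mono) (simp add: abs_mult)
    also have "\<dots> \<le> ?C"
      using t by (intro sum_mono mult_left_mono power_le_fact_exp) auto
    finally have "t\<^sup>2 * \<bar>poly p t * exp (- t)\<bar> \<le> ?C" .
    then show ?thesis using True t by (simp add: flat_exp_def t_def[symmetric]) (simp add: t_def power2_eq_square field_simps)
  qed (simp add: flat_exp_def sum_nonneg)
qed

text \<open>For positive x, differentiation gives (p - p')(1/x) e^(-1/x) divided by x^2. The factor
  \<open>[:0, 0, 1:]\<close> is the square of the polynomial variable 1/x and absorbs that
  division.\<close>

lemma has_real_derivative_flat_exp:
  "(flat_exp p has_real_derivative flat_exp ([:0, 0, 1:] * (p - pderiv p)) x) (at x)"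
proof -
  consider "x > 0" | "x < 0" | "x = 0" by linarith
  then show ?thesis
  proof cases
    case 1
    have "((\<lambda>x. poly p (1 / x) * exp (- (1 / x))) has_real_derivative
        poly (pderiv p) (1 / x) * (- (1 / x\<^sup>2)) * exp (- (1 / x)) + (exp (- (1 / x)) * (1 / x\<^sup>2)) * poly p (1 / x)) (at x)"
      using 1 by (auto intro!: derivative_eq_intros DERIV_chain2[OF poly_DERIV] simp: power2_eq_square field_simps)
    then have "((\<lambda>x. poly p (1 / x) * exp (- (1 / x))) has_real_derivative flat_exp ([:0, 0, 1:] * (p - pderiv p)) x) (at x)"
      using 1 by (simp add: flat_exp_def field_simps power2_eq_square)
    moreover have "\<forall>\<^sub>F y in nhds x. flat_exp p y = poly p (1 / y) * exp (- (1 / y))"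
      using eventually_nhds_in_open[of "{0<..}" x] 1 by (auto simp: flat_exp_def elim: eventually_mono)
    ultimately show ?thesis by (subst DERIV_cong_ev[OF refl _ refl]) auto
  next
    case 2
    have "\<forall>\<^sub>F y in nhds x. flat_exp p y = 0"
      using eventually_nhds_in_open[of "{..<0}" x] 2 by (auto simp: flat_exp_def elim: eventually_mono)
    then show ?thesis using 2 by (subst DERIV_cong_ev[OF refl _ refl]) (auto simp: flat_exp_def)
  next
    case 3
    obtain C where C: "\<And>x. \<bar>flat_exp p x\<bar> \<le> C * x\<^sup>2" using flat_exp_le by blast
    have "((\<lambda>h. (flat_exp p (0 + h) - flat_exp p 0) / h) \<longlongrightarrow> 0) (at 0)"
    proof (rule Lim_null_comparison)
      show "\<forall>\<^sub>F h in at 0. norm ((flat_exp p (0 + h) - flat_exp p 0) / h) \<le> C * \<bar>h\<bar>"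
      proof (rule eventually_at_filter[THEN iffD2], rule always_eventually, intro allI impI)
        fix h :: real assume "h \<noteq> 0"
        then show "norm ((flat_exp p (0 + h) - flat_exp p 0) / h) \<le> C * \<bar>h\<bar>"
          using C[of h] by (simp add: flat_exp_def[of p 0] divide_le_eq power2_eq_square abs_mult[symmetric] mult.assoc)
      qed
      show "((\<lambda>h. C * \<bar>h\<bar>) \<longlongrightarrow> 0) (at 0)" by (auto intro!: tendsto_eq_intros)
    qed
    then show ?thesis unfolding 3 DERIV_def by (simp add: flat_exp_def[of _ 0])
  qed
qed

lemma smooth1_flat_exp: "smooth1 k (flat_exp p)"
proof (induction k arbitrary: p)
  case 0
  show ?case by (simp only: smooth1.simps) (rule continuous_on_of_deriv[OF has_real_derivative_flat_exp])
next
  case (Suc k)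
  then show ?case using has_real_derivative_flat_exp by (intro smooth1_SucI)
qed

lemma antiderivative_exists_UNIV:
  fixes f :: "real \<Rightarrow> real"
  assumes "continuous_on UNIV f"
  shows "\<exists>F. \<forall>x. (F has_real_derivative f x) (at x)"
proof -
  have "\<exists>F. \<forall>x::real. - \<infinity> < ereal x \<longrightarrow> ereal x < \<infinity> \<longrightarrow> (F has_vector_derivative f x) (at x)"
    using assms by (intro einterval_antiderivative) (auto simp: continuous_on_eq_continuous_at)
  then show ?thesis by (simp add: has_real_derivative_iff_has_vector_derivative)
qed

text \<open>The length \<open>r\<close> of the transition is recorded because the supports of the
  bumps, and with them the sizes of their boxes, depend on it.\<close>

definition smooth_step :: "real \<Rightarrow> (real \<Rightarrow> real) \<Rightarrow> bool" where
  "smooth_step r T \<longleftrightarrow> (\<forall>k. smooth1 k T) \<and> mono T \<and> (\<forall>s\<le>0. T s = 0) \<and> (\<forall>s\<ge>r. T s = 1)"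

lemma const_left_of_deriv_zero:
  fixes F :: "real \<Rightarrow> real"
  assumes "\<And>x. (F has_real_derivative f x) (at x)" "\<And>x. x \<in> S \<Longrightarrow> f x = 0" "convex S" "x \<in> S" "y \<in> S"
  shows "F x = F y"
  using has_field_derivative_zero_constant[of S F] assms by (metis has_field_derivative_at_within)

lemma mono_of_deriv_nonneg:
  fixes F :: "real \<Rightarrow> real"
  assumes "\<And>x. (F has_real_derivative f x) (at x)" "\<And>x. 0 \<le> f x"
  shows "mono F"
  by (rule monoI, rule DERIV_nonneg_imp_nondecreasing) (use assms in blast)+

text \<open>The normalised antiderivative of a bump on the unit interval, the product of
  \<open>flat_exp 1\<close> with its mirror image about 1/2.\<close>

lemma smooth_step_exists: "\<exists>B. smooth_step 1 B"
proof -
  define b where "b s = flat_exp 1 s * flat_exp 1 ((-1) * s + 1)" for s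
  have sb: "smooth1 k b" for k
    unfolding b_def by (intro smooth1_mult smooth1_affine smooth1_flat_exp)
  obtain F where F: "\<And>x. (F has_real_derivative b x) (at x)"
    using antiderivative_exists_UNIV[of b] sb[of 0] by auto
  have b0: "b s = 0" if "s \<le> 0 \<or> s \<ge> 1" for s using that by (auto simp: b_def flat_exp_def)
  have bn: "0 \<le> b s" for s by (simp add: b_def flat_exp_def)
  have bp: "0 < b s" if "0 < s" "s < 1" for s using that by (simp add: b_def flat_exp_def)
  have "F 0 < F 1"
  proof (rule DERIV_pos_imp_increasing_open[of 0 1])
    show "\<exists>y. DERIV F x :> y \<and> 0 < y" if "0 < x" "x < 1" for x using F bp that by blast
    show "continuous_on {0..1} F" using F by (intro continuous_on_subset[OF continuous_on_of_deriv]) auto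
  qed simp
  then have pos: "F 1 - F 0 > 0" by simp
  define B where "B s = (F s - F 0) / (F 1 - F 0)" for s
  have dB: "(B has_real_derivative b x / (F 1 - F 0)) (at x)" for x
    unfolding B_def by (rule derivative_eq_intros F refl | use pos in simp)+
  have "smooth1 k (\<lambda>x. b x / (F 1 - F 0))" for k
    using smooth1_mult[OF sb smooth1_const, of k "1 / (F 1 - F 0)"] by simp
  then have "smooth1 (Suc k) B" for k using dB by (intro smooth1_SucI)
  then have "smooth1 k B" for k by (rule smooth1_Suc_imp)
  moreover have "mono B" using bn pos by (intro mono_of_deriv_nonneg[OF dB]) simp
  moreover have "B s = 0" if "s \<le> 0" for s
    using const_left_of_deriv_zero[OF F, of "{..0}" s 0] b0 that by (auto simp: B_def)
  moreover have "B s = 1" if "s \<ge> 1" for s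
    using const_left_of_deriv_zero[OF F, of "{1..}" s 1] b0 that pos by (auto simp: B_def)
  ultimately show ?thesis unfolding smooth_step_def by blast
qed

text \<open>A bump written as a difference of steps: sums of integer translates telescope, so a
  partition of unity arises without any normalising division.\<close>

definition window :: "(real \<Rightarrow> real) \<Rightarrow> real \<Rightarrow> real" where
  "window T s = T s - T (s - 1)"

lemma smooth1_window: "smooth1 k T \<Longrightarrow> smooth1 k (window T)"
  unfolding window_def[abs_def]
  using smooth1_add[OF _ smooth1_mult[OF smooth1_const[of _ "-1"] smooth1_affine[of _ T 1 "-1"]], of k T] by simp

text \<open>The windows of \<open>B\<close> form a partition of unity under integer translations; the
  second step function \<open>A\<close> has derivative \<open>window B\<close>, so that the derivative of \<open>window A\<close>
  is a unit difference of \<open>window B\<close>.\<close>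

lemma smooth_step_pair:
  "\<exists>B A. smooth_step 1 B \<and> smooth_step 2 A \<and> (\<forall>s. (A has_real_derivative window B s) (at s))"
proof -
  obtain B where B: "smooth_step 1 B" using smooth_step_exists by blast
  then have sB: "smooth1 k B" for k by (simp add: smooth_step_def)
  obtain G where G: "\<And>x. (G has_real_derivative B x) (at x)"
    using antiderivative_exists_UNIV[of B] sB[of 0] by auto
  define A where "A s = G s - G (s - 1)" for s
  have dA: "(A has_real_derivative window B s) (at s)" for s
    unfolding A_def window_def
    by (rule derivative_eq_intros G DERIV_chain2[OF G] refl | simp)+
  have "smooth1 (Suc k) A" for k by (rule smooth1_SucI[OF dA smooth1_window[OF sB]])
  then have "smooth1 k A" for k by (rule smooth1_Suc_imp)
  moreover have "mono A"
    using B by (intro mono_of_deriv_nonneg[OF dA]) (auto simp: window_def smooth_step_def mono_def)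
  moreover have "A s = 0" if "s \<le> 0" for s
    using const_left_of_deriv_zero[OF G, of "{..0}" s "s - 1"] B that by (auto simp: A_def smooth_step_def)
  moreover have "A s = 1" if "s \<ge> 2" for s
  proof -
    \<comment> \<open>\<open>B\<close> equals 1 beyond 1, so \<open>G\<close> minus the identity is
      constant there; for s \<ge> 2 both \<open>s\<close> and \<open>s - 1\<close> lie in that
      range.\<close>
    have "((\<lambda>x. G x - x) has_real_derivative B x - 1) (at x)" for x
      by (rule derivative_eq_intros G refl)+
    from const_left_of_deriv_zero[OF this, of "{1..}" s "s - 1"] show ?thesis
      using B that by (auto simp: A_def smooth_step_def)
  qed
  ultimately show ?thesis using B dA unfolding smooth_step_def by blast
qed

context
  fixes T r assumes T: "smooth_step r T"
begin

lemma window_nonneg: "0 \<le> window T s"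
  using T by (auto simp: smooth_step_def window_def mono_def)

lemma window_eq_0: "s \<le> 0 \<or> s \<ge> r + 1 \<Longrightarrow> window T s = 0"
  using T by (auto simp: smooth_step_def window_def)

lemma smooth_step_bounds: "0 \<le> T s" "T s \<le> 1"
proof -
  have m: "mono T" using T by (simp add: smooth_step_def)
  have "T (min s 0) \<le> T s" "T s \<le> T (max s r)" by (rule monoD[OF m], simp)+
  moreover have "T (min s 0) = 0" "T (max s r) = 1" using T by (auto simp: smooth_step_def)
  ultimately show "0 \<le> T s" "T s \<le> 1" by auto
qed

lemma window_le_1: "window T s \<le> 1"
  using smooth_step_bounds(2)[of s] smooth_step_bounds(1)[of "s - 1"] by (simp add: window_def)

lemma sum_window_interval: "a \<le> b \<Longrightarrow> (\<Sum>m\<in>{a..<b}. window T (s - of_int m)) = T (s - of_int a) - T (s - of_int b)"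
proof (induction b rule: int_ge_induct)
  case (step i)
  have "{a..<i+1} = insert i {a..<i}" using step by auto
  then show ?case using step by (simp add: window_def algebra_simps)
qed simp

text \<open>Windows are nonnegative, so the sum may be enlarged to a full interval of integers,
  where it telescopes to a difference of two values in the unit interval.\<close>

lemma sum_window_le_1:
  assumes "finite (S :: int set)"
  shows "(\<Sum>m\<in>S. window T (s - of_int m)) \<le> 1"
proof (cases "S = {}")
  case False
  have "(\<Sum>m\<in>S. window T (s - of_int m)) \<le> (\<Sum>m\<in>{Min S..<Max S + 1}. window T (s - of_int m))"
    using assms by (intro sum_mono2) (auto simp: window_nonneg zle_add1_eq_le)
  also have "\<dots> = T (s - of_int (Min S)) - T (s - of_int (Max S + 1))"
    using order.trans[OF Min.coboundedI[OF assms] Max.coboundedI[OF assms]] False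
    by (intro sum_window_interval) force
  also have "\<dots> \<le> 1" using smooth_step_bounds by (smt (verit))
  finally show ?thesis .
qed simp

lemma sum_window_eq_1:
  assumes "of_int a \<le> s - r" "s \<le> of_int b" "r \<ge> 0"
  shows "(\<Sum>m\<in>{a..<b}. window T (s - of_int m)) = 1"
proof -
  have "a \<le> b" using assms by linarith
  moreover have "T (s - of_int a) = 1" "T (s - of_int b) = 0"
    using T assms by (auto simp: smooth_step_def)
  ultimately show ?thesis by (simp add: sum_window_interval)
qed

end

section \<open>Product functions and bumps on the lattice\<close>

lemma has_derivative_prod_coords:
  fixes G :: "'n::finite \<Rightarrow> real \<Rightarrow> real"
  assumes "\<And>i x. (G i has_real_derivative G' i x) (at x)"
  shows "((\<lambda>x::real^'n. \<Prod>i\<in>UNIV. G i (x $ i)) has_derivative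
    (\<lambda>h. \<Sum>i\<in>UNIV. G' i (x $ i) * h $ i * (\<Prod>j\<in>UNIV - {i}. G j (x $ j)))) (at x)"
proof -
  have "((\<lambda>x::real^'n. G i (x $ i)) has_derivative (\<lambda>h. G' i (x $ i) * h $ i)) (at x)" for i
    using assms[of i "x $ i"] unfolding has_field_derivative_def
    by (rule has_derivative_compose[rotated]) (rule bounded_linear.has_derivative[OF bounded_linear_vec_nth has_derivative_ident])
  then show ?thesis by (rule has_derivative_prod)
qed

text \<open>The result is again a product over coordinates, with one factor exchanged; this form
  keeps the induction for \<open>C_k\<close> going.\<close>

lemma partial_deriv_prod_coords:
  fixes G :: "'n::finite \<Rightarrow> real \<Rightarrow> real"
  assumes "\<And>i x. (G i has_real_derivative G' i x) (at x)"
  shows "partial_deriv i (\<lambda>x. \<Prod>j\<in>UNIV. G j (x $ j)) = (\<lambda>x. \<Prod>j\<in>UNIV. (if j = i then G' j else G j) (x $ j))"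
proof
  fix x :: "real^'n"
  have "partial_deriv i (\<lambda>x. \<Prod>j\<in>UNIV. G j (x $ j)) x =
      (\<Sum>k\<in>UNIV. G' k (x $ k) * axis i 1 $ k * (\<Prod>j\<in>UNIV - {k}. G j (x $ j)))"
    unfolding partial_deriv_def
    by (simp add: frechet_derivative_at[OF has_derivative_prod_coords[OF assms], symmetric])
  also have "\<dots> = (\<Sum>k\<in>UNIV. if k = i then G' k (x $ k) * (\<Prod>j\<in>UNIV - {k}. G j (x $ j)) else 0)"
    by (intro sum.cong) (auto simp: axis_def)
  also have "\<dots> = G' i (x $ i) * (\<Prod>j\<in>UNIV - {i}. G j (x $ j))" by simp
  also have "\<dots> = (\<Prod>j\<in>UNIV. (if j = i then G' j else G j) (x $ j))"
    by (subst prod.remove[of UNIV i]) auto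
  finally show "partial_deriv i (\<lambda>x. \<Prod>j\<in>UNIV. G j (x $ j)) x = (\<Prod>j\<in>UNIV. (if j = i then G' j else G j) (x $ j))" .
qed

lemma C_k_prod_coords:
  fixes G :: "'n::finite \<Rightarrow> real \<Rightarrow> real"
  assumes "\<And>i. smooth1 k (G i)"
  shows "C_k k (\<lambda>x::real^'n. \<Prod>i\<in>UNIV. G i (x $ i))"
  using assms
proof (induction k arbitrary: G)
  case 0
  then have "continuous_on UNIV (\<lambda>x::real^'n. G i (x $ i))" for i
    using continuous_on_compose2[of UNIV "G i" UNIV "\<lambda>x. x $ i"]
    by (simp add: linear_continuous_on bounded_linear_vec_nth)
  then show ?case by (simp only: C_k.simps) (rule continuous_on_prod)
next
  case (Suc k)
  then have "\<forall>i. \<exists>g'. (\<forall>x. (G i has_real_derivative g' x) (at x)) \<and> smooth1 k g'" by simp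
  then obtain G' where G': "\<And>i x. (G i has_real_derivative G' i x) (at x)" "\<And>i. smooth1 k (G' i)" by metis
  have "(\<lambda>x::real^'n. \<Prod>i\<in>UNIV. G i (x $ i)) differentiable_on UNIV"
    unfolding differentiable_on_def differentiable_def
    by (intro ballI exI) (rule has_derivative_prod_coords[OF G'(1)])
  moreover have "smooth1 k (if j = i then G' j else G j)" for i j
    using G'(2) smooth1_Suc_imp[OF Suc.prems] by simp
  ultimately show ?case
    unfolding C_k.simps partial_deriv_prod_coords[OF G'(1)] by (auto intro!: Suc.IH)
qed

definition lattice_bump :: "(real \<Rightarrow> real) \<Rightarrow> real \<Rightarrow> ('n::finite \<Rightarrow> int) \<Rightarrow> real^'n \<Rightarrow> real" where
  "lattice_bump B \<epsilon> x y = (\<Prod>j\<in>UNIV. window B (y $ j / \<epsilon> - of_int (x j)))"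

text \<open>A bump for the edge from \<open>x\<close> to \<open>shift i x\<close>. Its factor in
  direction \<open>i\<close> comes from \<open>A\<close>, whose derivative is
  \<open>window B\<close>; differentiating in that direction thus produces the difference of two
  neighbouring lattice bumps.\<close>

definition edge_bump :: "(real \<Rightarrow> real) \<Rightarrow> (real \<Rightarrow> real) \<Rightarrow> real \<Rightarrow> 'n::finite \<Rightarrow> ('n \<Rightarrow> int) \<Rightarrow> real^'n \<Rightarrow> real" where
  "edge_bump B A \<epsilon> i x y = (\<Prod>j\<in>UNIV. window (if j = i then A else B) (y $ j / \<epsilon> - of_int (x j)))"

context
  fixes B A :: "real \<Rightarrow> real" and \<epsilon> :: real
  assumes B: "smooth_step 1 B" and A: "smooth_step 2 A" and dA: "\<And>s. (A has_real_derivative window B s) (at s)"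
    and eps: "0 < \<epsilon>"
begin

lemma step_BA: "smooth_step 1 T \<or> smooth_step 2 T \<Longrightarrow> 0 \<le> window T s \<and> window T s \<le> 1"
  using window_nonneg window_le_1 by blast

lemma edge_step: "smooth_step 1 (if j = i then A else B) \<or> smooth_step 2 (if j = i then A else B)"
  using A B by auto

lemma smooth1_window_scaled:
  assumes "smooth_step r T" shows "smooth1 k (\<lambda>s. window T (s / \<epsilon> - c))"
  using smooth1_affine[of k "window T" "1 / \<epsilon>" "- c"] assms smooth1_window[of k T]
  by (simp add: smooth_step_def)

lemma edge_bump_nonneg: "0 \<le> edge_bump B A \<epsilon> i x y"
  unfolding edge_bump_def by (intro prod_nonneg conjunct1[OF step_BA[OF edge_step]])

lemma edge_bump_le_1: "edge_bump B A \<epsilon> i x y \<le> 1"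
  unfolding edge_bump_def by (intro prod_le_1 step_BA[OF edge_step])

text \<open>The bound 3 is the support length of \<open>window A\<close>, its transition 2 plus the
  translation 1; factors from \<open>window B\<close> reach only to 2.\<close>

lemma edge_bump_nonzero:
  assumes "edge_bump B A \<epsilon> i x y \<noteq> 0"
  shows "0 < y $ j / \<epsilon> - of_int (x j)" "y $ j / \<epsilon> - of_int (x j) < 3"
proof -
  let ?s = "y $ j / \<epsilon> - of_int (x j)"
  have "window (if j = i then A else B) ?s \<noteq> 0"
    using assms unfolding edge_bump_def by auto
  then have "\<not> (?s \<le> 0 \<or> ?s \<ge> 3)"
    using window_eq_0[OF A, of ?s] window_eq_0[OF B, of ?s] by (auto split: if_splits)
  then show "0 < ?s" "?s < 3" by auto
qed

lemma edge_bump_box: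
  assumes "edge_bump B A \<epsilon> i x y \<noteq> 0"
  shows "y \<in> cbox (\<chi> j. \<epsilon> * of_int (x j)) (\<chi> j. \<epsilon> * (of_int (x j) + 3))"
proof -
  have "\<epsilon> * of_int (x j) \<le> y $ j" "y $ j \<le> \<epsilon> * (of_int (x j) + 3)" for j
    using edge_bump_nonzero[OF assms, of j] eps by (auto simp: field_simps)
  then show ?thesis by (simp add: mem_box_cart)
qed

lemma edge_bump_test: "edge_bump B A \<epsilon> i x \<in> test_functions"
proof -
  have "C_k k (edge_bump B A \<epsilon> i x)" for k
    unfolding edge_bump_def[abs_def]
    by (rule C_k_prod_coords) (use smooth1_window_scaled A B in auto)
  moreover have "compact (closure {y. edge_bump B A \<epsilon> i x y \<noteq> 0})"
    unfolding compact_closure using edge_bump_box by (intro bounded_subset[OF bounded_cbox]) blast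
  ultimately show ?thesis by (simp add: test_functions_def)
qed

lemma continuous_edge_bump: "continuous_on UNIV (edge_bump B A \<epsilon> i x)"
  using edge_bump_test[of i x] unfolding test_functions_def by (auto dest!: spec[of _ 0])

lemma partial_deriv_edge_bump:
  "partial_deriv i (edge_bump B A \<epsilon> i x) y = (lattice_bump B \<epsilon> x y - lattice_bump B \<epsilon> (shift i x) y) / \<epsilon>"
proof -
  define G where "G j s = window (if j = i then A else B) (s / \<epsilon> - of_int (x j))" for j s
  define D where "D s = (window B (s / \<epsilon> - of_int (x i)) - window B (s / \<epsilon> - of_int (x i) - 1)) / \<epsilon>" for s
  have D: "(G i has_real_derivative D s) (at s)" for s
    unfolding G_def window_def[of A] if_P[OF refl] D_def
    by (rule DERIV_cong[OF DERIV_diff[OF DERIV_chain2[OF dA] DERIV_chain2[OF dA]]])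
       (use eps in \<open>auto intro!: derivative_eq_intros simp: diff_divide_distrib\<close>)
  \<comment> \<open>Only the derivative of the factor in direction \<open>i\<close> has to be
    explicit, since no other survives in the partial derivative; for the remaining factors any
    derivative is chosen.\<close>
  have "\<exists>g'. \<forall>s. (G j has_real_derivative g' s) (at s)" for j
  proof -
    have "smooth1 (Suc 0) (G j)"
      unfolding G_def using smooth1_window_scaled[OF A, of "Suc 0"] smooth1_window_scaled[OF B, of "Suc 0"]
      by (cases "j = i") (simp_all only: if_True if_False simp_thms)
    then show ?thesis by auto
  qed
  then obtain G'' where "\<And>j s. (G j has_real_derivative G'' j s) (at s)" by metis
  then have G': "(G j has_real_derivative (if j = i then D s else G'' j s)) (at s)" for j s
    using D by auto
  have "partial_deriv i (edge_bump B A \<epsilon> i x) y = (\<Prod>j\<in>UNIV. (if j = i then (\<lambda>s. if j = i then D s else G'' j s) else G j) (y $ j))"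
    using fun_cong[OF partial_deriv_prod_coords[of G "\<lambda>j s. if j = i then D s else G'' j s" i, OF G'], of y]
    by (simp add: edge_bump_def[abs_def] G_def)
  also have "\<dots> = D (y $ i) * (\<Prod>j\<in>UNIV - {i}. G j (y $ j))"
    by (subst prod.remove[of UNIV i]) auto
  also have "(\<Prod>j\<in>UNIV - {i}. G j (y $ j)) = (\<Prod>j\<in>UNIV - {i}. window B (y $ j / \<epsilon> - of_int (x j)))"
    by (intro prod.cong) (auto simp: G_def)
  also have "lattice_bump B \<epsilon> x y = window B (y $ i / \<epsilon> - of_int (x i)) * (\<Prod>j\<in>UNIV - {i}. window B (y $ j / \<epsilon> - of_int (x j)))"
    unfolding lattice_bump_def by (subst prod.remove[of UNIV i]) auto
  moreover have "lattice_bump B \<epsilon> (shift i x) y = window B (y $ i / \<epsilon> - of_int (x i) - 1) * (\<Prod>j\<in>UNIV - {i}. window B (y $ j / \<epsilon> - of_int (x j)))"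
    unfolding lattice_bump_def by (subst prod.remove[of UNIV i]) (auto simp: shift_def diff_diff_eq intro!: prod.cong)
  ultimately show ?thesis by (simp add: D_def diff_divide_distrib left_diff_distrib)
qed

text \<open>The finite set \<open>X\<close> is enlarged to a full product set, over which the sum of
  products factors into one-dimensional window sums.\<close>

lemma sum_edge_bump_le_1:
  assumes "finite X"
  shows "(\<Sum>x\<in>X. edge_bump B A \<epsilon> i x y) \<le> 1"
proof -
  define S where "S = (\<lambda>(x, j). x j) ` (X \<times> UNIV)"
  have fS: "finite S" using assms by (simp add: S_def)
  have "X \<subseteq> PiE UNIV (\<lambda>_. S)" by (auto simp: S_def PiE_def Pi_def)
  then have "(\<Sum>x\<in>X. edge_bump B A \<epsilon> i x y) \<le> (\<Sum>x\<in>PiE UNIV (\<lambda>_. S). edge_bump B A \<epsilon> i x y)"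
    using fS by (intro sum_mono2 finite_PiE edge_bump_nonneg) auto
  also have "\<dots> = (\<Prod>j\<in>UNIV. \<Sum>m\<in>S. window (if j = i then A else B) (y $ j / \<epsilon> - of_int m))"
    unfolding edge_bump_def using fS by (subst prod_sum_PiE) auto
  also have "\<dots> \<le> 1"
  proof (intro prod_le_1 conjI sum_nonneg conjunct1[OF step_BA[OF edge_step]])
    fix j
    show "(\<Sum>m\<in>S. window (if j = i then A else B) (y $ j / \<epsilon> - of_int m)) \<le> 1"
      using sum_window_le_1[OF A fS] sum_window_le_1[OF B fS] by simp
  qed
  finally show ?thesis .
qed

text \<open>The left margin 2 is the transition length of \<open>A\<close>: translates that start to
  the left of the cube vanish at \<open>y\<close>.\<close>

lemma sum_edge_bump_eq_1:
  fixes c :: "'n::finite \<Rightarrow> int"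
  assumes "\<And>j. of_int (c j) \<le> y $ j / \<epsilon> - 2" "\<And>j. y $ j / \<epsilon> \<le> of_int (c j) + real s"
  shows "(\<Sum>x\<in>cube c s. edge_bump B A \<epsilon> i x y) = 1"
proof -
  have "cube c s = PiE UNIV (\<lambda>j. {c j..<c j + int s})" by (auto simp: cube_def PiE_def Pi_def)
  then have "(\<Sum>x\<in>cube c s. edge_bump B A \<epsilon> i x y) =
      (\<Prod>j\<in>UNIV. \<Sum>m\<in>{c j..<c j + int s}. window (if j = i then A else B) (y $ j / \<epsilon> - of_int m))"
    unfolding edge_bump_def by (subst prod_sum_PiE) auto
  also have "\<dots> = 1"
  proof (intro prod.neutral ballI)
    fix j
    show "(\<Sum>m\<in>{c j..<c j + int s}. window (if j = i then A else B) (y $ j / \<epsilon> - of_int m)) = 1"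
    proof (cases "j = i")
      case True then show ?thesis using sum_window_eq_1[OF A, of "c j" _ "c j + int s"] assms[of j] by simp
    next
      case False then show ?thesis using sum_window_eq_1[OF B, of "c j" "y $ j / \<epsilon>" "c j + int s"] assms[of j] by simp
    qed
  qed
  finally show ?thesis .
qed

lemma integrable_lattice_bump:
  fixes u :: "real^'n \<Rightarrow> real"
  assumes u: "locally_integrable u"
  shows "integrable lebesgue (\<lambda>y. u y * lattice_bump B \<epsilon> x y)"
proof -
  let ?K = "cbox (\<chi> j. \<epsilon> * of_int (x j)) (\<chi> j. \<epsilon> * (of_int (x j) + 2)) :: (real^'n) set"
  have nz: "y \<in> ?K" if "lattice_bump B \<epsilon> x y \<noteq> 0" for y
  proof -
    have "window B (y $ j / \<epsilon> - of_int (x j)) \<noteq> 0" for j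
      using that unfolding lattice_bump_def by auto
    then have "0 < y $ j / \<epsilon> - of_int (x j)" "y $ j / \<epsilon> - of_int (x j) < 2" for j
      using window_eq_0[OF B, of "y $ j / \<epsilon> - of_int (x j)"] by force+
    then have "\<epsilon> * of_int (x j) \<le> y $ j" "y $ j \<le> \<epsilon> * (of_int (x j) + 2)" for j
      using eps by (auto simp: field_simps intro: less_imp_le)
    then show ?thesis by (simp add: mem_box_cart)
  qed
  have i: "integrable lebesgue (\<lambda>y. indicator ?K y * u y)"
    using u unfolding locally_integrable_def set_integrable_def by (simp add: compact_cbox)
  have "continuous_on UNIV (lattice_bump B \<epsilon> x)"
    using C_k_prod_coords[of 0 "\<lambda>j s. window B (s / \<epsilon> - of_int (x j))"] smooth1_window_scaled[OF B, of 0]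
    unfolding lattice_bump_def[abs_def] by simp
  then have m: "lattice_bump B \<epsilon> x \<in> borel_measurable lebesgue"
    by (intro measurable_completion) (simp add: borel_measurable_continuous_onI)
  have "(\<lambda>y. indicator ?K y * u y * lattice_bump B \<epsilon> x y) = (\<lambda>y. u y * lattice_bump B \<epsilon> x y)"
    using nz by (auto simp: indicator_def fun_eq_iff)
  moreover have "integrable lebesgue (\<lambda>y. lattice_bump B \<epsilon> x y * (indicator ?K y * u y))"
  proof (rule integrable_bounded_mult[OF i m])
    show "\<bar>lattice_bump B \<epsilon> x y\<bar> \<le> 1" for y
      unfolding lattice_bump_def abs_prod using step_BA B by (intro prod_le_1) auto
  qed
  ultimately show ?thesis by (simp add: mult.commute)
qed

text \<open>A weighted mean of \<open>u\<close> at scale \<open>\<epsilon>\<close>, since the bump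
  has integral \<open>\<epsilon> ^ CARD('n)\<close>.\<close>

definition lattice_average :: "(real^'n::finite \<Rightarrow> real) \<Rightarrow> ('n \<Rightarrow> int) \<Rightarrow> real" where
  "lattice_average u x = (LINT y|lebesgue. u y * lattice_bump B \<epsilon> x y) / \<epsilon> ^ CARD('n)"

text \<open>Testing the distributional gradient with an edge bump gives the difference of
  neighbouring averages exactly, with no discretisation error. The power d - 1 is what remains of
  \<epsilon>^d in the average and 1/\<epsilon> in the partial derivative.\<close>

lemma lattice_average_diff:
  fixes u :: "real^'n::finite \<Rightarrow> real"
  assumes u: "locally_integrable u" and nu: "distributional_gradient u \<nu>"
  shows "\<epsilon> ^ (CARD('n) - 1) * (lattice_average u (shift i x) - lattice_average u x)
    = signed_integral (component i \<nu>) (edge_bump B A \<epsilon> i x)"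
proof -
  have "- signed_integral (component i \<nu>) (edge_bump B A \<epsilon> i x) =
     (LINT y|lebesgue. u y * ((lattice_bump B \<epsilon> x y - lattice_bump B \<epsilon> (shift i x) y) / \<epsilon>))"
    using bspec[OF nu[unfolded distributional_gradient_def] edge_bump_test[of i x], THEN spec[of _ i]]
    by (simp only: partial_deriv_edge_bump)
  also have "\<dots> = (LINT y|lebesgue. (u y * lattice_bump B \<epsilon> x y - u y * lattice_bump B \<epsilon> (shift i x) y) / \<epsilon>)"
    by (simp only: right_diff_distrib times_divide_eq_right)
  also have "\<dots> = ((LINT y|lebesgue. u y * lattice_bump B \<epsilon> x y) - (LINT y|lebesgue. u y * lattice_bump B \<epsilon> (shift i x) y)) / \<epsilon>"
    by (simp only: integral_divide_zero Bochner_Integration.integral_diff[OF integrable_lattice_bump[OF u] integrable_lattice_bump[OF u]])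
  also have "\<dots> = \<epsilon> ^ (CARD('n) - 1) * (lattice_average u x - lattice_average u (shift i x))"
  proof -
    have "\<epsilon> ^ CARD('n) = \<epsilon> * \<epsilon> ^ (CARD('n) - 1)" by (simp add: power_Suc[symmetric] del: power_Suc)
    then show ?thesis using eps by (simp add: lattice_average_def field_simps)
  qed
  finally show ?thesis by (simp add: algebra_simps)
qed

end

section \<open>Translates of the heat kernel\<close>

abbreviation (input) heat_exp :: "real \<Rightarrow> 'a::real_normed_vector \<Rightarrow> 'a \<Rightarrow> real" where
  "heat_exp t x y \<equiv> exp (- ((norm (x - y))\<^sup>2 / (4 * t)))"

definition gauss :: "real \<Rightarrow> real \<Rightarrow> real" where
  "gauss t s = exp (- (s\<^sup>2 / (4 * t)))"

lemma gauss_nonneg [simp]: "0 \<le> gauss t s" by (simp add: gauss_def)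

lemma gauss_measurable [measurable]: "gauss t \<in> borel_measurable borel"
  unfolding gauss_def[abs_def] by measurable

context
  fixes t :: real assumes t: "0 < t"
begin

lemma nn_integral_gauss: "(\<integral>\<^sup>+s. ennreal (gauss t (s - m)) \<partial>lborel) = ennreal (sqrt (4 * pi * t))"
proof -
  have \<sigma>: "0 < sqrt (2 * t)" using t by simp
  have *: "gauss t (s - m) = sqrt (4 * pi * t) * normal_density m (sqrt (2 * t)) s" for s
    using t by (simp add: gauss_def normal_density_def mult.assoc)
  have "(\<integral>\<^sup>+s. ennreal (normal_density m (sqrt (2 * t)) s) \<partial>lborel) = 1"
    using prob_space.emeasure_space_1[OF prob_space_normal_density[OF \<sigma>, of m]]
    by (simp add: emeasure_density)
  then show ?thesis
    using t by (simp add: * ennreal_mult nn_integral_cmult)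
qed

definition dgauss :: "real \<Rightarrow> real" where
  "dgauss s = - (s / (2 * t)) * gauss t s"

lemma DERIV_gauss: "(gauss t has_real_derivative dgauss s) (at s)"
  unfolding gauss_def[abs_def] dgauss_def using t
  by (auto intro!: derivative_eq_intros simp: field_simps)

lemma dgauss_measurable [measurable]: "dgauss \<in> borel_measurable borel"
  unfolding dgauss_def[abs_def] by measurable

text \<open>The Gaussian rises from 0 to 1 and falls back, so its total variation is 2 whatever the
  time; the negative half line is reflected onto the positive one.\<close>

lemma nn_integral_abs_dgauss: "(\<integral>\<^sup>+s. ennreal \<bar>dgauss s\<bar> \<partial>lborel) \<le> 2"
proof -
  have half: "(\<integral>\<^sup>+s. ennreal \<bar>dgauss s\<bar> * indicator {0..} s \<partial>lborel) = 1"
  proof -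
    have "(\<integral>\<^sup>+s. ennreal (- dgauss s) * indicator {0..} s \<partial>lborel) = ennreal (0 - (- gauss t 0))"
    proof (rule nn_integral_FTC_atLeast)
      show "((\<lambda>s. - gauss t s) \<longlongrightarrow> 0) at_top"
        unfolding gauss_def using t by real_asymp
    qed (use t in \<open>auto intro!: derivative_eq_intros DERIV_gauss simp: dgauss_def\<close>)
    moreover have "\<bar>dgauss s\<bar> = - dgauss s" if "0 \<le> s" for s using that t by (simp add: dgauss_def)
    then have "(\<integral>\<^sup>+s. ennreal \<bar>dgauss s\<bar> * indicator {0..} s \<partial>lborel) = (\<integral>\<^sup>+s. ennreal (- dgauss s) * indicator {0..} s \<partial>lborel)"
      by (intro nn_integral_cong) (auto split: split_indicator)
    ultimately show ?thesis by (simp add: gauss_def)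
  qed
  have "(\<integral>\<^sup>+s. ennreal \<bar>dgauss s\<bar> * indicator {..0} s \<partial>lborel) =
     (\<integral>\<^sup>+s. ennreal \<bar>dgauss (0 + (- 1) * s)\<bar> * indicator {..0} (0 + (- 1) * s) \<partial>lborel)"
    by (subst nn_integral_real_affine[of _ "- 1" 0]) auto
  also have "\<dots> = (\<integral>\<^sup>+s. ennreal \<bar>dgauss s\<bar> * indicator {0..} s \<partial>lborel)"
    by (intro nn_integral_cong) (auto simp: dgauss_def gauss_def split: split_indicator)
  finally have half': "(\<integral>\<^sup>+s. ennreal \<bar>dgauss s\<bar> * indicator {..0} s \<partial>lborel) = 1" using half by simp
  have "(\<integral>\<^sup>+s. ennreal \<bar>dgauss s\<bar> \<partial>lborel) \<le>
     (\<integral>\<^sup>+s. ennreal \<bar>dgauss s\<bar> * indicator {0..} s + ennreal \<bar>dgauss s\<bar> * indicator {..0} s \<partial>lborel)"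
    by (intro nn_integral_mono) (auto split: split_indicator)
  also have "\<dots> = 2" using half half' by (subst nn_integral_add) auto
  finally show ?thesis .
qed

text \<open>The increment is the integral of the derivative over a segment of length
  \<open>e\<close>. After the integrals are exchanged, each translate of the derivative contributes
  at most 2.\<close>

lemma nn_integral_gauss_diff:
  assumes e: "0 < e"
  shows "(\<integral>\<^sup>+s. ennreal \<bar>gauss t (s + e - m) - gauss t (s - m)\<bar> \<partial>lborel) \<le> ennreal (2 * e)"
proof -
  have 1: "ennreal \<bar>gauss t (s + e - m) - gauss t (s - m)\<bar> \<le> (\<integral>\<^sup>+r. ennreal \<bar>dgauss (s - m + r)\<bar> * indicator {0..e} r \<partial>lborel)" for s
  proof -
    have c: "continuous_on {0..e} (\<lambda>r. dgauss (s - m + r))"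
      unfolding dgauss_def gauss_def using t by (auto intro!: continuous_intros)
    have "((\<lambda>r. gauss t (s - m + r)) has_vector_derivative dgauss (s - m + r)) (at r within {0..e})" for r
      unfolding has_real_derivative_iff_has_vector_derivative[symmetric]
      by (rule DERIV_subset[OF DERIV_cong[OF DERIV_chain2[OF DERIV_gauss]]]) (auto intro!: derivative_eq_intros)
    then have eq: "(LINT r|lborel. indicator {0..e} r *\<^sub>R dgauss (s - m + r)) = gauss t (s + e - m) - gauss t (s - m)"
      and i: "integrable lborel (\<lambda>r. indicator {0..e} r *\<^sub>R dgauss (s - m + r))"
      using integral_FTC_Icc[of 0 e "\<lambda>r. gauss t (s - m + r)" "\<lambda>r. dgauss (s - m + r)"] c e
        borel_integrable_compact[OF compact_Icc c]
      by (auto simp: algebra_simps)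
    have "ennreal \<bar>gauss t (s + e - m) - gauss t (s - m)\<bar> \<le> ennreal (LINT r|lborel. \<bar>indicator {0..e} r *\<^sub>R dgauss (s - m + r)\<bar>)"
      unfolding eq[symmetric] by (intro ennreal_leI integral_abs_bound)
    also have "\<dots> = (\<integral>\<^sup>+r. ennreal \<bar>indicator {0..e} r *\<^sub>R dgauss (s - m + r)\<bar> \<partial>lborel)"
      using i by (intro nn_integral_eq_integral[symmetric]) auto
    also have "\<dots> = (\<integral>\<^sup>+r. ennreal \<bar>dgauss (s - m + r)\<bar> * indicator {0..e} r \<partial>lborel)"
      by (intro nn_integral_cong) (auto split: split_indicator)
    finally show ?thesis .
  qed
  have "(\<integral>\<^sup>+s. ennreal \<bar>gauss t (s + e - m) - gauss t (s - m)\<bar> \<partial>lborel) \<le>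
     (\<integral>\<^sup>+s. \<integral>\<^sup>+r. ennreal \<bar>dgauss (s - m + r)\<bar> * indicator {0..e} r \<partial>lborel \<partial>lborel)"
    by (intro nn_integral_mono 1)
  also have "\<dots> = (\<integral>\<^sup>+r. \<integral>\<^sup>+s. ennreal \<bar>dgauss (s - m + r)\<bar> * indicator {0..e} r \<partial>lborel \<partial>lborel)"
    by (rule lborel_pair.Fubini') measurable
  also have "\<dots> \<le> (\<integral>\<^sup>+r. 2 * indicator {0..e} r \<partial>lborel)"
  proof (intro nn_integral_mono)
    fix r :: real
    have "(\<integral>\<^sup>+s. ennreal \<bar>dgauss (s - m + r)\<bar> \<partial>lborel) = (\<integral>\<^sup>+s. ennreal \<bar>dgauss s\<bar> \<partial>lborel)"
      by (subst nn_integral_real_affine[where c=1 and t="r - m" and f="\<lambda>s. ennreal \<bar>dgauss s\<bar>"]) (auto simp: algebra_simps)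
    then show "(\<integral>\<^sup>+s. ennreal \<bar>dgauss (s - m + r)\<bar> * indicator {0..e} r \<partial>lborel) \<le> 2 * indicator {0..e} r"
      using nn_integral_abs_dgauss by (auto split: split_indicator)
  qed
  also have "\<dots> = ennreal (2 * e)"
    using e by (simp add: nn_integral_cmult ennreal_mult)
  finally show ?thesis .
qed

lemma exp_norm_eq_prod_gauss:
  fixes x y :: "'a::euclidean_space"
  shows "heat_exp t x y = (\<Prod>b\<in>Basis. gauss t (y \<bullet> b - x \<bullet> b))"
proof -
  have "(norm (x - y))\<^sup>2 = (\<Sum>b\<in>Basis. (y \<bullet> b - x \<bullet> b)\<^sup>2)"
    unfolding power2_norm_eq_inner euclidean_inner[of "x - y" "x - y"]
    by (intro sum.cong refl) (simp add: inner_diff_left power2_eq_square algebra_simps)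
  then show ?thesis
    unfolding gauss_def by (simp only: sum_divide_distrib sum_negf[symmetric]) (rule exp_sum, simp)
qed

text \<open>The kernel is a product over coordinates and the translation touches one factor only,
  which gives 2 e, while every other factor integrates to sqrt(4 pi t). Relative to the full mass (4
  pi t)^(d/2) this gains a factor of order e / sqrt t.\<close>

lemma nn_integral_heat_translate:
  fixes x b :: "'a::euclidean_space"
  assumes b: "b \<in> Basis" and e: "0 < e"
  shows "(\<integral>\<^sup>+y. ennreal \<bar>heat_exp t x (y + e *\<^sub>R b) - heat_exp t x y\<bar> \<partial>lborel)
    \<le> ennreal (2 * e * sqrt (4 * pi * t) ^ (DIM('a) - 1))"
proof -
  define f where "f c s = (if c = b then \<bar>gauss t (s + e - x \<bullet> c) - gauss t (s - x \<bullet> c)\<bar> else gauss t (s - x \<bullet> c))" for c s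
  have m: "f c \<in> borel_measurable borel" for c unfolding f_def[abs_def] by measurable
  have "\<bar>heat_exp t x (y + e *\<^sub>R b) - heat_exp t x y\<bar> = (\<Prod>c\<in>Basis. f c (y \<bullet> c))" for y
  proof -
    have "(\<Prod>c\<in>Basis. gauss t ((y + e *\<^sub>R b) \<bullet> c - x \<bullet> c)) =
       gauss t (y \<bullet> b + e - x \<bullet> b) * (\<Prod>c\<in>Basis - {b}. gauss t (y \<bullet> c - x \<bullet> c))"
      using b by (subst prod.remove[of _ b]) (auto simp: inner_add_left inner_Basis intro!: prod.cong split: if_splits)
    moreover have "(\<Prod>c\<in>Basis. gauss t (y \<bullet> c - x \<bullet> c)) = gauss t (y \<bullet> b - x \<bullet> b) * (\<Prod>c\<in>Basis - {b}. gauss t (y \<bullet> c - x \<bullet> c))"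
      using b by (subst prod.remove[of _ b]) auto
    moreover have "(\<Prod>c\<in>Basis. f c (y \<bullet> c)) = f b (y \<bullet> b) * (\<Prod>c\<in>Basis - {b}. gauss t (y \<bullet> c - x \<bullet> c))"
      using b by (subst prod.remove[of _ b]) (auto simp: f_def)
    ultimately show ?thesis
      unfolding exp_norm_eq_prod_gauss f_def
      by (simp add: left_diff_distrib[symmetric] abs_mult abs_of_nonneg[OF prod_nonneg])
  qed
  then have "(\<integral>\<^sup>+y. ennreal \<bar>heat_exp t x (y + e *\<^sub>R b) - heat_exp t x y\<bar> \<partial>lborel)
     = (\<integral>\<^sup>+y. (\<Prod>c\<in>Basis. ennreal (f c (y \<bullet> c))) \<partial>lborel)"
    by (simp add: prod_ennreal f_def)
  also have "\<dots> = (\<Prod>c\<in>Basis. \<integral>\<^sup>+s. ennreal (f c s) \<partial>lborel)"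
    using m by (intro nn_integral_lborel_prod) auto
  also have "\<dots> = (\<integral>\<^sup>+s. ennreal (f b s) \<partial>lborel) * (\<Prod>c\<in>Basis - {b}. \<integral>\<^sup>+s. ennreal (f c s) \<partial>lborel)"
    using b by (subst prod.remove[of _ b]) auto
  also have "(\<Prod>c\<in>Basis - {b}. \<integral>\<^sup>+s. ennreal (f c s) \<partial>lborel) = (\<Prod>c\<in>Basis - {b}. ennreal (sqrt (4 * pi * t)))"
    by (intro prod.cong) (auto simp: f_def nn_integral_gauss)
  also have "\<dots> = ennreal (sqrt (4 * pi * t) ^ (DIM('a) - 1))"
    using b t by (simp add: card_Diff_singleton ennreal_power)
  also have "(\<integral>\<^sup>+s. ennreal (f b s) \<partial>lborel) * \<dots> \<le> ennreal (2 * e) * ennreal (sqrt (4 * pi * t) ^ (DIM('a) - 1))"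
    using nn_integral_gauss_diff[OF e] by (intro mult_right_mono) (auto simp: f_def)
  also have "\<dots> = ennreal (2 * e * sqrt (4 * pi * t) ^ (DIM('a) - 1))"
    using e t by (intro ennreal_mult[symmetric]) auto
  finally show ?thesis .
qed

end

section \<open>Step functions and atoms\<close>

definition cell :: "real \<Rightarrow> real^'n \<Rightarrow> 'n \<Rightarrow> int" where
  "cell \<epsilon> y = (\<lambda>i. \<lfloor>y $ i / \<epsilon>\<rfloor>)"

definition unshift :: "'n \<Rightarrow> ('n \<Rightarrow> int) \<Rightarrow> 'n \<Rightarrow> int" where
  "unshift i x = x(i := x i - 1)"

lemma shift_unshift [simp]: "shift i (unshift i x) = x" "unshift i (shift i x) = x"
  by (auto simp: shift_def unshift_def)

definition backward_diff :: "real \<Rightarrow> 'n \<Rightarrow> (('n \<Rightarrow> int) \<Rightarrow> real) \<Rightarrow> ('n \<Rightarrow> int) \<Rightarrow> real" where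
  "backward_diff \<epsilon> l g x = (g x - g (unshift l x)) / \<epsilon>"

text \<open>The density of \<open>\<partial>\<^sub>l f\<close> for the function \<open>f\<close> that equals \<open>g\<close> at the lattice points
  \<open>\<epsilon> (x + e\<^sub>l)\<close>, is affine in the direction \<open>e\<^sub>l\<close> between them and constant on cells in the other directions.\<close>

definition diff_density :: "real \<Rightarrow> 'n \<Rightarrow> (('n \<Rightarrow> int) \<Rightarrow> real) \<Rightarrow> real^'n \<Rightarrow> real" where
  "diff_density \<epsilon> l g y = backward_diff \<epsilon> l g (cell \<epsilon> y)"

lemma finite_supp_backward_diff:
  assumes "finite {x. g x \<noteq> 0}"
  shows "finite {x. backward_diff \<epsilon> l g x \<noteq> 0}"
proof (rule finite_subset)
  show "{x. backward_diff \<epsilon> l g x \<noteq> 0} \<subseteq> {x. g x \<noteq> 0} \<union> shift l ` {x. g x \<noteq> 0}"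
  proof
    fix x assume "x \<in> {x. backward_diff \<epsilon> l g x \<noteq> 0}"
    then have "g x \<noteq> 0 \<or> g (unshift l x) \<noteq> 0" by (auto simp: backward_diff_def)
    then show "x \<in> {x. g x \<noteq> 0} \<union> shift l ` {x. g x \<noteq> 0}"
      by (metis (mono_tags, lifting) UnCI image_eqI mem_Collect_eq shift_unshift(1))
  qed
qed (use assms in auto)

context
  fixes \<epsilon> :: real
  assumes eps: "0 < \<epsilon>"
begin

lemma cell_eq_iff: "cell \<epsilon> y = x \<longleftrightarrow> (\<forall>i. \<epsilon> * of_int (x i) \<le> y $ i \<and> y $ i < \<epsilon> * (of_int (x i) + 1))"
proof -
  have "\<lfloor>y $ i / \<epsilon>\<rfloor> = x i \<longleftrightarrow> \<epsilon> * of_int (x i) \<le> y $ i \<and> y $ i < \<epsilon> * (of_int (x i) + 1)" for i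
    unfolding floor_eq_iff using eps by (simp add: field_simps)
  then show ?thesis by (simp add: cell_def fun_eq_iff)
qed

lemma cell_vimage_borel [measurable]: "{y::real^'n::finite. cell \<epsilon> y = x} \<in> sets borel"
  unfolding cell_eq_iff by measurable

text \<open>A half-open cell lies between an open and a closed box of the same volume.\<close>

lemma emeasure_cell: "emeasure lborel {y::real^'n::finite. cell \<epsilon> y = x} = ennreal (\<epsilon> ^ CARD('n))"
proof -
  define a b where "a = (\<chi> i. \<epsilon> * of_int (x i))" and "b = (\<chi> i. \<epsilon> * (of_int (x i) + 1))"
  have ba: "(b - a) \<bullet> c = \<epsilon>" if "c \<in> Basis" for c
    using that eps by (auto simp: a_def b_def Basis_vec_def inner_axis algebra_simps)
  then have le: "a \<bullet> c \<le> b \<bullet> c" if "c \<in> Basis" for c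
    using that eps by (metis diff_ge_0_iff_ge inner_diff_left less_imp_le)
  have 1: "emeasure lborel (box a b) = ennreal (\<epsilon> ^ CARD('n))" "emeasure lborel (cbox a b) = ennreal (\<epsilon> ^ CARD('n))"
    using emeasure_lborel_box[OF le] emeasure_lborel_cbox[OF le] by (simp_all add: ba)
  have "box a b \<subseteq> {y. cell \<epsilon> y = x}" "{y. cell \<epsilon> y = x} \<subseteq> cbox a b"
    unfolding cell_eq_iff by (auto simp: mem_box_cart a_def b_def less_imp_le)
  then have "emeasure lborel (box a b) \<le> emeasure lborel {y. cell \<epsilon> y = x}"
    "emeasure lborel {y. cell \<epsilon> y = x} \<le> emeasure lborel (cbox a b)"
    by (auto intro!: emeasure_mono)
  then show ?thesis unfolding 1 by (rule antisym[rotated])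
qed

lemma measure_cell: "measure lborel {y::real^'n::finite. cell \<epsilon> y = x} = \<epsilon> ^ CARD('n)"
  using eps by (simp add: measure_def emeasure_cell)

text \<open>At most one cell indicator is nonzero at a given point. The extra \<open>f\<close>,
  vanishing with its first argument, lets one identity serve both the plain step function and its
  product with a weight.\<close>

lemma step_function_eq:
  fixes f :: "real \<Rightarrow> real^'n \<Rightarrow> real"
  assumes X: "finite X" "{x. G x \<noteq> 0} \<subseteq> X" and f0: "f 0 y = 0"
  shows "f (G (cell \<epsilon> y)) y = (\<Sum>x\<in>X. f (G x) y * indicator {y. cell \<epsilon> y = x} y)"
proof -
  have "(\<Sum>x\<in>X. f (G x) y * indicator {y. cell \<epsilon> y = x} y) = (\<Sum>x\<in>X. if x = cell \<epsilon> y then f (G (cell \<epsilon> y)) y else 0)"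
    by (intro sum.cong) auto
  also have "\<dots> = f (G (cell \<epsilon> y)) y"
  proof (cases "cell \<epsilon> y \<in> X")
    case False
    then have "G (cell \<epsilon> y) = 0" using X by auto
    then show ?thesis using False f0 X by (simp add: sum.delta)
  qed (use X in \<open>simp add: sum.delta\<close>)
  finally show ?thesis by simp
qed

lemma integrable_step_function:
  fixes G :: "('n::finite \<Rightarrow> int) \<Rightarrow> real"
  assumes G: "finite {x. G x \<noteq> 0}"
  shows "integrable lborel (\<lambda>y. G (cell \<epsilon> y))"
proof -
  have "integrable lborel (\<lambda>y::real^'n. \<Sum>x\<in>{x. G x \<noteq> 0}. G x * indicator {y. cell \<epsilon> y = x} y)"
    by (intro Bochner_Integration.integrable_sum integrable_mult_right integrable_real_indicator)
       (auto simp: emeasure_cell)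
  then show ?thesis using step_function_eq[OF G order_refl, of "\<lambda>a y. a"] by simp
qed

lemma integrable_cell:
  fixes f :: "real^'n::finite \<Rightarrow> real"
  assumes f: "f \<in> borel_measurable borel" and B: "\<And>x. \<bar>f x\<bar> \<le> B"
  shows "integrable lborel (\<lambda>y. indicator {y. cell \<epsilon> y = x} y * f y)"
proof -
  have "integrable lborel (indicator {y::real^'n. cell \<epsilon> y = x} :: _ \<Rightarrow> real)"
    by (intro integrable_real_indicator) (auto simp: emeasure_cell)
  from integrable_bounded_mult[where f=f, OF this _ B] show ?thesis using f by (simp add: mult.commute)
qed

lemma integral_step_function:
  fixes G :: "('n::finite \<Rightarrow> int) \<Rightarrow> real"
  assumes X: "finite X" "{x. G x \<noteq> 0} \<subseteq> X"
    and f: "f \<in> borel_measurable borel" and B: "\<And>x. \<bar>f x\<bar> \<le> B"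
  shows "(LINT y|lborel. f y * G (cell \<epsilon> y)) = (\<Sum>x\<in>X. G x * (LINT y|lborel. indicator {y. cell \<epsilon> y = x} y * f y))"
proof -
  have "(LINT y|lborel. f y * G (cell \<epsilon> y)) = (LINT y|lborel. (\<Sum>x\<in>X. G x * (indicator {y. cell \<epsilon> y = x} y * f y)))"
    using step_function_eq[OF X, of "\<lambda>a y. f y * a"]
    by (intro Bochner_Integration.integral_cong refl) (simp add: mult_ac)
  also have "\<dots> = (\<Sum>x\<in>X. G x * (LINT y|lborel. indicator {y. cell \<epsilon> y = x} y * f y))"
    by (simp add: Bochner_Integration.integral_sum integrable_cell[OF f B])
  finally show ?thesis .
qed

lemma abs_cell_average_le:
  fixes f :: "real^'n::finite \<Rightarrow> real"
  assumes f: "f \<in> borel_measurable borel" and B: "\<And>y. cell \<epsilon> y = x \<Longrightarrow> \<bar>f y - a\<bar> \<le> B" and bd: "\<And>y. \<bar>f y\<bar> \<le> B'"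
  shows "\<bar>(LINT y|lborel. indicator {y. cell \<epsilon> y = x} y * f y) / \<epsilon> ^ CARD('n) - a\<bar> \<le> B"
proof -
  let ?Q = "{y::real^'n. cell \<epsilon> y = x}"
  have i: "integrable lborel (indicator ?Q :: _ \<Rightarrow> real)" by (auto simp: emeasure_cell)
  have "(LINT y|lborel. indicator ?Q y * f y) - a * \<epsilon> ^ CARD('n) = (LINT y|lborel. indicator ?Q y * (f y - a))"
  proof -
    have "(LINT y|lborel. indicator ?Q y * (f y - a)) = (LINT y|lborel. indicator ?Q y * f y - a * indicator ?Q y)"
      by (intro Bochner_Integration.integral_cong refl) (simp add: algebra_simps)
    also have "\<dots> = (LINT y|lborel. indicator ?Q y * f y) - (LINT y|lborel. a * indicator ?Q y)"
      using i by (intro Bochner_Integration.integral_diff integrable_cell[OF f bd]) simp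
    finally show ?thesis using i by (simp add: measure_cell)
  qed
  also have "\<bar>\<dots>\<bar> \<le> (LINT y|lborel. \<bar>indicator ?Q y * (f y - a)\<bar>)" by (rule integral_abs_bound)
  also have "\<dots> \<le> (LINT y|lborel. B * indicator ?Q y)"
  proof (rule integral_mono)
    show "integrable lborel (\<lambda>y. \<bar>indicator ?Q y * (f y - a)\<bar>)"
      using i by (simp add: right_diff_distrib integrable_cell[OF f bd])
  qed (use i B in \<open>auto split: split_indicator\<close>)
  also have "\<dots> = B * \<epsilon> ^ CARD('n)" using i by (simp add: measure_cell)
  finally have "\<bar>(LINT y|lborel. indicator ?Q y * f y) - a * \<epsilon> ^ CARD('n)\<bar> \<le> B * \<epsilon> ^ CARD('n)" .
  then have "\<bar>(LINT y|lborel. indicator ?Q y * f y) - a * \<epsilon> ^ CARD('n)\<bar> / \<epsilon> ^ CARD('n) \<le> B"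
    using eps by (simp add: divide_le_eq)
  moreover have "(LINT y|lborel. indicator ?Q y * f y) / \<epsilon> ^ CARD('n) - a = ((LINT y|lborel. indicator ?Q y * f y) - a * \<epsilon> ^ CARD('n)) / \<epsilon> ^ CARD('n)"
    using eps by (simp add: diff_divide_distrib)
  ultimately show ?thesis using eps by (simp add: abs_divide)
qed

lemma integral_abs_step_function:
  fixes G :: "('n::finite \<Rightarrow> int) \<Rightarrow> real"
  assumes X: "finite X" "{x. G x \<noteq> 0} \<subseteq> X"
  shows "(\<integral>\<^sup>+(y::real^'n). ennreal \<bar>G (cell \<epsilon> y)\<bar> \<partial>lborel) = ennreal ((\<Sum>x\<in>X. \<bar>G x\<bar>) * \<epsilon> ^ CARD('n))"
proof -
  have fin: "finite {x. \<bar>G x\<bar> \<noteq> 0}" using X by (auto intro: finite_subset)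
  have "(\<integral>\<^sup>+(y::real^'n). ennreal \<bar>G (cell \<epsilon> y)\<bar> \<partial>lborel) = ennreal (LINT (y::real^'n)|lborel. \<bar>G (cell \<epsilon> y)\<bar>)"
    using integrable_step_function[OF fin] by (intro nn_integral_eq_integral) auto
  also have "(LINT (y::real^'n)|lborel. \<bar>G (cell \<epsilon> y)\<bar>) = (\<Sum>x\<in>X. \<bar>G x\<bar>) * \<epsilon> ^ CARD('n)"
    using integral_step_function[of X "\<lambda>x. \<bar>G x\<bar>" "\<lambda>_. 1" 1] X by (simp add: measure_cell sum_distrib_right)
  finally show ?thesis .
qed

lemma cell_translate: "cell \<epsilon> (y - \<epsilon> *\<^sub>R axis l 1) = unshift l (cell \<epsilon> y)"
proof -
  have "(y $ i - \<epsilon>) / \<epsilon> = y $ i / \<epsilon> - 1" for i using eps by (simp add: diff_divide_distrib)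
  then show ?thesis by (auto simp: cell_def unshift_def fun_eq_iff axis_def)
qed

lemma integrable_diff_density:
  "finite {x. g x \<noteq> 0} \<Longrightarrow> integrable lborel (diff_density \<epsilon> l g :: real^'n::finite \<Rightarrow> real)"
  unfolding diff_density_def[abs_def] by (intro integrable_step_function finite_supp_backward_diff)

text \<open>Translation invariance of Lebesgue measure moves the difference quotient from the step
  function onto \<open>p\<close>, with the sign of an integration by parts.\<close>

lemma integral_diff_density_summation_by_parts:
  fixes p :: "real^'n::finite \<Rightarrow> real"
  assumes g: "finite {x. g x \<noteq> 0}" and p: "p \<in> borel_measurable borel" "\<And>x. \<bar>p x\<bar> \<le> B"
  shows "(LINT y|lborel. p y * diff_density \<epsilon> l g y) = (LINT y|lborel. (p y - p (y + \<epsilon> *\<^sub>R axis l 1)) * g (cell \<epsilon> y)) / \<epsilon>"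
proof -
  note [measurable] = p(1)
  let ?e = "\<epsilon> *\<^sub>R axis l 1 :: real^'n"
  have gi: "integrable lborel (\<lambda>y. g (cell \<epsilon> y))" using integrable_step_function[OF g] .
  then have [measurable]: "(\<lambda>y. g (cell \<epsilon> y)) \<in> borel_measurable borel" by auto
  have p': "(\<lambda>y. p (y + ?e)) \<in> borel_measurable borel" by measurable
  have i1: "integrable lborel (\<lambda>y. p y * g (cell \<epsilon> y))" using integrable_bounded_mult[where f=p, OF gi _ p(2)] by simp
  have i2: "integrable lborel (\<lambda>y. p (y + ?e) * g (cell \<epsilon> y))" using integrable_bounded_mult[where f="\<lambda>y. p (y + ?e)", OF gi _ p(2)] p' by simp
  have tr: "(LINT y|lborel. q (y + ?e)) = (LINT y|lborel. q y)" "integrable lborel (\<lambda>y. q (y + ?e)) \<longleftrightarrow> integrable lborel q"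
    if "q \<in> borel_measurable borel" for q :: "real^'n \<Rightarrow> real"
  proof -
    have m: "(+) ?e \<in> lborel \<rightarrow>\<^sub>M borel" by simp
    show "(LINT y|lborel. q (y + ?e)) = (LINT y|lborel. q y)"
      using integral_distr[OF m that] by (simp add: lborel_distr_plus add.commute)
    show "integrable lborel (\<lambda>y. q (y + ?e)) \<longleftrightarrow> integrable lborel q"
      using integrable_distr_eq[OF m that] by (simp add: lborel_distr_plus add.commute)
  qed
  define q where "q y = p y * g (cell \<epsilon> (y - ?e))" for y
  have q: "q \<in> borel_measurable borel" unfolding q_def by measurable
  have "(LINT y|lborel. p y * g (unshift l (cell \<epsilon> y))) = (LINT y|lborel. q y)"
    by (simp add: q_def cell_translate)
  also have "\<dots> = (LINT y|lborel. p (y + ?e) * g (cell \<epsilon> y))"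
    using tr(1)[OF q] by (simp add: q_def)
  finally have eq: "(LINT y|lborel. p y * g (unshift l (cell \<epsilon> y))) = (LINT y|lborel. p (y + ?e) * g (cell \<epsilon> y))" .
  have i3: "integrable lborel (\<lambda>y. p y * g (unshift l (cell \<epsilon> y)))"
  proof -
    have "integrable lborel q" using tr(2)[OF q] i2 by (simp add: q_def)
    then show ?thesis by (simp add: q_def[abs_def] cell_translate)
  qed
  have "(LINT y|lborel. p y * diff_density \<epsilon> l g y) = (LINT y|lborel. (p y * g (cell \<epsilon> y) - p y * g (unshift l (cell \<epsilon> y))) / \<epsilon>)"
    by (simp add: diff_density_def backward_diff_def right_diff_distrib diff_divide_distrib)
  also have "\<dots> = ((LINT y|lborel. p y * g (cell \<epsilon> y)) - (LINT y|lborel. p (y + ?e) * g (cell \<epsilon> y))) / \<epsilon>"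
    using i1 i3 eq by simp
  also have "\<dots> = (LINT y|lborel. (p y - p (y + ?e)) * g (cell \<epsilon> y)) / \<epsilon>"
    using i1 i2 by (simp add: left_diff_distrib)
  finally show ?thesis .
qed

lemma integral_diff_density:
  "finite {x. g x \<noteq> 0} \<Longrightarrow> (LINT (y::real^'n::finite)|lborel. diff_density \<epsilon> l g y) = 0"
  using integral_diff_density_summation_by_parts[of g "\<lambda>_. 1" 1 l] by simp

end

section \<open>Heat extensions and the atom conditions\<close>

lemma heat_extension_density_sm:
  fixes k :: "real^'n::finite \<Rightarrow> real"
  assumes k: "integrable lborel k" and t: "0 < t"
  shows "heat_extension t (density_sm k) x =
    1 / (4 * pi * t) powr (real CARD('n) / 2) * (LINT y|lborel. heat_exp t x y * k y)"
proof -
  have "signed_integral (density_sm k) (\<lambda>y. heat_exp t x y)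
      = (LINT y|lborel. heat_exp t x y * k y)"
    by (rule signed_integral_density_sm[OF k, of _ 1]) (use t in auto)
  then show ?thesis by (simp add: heat_extension_def)
qed

text \<open>\<open>esssup\<close> of a nonmeasurable function is top by convention, so joint
  measurability in space and time must be in place before a pointwise bound can be used.\<close>

lemma heat_extension_density_measurable:
  fixes k :: "real^'n::finite \<Rightarrow> real"
  assumes k: "integrable lborel k"
  shows "(\<lambda>(x, t). ennreal \<bar>t powr a * heat_extension t (density_sm k) x\<bar>)
    \<in> borel_measurable (restrict_space lborel (UNIV \<times> {0<..}))"
proof -
  have [measurable]: "k \<in> borel_measurable borel" using k by auto
  have [measurable]: "fst \<in> borel_measurable (borel :: ((real^'n) \<times> real) measure)"
    "snd \<in> borel_measurable (borel :: ((real^'n) \<times> real) measure)"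
    by (auto intro!: borel_measurable_continuous_onI continuous_intros)
  have "(\<lambda>p. LINT y|lborel. heat_exp (snd p) (fst p) y * k y)
      \<in> borel_measurable (borel :: ((real^'n) \<times> real) measure)"
    by (rule lborel.borel_measurable_lebesgue_integral) measurable
  then have "(\<lambda>p. ennreal \<bar>snd p powr a * (1 / (4 * pi * snd p) powr (real CARD('n) / 2) *
      (LINT y|lborel. heat_exp (snd p) (fst p) y * k y))\<bar>)
      \<in> borel_measurable (borel :: ((real^'n) \<times> real) measure)"
    by measurable
  then have "(\<lambda>p. ennreal \<bar>snd p powr a * (1 / (4 * pi * snd p) powr (real CARD('n) / 2) *
      (LINT y|lborel. heat_exp (snd p) (fst p) y * k y))\<bar>)
      \<in> borel_measurable (restrict_space (lborel :: ((real^'n) \<times> real) measure) (UNIV \<times> {0<..}))"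
    by (intro measurable_restrict_space1) simp
  then show ?thesis
    by (rule measurable_cong[THEN iffD1, rotated])
       (auto simp: space_restrict_space heat_extension_density_sm[OF k])
qed

text \<open>Summation by parts puts the difference on the heat kernel, whose translation estimate
  cancels the factor 1/\<epsilon>. Only the bound by 1 of the indicator enters the estimate, so the
  result is uniform in \<open>F\<close>, \<open>\<epsilon>\<close> and \<open>t\<close>.\<close>

lemma heat_extension_indicator_le:
  fixes F :: "('n::finite \<Rightarrow> int) set"
  assumes eps: "0 < \<epsilon>" and F: "finite F" and t: "0 < t"
  shows "\<bar>sqrt t * heat_extension t (density_sm (diff_density \<epsilon> l (indicator F))) x\<bar> \<le> 1"
proof -
  define p where "p y = heat_exp t x y" for y
  let ?e = "\<epsilon> *\<^sub>R axis l 1 :: real^'n"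
  have [measurable]: "p \<in> borel_measurable borel" unfolding p_def by measurable
  have p1: "\<bar>p y\<bar> \<le> 1" for y using t by (simp add: p_def)
  have fin: "finite {x. indicator F x \<noteq> (0::real)}" using F by (auto simp: indicator_def)
  define I where "I = (LINT y|lborel. p y * diff_density \<epsilon> l (indicator F) y)"
  define J where "J = (LINT y|lborel. (p y - p (y + ?e)) * indicator F (cell \<epsilon> y))"
  have IJ: "I = J / \<epsilon>"
    unfolding I_def J_def by (rule integral_diff_density_summation_by_parts[OF eps fin _ p1]) simp
  have sp: "sqrt (4 * pi * t) > 0" using t by simp
  have le_div: "\<bar>1 / (R * P) * I\<bar> \<le> 2 / R" if "0 < R" "0 < P" "\<bar>I\<bar> \<le> 2 * P" for R P I :: real
    using that by (simp add: abs_mult divide_simps)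
  have nn: "(\<integral>\<^sup>+y. ennreal \<bar>p (y + ?e) - p y\<bar> \<partial>lborel) \<le> ennreal (2 * \<epsilon> * sqrt (4 * pi * t) ^ (CARD('n) - 1))"
    using nn_integral_heat_translate[OF t _ eps, of "axis l 1" x] by (simp add: p_def axis_in_Basis_iff)
  have "ennreal \<bar>J\<bar> \<le> (\<integral>\<^sup>+y. ennreal \<bar>(p y - p (y + ?e)) * indicator F (cell \<epsilon> y)\<bar> \<partial>lborel)"
    unfolding J_def using integral_norm_bound_ennreal[of lborel "\<lambda>y. (p y - p (y + ?e)) * indicator F (cell \<epsilon> y)"]
    by (cases "integrable lborel (\<lambda>y. (p y - p (y + ?e)) * indicator F (cell \<epsilon> y))") (auto simp: not_integrable_integral_eq)
  also have "\<dots> \<le> (\<integral>\<^sup>+y. ennreal \<bar>p (y + ?e) - p y\<bar> \<partial>lborel)"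
    by (intro nn_integral_mono) (auto simp: indicator_def abs_minus_commute)
  also note nn
  finally have J: "\<bar>J\<bar> \<le> 2 * \<epsilon> * sqrt (4 * pi * t) ^ (CARD('n) - 1)"
    using eps sp by (subst (asm) ennreal_le_iff) auto
  then have "\<bar>I\<bar> \<le> 2 * sqrt (4 * pi * t) ^ (CARD('n) - 1)"
    unfolding IJ using eps by (simp add: divide_le_eq mult_ac)
  moreover have pw: "(4 * pi * t) powr (real CARD('n) / 2) = sqrt (4 * pi * t) * sqrt (4 * pi * t) ^ (CARD('n) - 1)"
  proof -
    have "(4 * pi * t) powr (real CARD('n) / 2) = ((4 * pi * t) powr (1 / 2)) powr real CARD('n)"
      by (simp add: powr_powr)
    also have "\<dots> = sqrt (4 * pi * t) ^ CARD('n)" using sp t by (simp add: powr_half_sqrt powr_realpow)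
    finally show ?thesis by (simp add: power_Suc[symmetric] del: power_Suc)
  qed
  moreover have "heat_extension t (density_sm (diff_density \<epsilon> l (indicator F))) x = 1 / (4 * pi * t) powr (real CARD('n) / 2) * I"
    unfolding heat_extension_density_sm[OF integrable_diff_density[OF eps fin] t] I_def p_def ..
  ultimately have "\<bar>heat_extension t (density_sm (diff_density \<epsilon> l (indicator F))) x\<bar> \<le> 2 / sqrt (4 * pi * t)"
    using le_div[OF sp zero_less_power[OF sp]] by simp
  then have "sqrt t * \<bar>heat_extension t (density_sm (diff_density \<epsilon> l (indicator F))) x\<bar> \<le> sqrt t * (2 / sqrt (4 * pi * t))"
    using t by (intro mult_left_mono) auto
  also have "\<dots> = 1 / sqrt pi" using t by (simp add: real_sqrt_mult)
  also have "\<dots> \<le> 1" using pi_gt3 by simp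
  finally show ?thesis using t by (simp add: abs_mult)
qed

text \<open>The normaliser \<open>\<kappa>\<close> has one summand for each quantitative condition:
  s^(d-1) for the size of the cube in the heat estimate, the number of jumps for the total
  variation. With \<beta> = d - 1 the power of t is 1/2, exactly that of the estimate for
  indicators. The mean vanishes because the density is a difference quotient.\<close>

lemma is_atom_diff_density:
  fixes F :: "('n::finite \<Rightarrow> int) set"
  assumes eps: "0 < \<epsilon>" and F: "F \<subseteq> cube c s" and s: "0 < s"
    and \<kappa>: "\<kappa> = 2 ^ (CARD('n) - 1) * \<epsilon> ^ (CARD('n) - 1) * (real s ^ (CARD('n) - 1) + real (card (jumps l F)))"
  shows "is_atom (real CARD('n) - 1) (\<lambda>A. 1 / \<kappa> * density_sm (diff_density \<epsilon> l (indicator F)) A)"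
proof -
  let ?d = "CARD('n) - 1"
  define h where "h = (diff_density \<epsilon> l (indicator F) :: real^'n \<Rightarrow> real)"
  define k where "k y = 1 / \<kappa> * h y" for y
  have finF: "finite F" using F by (rule finite_subset) simp
  then have fin: "finite {x. indicator F x \<noteq> (0::real)}" by (auto simp: indicator_def)
  have hi: "integrable lborel h" unfolding h_def by (rule integrable_diff_density[OF eps fin])
  then have ki: "integrable lborel k" by (simp add: k_def[abs_def])
  have eq: "(\<lambda>A. 1 / \<kappa> * density_sm h A) = density_sm k"
    by (rule ext, unfold k_def[abs_def]) (rule density_sm_cmult[symmetric])
  \<comment> \<open>The backward difference reaches one cell beyond \<open>F\<close>, hence s + 1.
    As s \<ge> 1 this is at most 2 s, which is where the power of 2 in \<open>\<kappa>\<close> comes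
    from.\<close>
  define L where "L = \<epsilon> * (real s + 1)"
  have L: "0 < L" using eps by (simp add: L_def)
  have kpos: "0 < \<kappa>" unfolding \<kappa> using eps s by (intro mult_pos_pos add_pos_nonneg) auto
  have Lk: "L ^ ?d \<le> \<kappa>"
  proof -
    have "L \<le> 2 * \<epsilon> * real s" unfolding L_def using eps s by (simp add: algebra_simps)
    then have "L ^ ?d \<le> (2 * \<epsilon> * real s) ^ ?d" using L by (intro power_mono) auto
    also have "\<dots> \<le> \<kappa>" unfolding \<kappa> using eps by (simp add: power_mult_distrib)
    finally show ?thesis .
  qed
  define a where "a = (\<chi> i. \<epsilon> * of_int (c i))"
  define Q where "Q = cbox a (a + (\<chi> i. L))"
  have supp: "y \<in> Q" if "h y \<noteq> 0" for y
  proof -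
    have "cell \<epsilon> y \<in> F \<or> unshift l (cell \<epsilon> y) \<in> F"
      using that by (auto simp: h_def diff_density_def backward_diff_def indicator_def)
    then have "cell \<epsilon> y \<in> cube c s \<or> unshift l (cell \<epsilon> y) \<in> cube c s" using F by auto
    then have "c i \<le> cell \<epsilon> y i \<and> cell \<epsilon> y i < c i + int s + 1" for i
    proof
      assume "unshift l (cell \<epsilon> y) \<in> cube c s"
      then have "c i \<le> unshift l (cell \<epsilon> y) i \<and> unshift l (cell \<epsilon> y) i < c i + int s" unfolding cube_def by blast
      then show ?thesis by (auto simp: unshift_def split: if_splits)
    qed (auto simp: cube_def dest!: spec[of _ i])
    then have c: "of_int (c i) \<le> (of_int (cell \<epsilon> y i) :: real)" "of_int (cell \<epsilon> y i) + 1 \<le> of_int (c i) + (real s + 1)" for i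
      by (metis of_int_le_iff, smt (verit) of_int_le_iff of_int_add of_int_of_nat_eq of_int_1)
    have "\<epsilon> * of_int (c i) \<le> y $ i \<and> y $ i \<le> \<epsilon> * of_int (c i) + L" for i
    proof -
      have "\<epsilon> * of_int (cell \<epsilon> y i) \<le> y $ i" "y $ i < \<epsilon> * (of_int (cell \<epsilon> y i) + 1)"
        using cell_eq_iff[OF eps, of y "cell \<epsilon> y"] by auto
      moreover have "\<epsilon> * of_int (c i) \<le> \<epsilon> * of_int (cell \<epsilon> y i)" using c eps by (intro mult_left_mono) auto
      moreover have "\<epsilon> * (of_int (cell \<epsilon> y i) + 1) \<le> \<epsilon> * (of_int (c i) + (real s + 1))" using c eps by (intro mult_left_mono) auto
      moreover have "\<epsilon> * (of_int (c i) + (real s + 1)) = \<epsilon> * of_int (c i) + L" by (simp add: L_def algebra_simps)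
      ultimately show ?thesis by linarith
    qed
    then show ?thesis by (simp add: Q_def a_def mem_box_cart)
  qed
  have "measure_support (density_sm k) \<subseteq> Q"
  proof
    fix x assume x: "x \<in> measure_support (density_sm k)"
    show "x \<in> Q"
    proof (rule ccontr)
      assume "x \<notin> Q"
      moreover have "open (- Q)" by (simp add: Q_def closed_cbox open_Compl)
      ultimately have "total_variation (density_sm k) (- Q) > 0" using x by (auto simp: measure_support_def)
      moreover have "total_variation (density_sm k) (- Q) \<le> (\<integral>\<^sup>+x. indicator (- Q) x * ennreal \<bar>k x\<bar> \<partial>lborel)"
        by (rule total_variation_density_sm_le[OF ki])
      moreover have "(\<integral>\<^sup>+x. indicator (- Q) x * ennreal \<bar>k x\<bar> \<partial>lborel) = (\<integral>\<^sup>+x. 0 \<partial>(lborel :: (real^'n) measure))"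
        using supp by (intro nn_integral_cong) (auto simp: k_def split: split_indicator)
      ultimately show False by simp
    qed
  qed
  moreover have "density_sm k Q = 0"
  proof -
    have "indicator Q y * k y = 1 / \<kappa> * h y" for y using supp[of y] by (auto simp: k_def split: split_indicator)
    then have "density_sm k Q = (LINT y|lborel. 1 / \<kappa> * h y)" by (simp add: density_sm_def Q_def)
    also have "\<dots> = 0" using integral_diff_density[OF eps fin, of l] by (simp add: h_def)
    finally show ?thesis .
  qed
  moreover have "esssup (restrict_space lborel (UNIV \<times> {0<..}))
      (\<lambda>(x, t). ennreal \<bar>t powr ((real CARD('n) - (real CARD('n) - 1)) / 2) * heat_extension t (density_sm k) x\<bar>)
      \<le> ennreal (1 / L powr (real CARD('n) - 1))"
  proof (rule esssup_I[OF heat_extension_density_measurable[OF ki]])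
    have "ennreal \<bar>t powr ((real CARD('n) - (real CARD('n) - 1)) / 2) * heat_extension t (density_sm k) x\<bar>
        \<le> ennreal (1 / L powr (real CARD('n) - 1))" if t: "0 < t" for x :: "real^'n" and t
    proof -
      have "heat_extension t (density_sm k) x = 1 / \<kappa> * heat_extension t (density_sm h) x"
        unfolding heat_extension_density_sm[OF ki t] heat_extension_density_sm[OF hi t] k_def
        by (simp add: mult.left_commute)
      then have "\<bar>sqrt t * heat_extension t (density_sm k) x\<bar> = 1 / \<kappa> * \<bar>sqrt t * heat_extension t (density_sm h) x\<bar>"
        using kpos by (simp add: abs_mult)
      also have "\<dots> \<le> 1 / \<kappa> * 1"
        unfolding h_def using kpos by (intro mult_left_mono heat_extension_indicator_le[OF eps finF t]) auto
      also have "\<dots> \<le> 1 / L ^ ?d" using Lk L kpos by (simp add: frac_le)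
      also have "L ^ ?d = L powr (real CARD('n) - 1)"
        using L by (simp add: powr_realpow[symmetric] of_nat_diff Suc_leI)
      finally show ?thesis using t by (intro ennreal_leI) (simp add: powr_half_sqrt)
    qed
    then show "AE p in restrict_space lborel (UNIV \<times> {0<..}). (case p of (x, t) \<Rightarrow>
       ennreal \<bar>t powr ((real CARD('n) - (real CARD('n) - 1)) / 2) * heat_extension t (density_sm k) x\<bar>)
       \<le> ennreal (1 / L powr (real CARD('n) - 1))"
      by (intro AE_I2) (auto simp: space_restrict_space)
  qed
  moreover have "total_variation (density_sm k) UNIV \<le> 1"
  proof -
    \<comment> \<open>Before normalisation the density is 1/\<epsilon> in absolute value on one cell
      per jump, the cell at the upper end of the edge, so its integral is \<epsilon>^(d-1) times the
      number of jumps.\<close>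
    define X where "X = shift l ` jumps l F"
    have fX: "finite X" using finF by (simp add: X_def finite_jumps)
    have bd: "\<bar>backward_diff \<epsilon> l (indicator F) x\<bar> = (if x \<in> X then 1 / \<epsilon> else 0)" for x
    proof -
      have "x \<in> X \<longleftrightarrow> (x \<in> F) \<noteq> (unshift l x \<in> F)"
      proof
        show "x \<in> X" if "(x \<in> F) \<noteq> (unshift l x \<in> F)"
          unfolding X_def using that by (intro image_eqI[of _ _ "unshift l x"]) (auto simp: jumps_def)
      qed (auto simp: X_def jumps_def)
      then show ?thesis using eps by (auto simp: backward_diff_def indicator_def)
    qed
    have "total_variation (density_sm k) UNIV \<le> (\<integral>\<^sup>+y. ennreal \<bar>k y\<bar> \<partial>lborel)"
      using total_variation_density_sm_le[OF ki, of UNIV] by simp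
    also have "\<dots> = (\<integral>\<^sup>+y. ennreal (1 / \<kappa>) * ennreal \<bar>backward_diff \<epsilon> l (indicator F) (cell \<epsilon> y)\<bar> \<partial>(lborel :: (real^'n) measure))"
      using kpos by (intro nn_integral_cong) (simp add: k_def h_def diff_density_def abs_mult ennreal_mult[symmetric])
    also have "\<dots> = ennreal (1 / \<kappa>) * (\<integral>\<^sup>+y. ennreal \<bar>backward_diff \<epsilon> l (indicator F) (cell \<epsilon> y)\<bar> \<partial>(lborel :: (real^'n) measure))"
      using borel_measurable_integrable[OF hi] by (intro nn_integral_cmult) (simp add: h_def diff_density_def[abs_def])
    also have "(\<integral>\<^sup>+y. ennreal \<bar>backward_diff \<epsilon> l (indicator F) (cell \<epsilon> y)\<bar> \<partial>(lborel :: (real^'n) measure)) =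
       ennreal ((\<Sum>x\<in>X. \<bar>backward_diff \<epsilon> l (indicator F) x\<bar>) * \<epsilon> ^ CARD('n))"
    proof (rule integral_abs_step_function[OF eps fX])
      have "x \<in> X" if "backward_diff \<epsilon> l (indicator F) x \<noteq> 0" for x
        using bd[of x] that by (cases "x \<in> X") auto
      then show "{x. backward_diff \<epsilon> l (indicator F) x \<noteq> 0} \<subseteq> X" by blast
    qed
    also have "(\<Sum>x\<in>X. \<bar>backward_diff \<epsilon> l (indicator F) x\<bar>) * \<epsilon> ^ CARD('n) = real (card (jumps l F)) * \<epsilon> ^ ?d"
    proof -
      have "card X = card (jumps l F)" unfolding X_def by (intro card_image inj_on_subset[OF inj_shift]) auto
      moreover have "\<epsilon> ^ CARD('n) = \<epsilon> * \<epsilon> ^ ?d" by (simp add: power_Suc[symmetric] del: power_Suc)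
      ultimately show ?thesis using eps by (simp add: bd)
    qed
    also have "ennreal (1 / \<kappa>) * \<dots> = ennreal (real (card (jumps l F)) * \<epsilon> ^ ?d / \<kappa>)"
      using kpos eps by (simp add: ennreal_mult[symmetric])
    also have "\<dots> \<le> 1"
    proof -
      have "real (card (jumps l F)) * \<epsilon> ^ ?d \<le> \<kappa>"
      proof -
        have "1 * (\<epsilon> ^ ?d * real (card (jumps l F))) \<le> 2 ^ ?d * (\<epsilon> ^ ?d * (real s ^ ?d + real (card (jumps l F))))"
          using eps by (intro mult_mono) auto
        then show ?thesis unfolding \<kappa> by (simp add: mult_ac)
      qed
      then show ?thesis using kpos by simp
    qed
    finally show ?thesis .
  qed
  ultimately show ?thesis
    unfolding is_atom_def Let_def h_def[symmetric] eq Q_def using density_sm_finite[OF ki] L by blast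
qed

lemma is_atom_zero: "is_atom (real CARD('n) - 1) (\<lambda>A :: (real^'n::finite) set. 0)"
proof -
  note is_atom_diff_density[OF zero_less_one empty_subsetI zero_less_one refl, of "undefined :: 'n"]
  moreover have "density_sm (diff_density 1 undefined (indicator {})) A = 0" for A :: "(real^'n) set"
    by (simp add: density_sm_def diff_density_def[abs_def] backward_diff_def)
  ultimately show ?thesis by simp
qed

lemma box_sum_finite: "box_sum l g B \<Longrightarrow> finite {x. g x \<noteq> 0}"
proof (induction rule: box_sum.induct)
  case (step g B1 F c s a B2)
  have "{x. g x + a * indicator F x \<noteq> 0} \<subseteq> {x. g x \<noteq> 0} \<union> cube c s"
    using step by (auto simp: indicator_def)
  then show ?case using step.IH by (auto intro: finite_subset)
qed simp

text \<open>A term with coefficient \<open>a\<close> becomes one atom with coefficient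
  \<open>a * \<kappa>\<close>; the price in \<open>box_sum\<close> was chosen so that these
  coefficients add up to it, up to the scale factor. Every \<open>m i\<close> is an atom, also
  beyond \<open>K\<close>, which leaves room for padding.\<close>

lemma box_sum_atoms:
  fixes l :: "'n::finite"
  assumes eps: "0 < \<epsilon>" and "box_sum l g B"
  shows "\<exists>K c m. (\<forall>i::nat. is_atom (real CARD('n) - 1) (m i)) \<and>
    (\<forall>A. density_sm (diff_density \<epsilon> l g) A = (\<Sum>i=1..K. c i * m i A)) \<and>
    (\<Sum>i=1..K. \<bar>c i\<bar>) \<le> 2 ^ (CARD('n) - 1) * \<epsilon> ^ (CARD('n) - 1) * B"
  using assms(2)
proof (induction rule: box_sum.induct)
  case (zero B)
  have "density_sm (diff_density \<epsilon> l (\<lambda>_. 0)) A = 0" for A :: "(real^'n) set"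
    by (simp add: density_sm_def diff_density_def[abs_def] backward_diff_def)
  then show ?case using is_atom_zero zero eps by (intro exI[of _ 0] exI[of _ "\<lambda>_. 0"] exI[of _ "\<lambda>_ _. 0"]) simp
next
  case (step g B1 F c s a B2)
  from step.IH obtain K :: nat and c' m where IH: "\<And>i. is_atom (real CARD('n) - 1) (m i)"
    "\<And>A. density_sm (diff_density \<epsilon> l g) A = (\<Sum>i=1..K. c' i * m i A)"
    "(\<Sum>i=1..K. \<bar>c' i\<bar>) \<le> 2 ^ (CARD('n) - 1) * \<epsilon> ^ (CARD('n) - 1) * B1" by blast
  define \<kappa> where "\<kappa> = 2 ^ (CARD('n) - 1) * \<epsilon> ^ (CARD('n) - 1) * (real s ^ (CARD('n) - 1) + real (card (jumps l F)))"
  have kpos: "0 < \<kappa>" unfolding \<kappa>_def using eps step.hyps(3) by (intro mult_pos_pos add_pos_nonneg) auto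
  define m' where "m' = m(Suc K := \<lambda>A. 1 / \<kappa> * density_sm (diff_density \<epsilon> l (indicator F)) A)"
  define c'' where "c'' = c'(Suc K := a * \<kappa>)"
  have "finite F" using step.hyps(2) by (rule finite_subset) simp
  then have fin: "finite {x. indicator F x \<noteq> (0::real)}" by (auto simp: indicator_def)
  have "is_atom (real CARD('n) - 1) (m' i)" for i
    using IH(1) is_atom_diff_density[OF eps step.hyps(2,3) \<kappa>_def] by (simp add: m'_def)
  moreover have "density_sm (diff_density \<epsilon> l (\<lambda>x. g x + a * indicator F x)) A = (\<Sum>i=1..Suc K. c'' i * m' i A)" for A
  proof -
    have "diff_density \<epsilon> l (\<lambda>x. g x + a * indicator F x) = (\<lambda>y. diff_density \<epsilon> l g y + a * diff_density \<epsilon> l (indicator F) y)"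
      by (auto simp: diff_density_def backward_diff_def fun_eq_iff add_divide_distrib[symmetric] algebra_simps)
    then have "density_sm (diff_density \<epsilon> l (\<lambda>x. g x + a * indicator F x)) A =
       density_sm (diff_density \<epsilon> l g) A + a * density_sm (diff_density \<epsilon> l (indicator F)) A"
      using integrable_diff_density[OF eps box_sum_finite[OF step.hyps(1)]] integrable_diff_density[OF eps fin]
      by (simp add: density_sm_add density_sm_cmult)
    also have "\<dots> = (\<Sum>i=1..K. c'' i * m' i A) + c'' (Suc K) * m' (Suc K) A"
      using kpos by (simp add: IH(2) c''_def m'_def)
    finally show ?thesis by simp
  qed
  moreover have "(\<Sum>i=1..Suc K. \<bar>c'' i\<bar>) \<le> 2 ^ (CARD('n) - 1) * \<epsilon> ^ (CARD('n) - 1) * B2"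
  proof -
    have "(\<Sum>i=1..Suc K. \<bar>c'' i\<bar>) = (\<Sum>i=1..K. \<bar>c' i\<bar>) + \<bar>a\<bar> * \<kappa>"
      using kpos by (simp add: c''_def abs_mult)
    also have "\<dots> \<le> 2 ^ (CARD('n) - 1) * \<epsilon> ^ (CARD('n) - 1) * (B1 + \<bar>a\<bar> * (real s ^ (CARD('n) - 1) + real (card (jumps l F))))"
      using IH(3) by (simp add: \<kappa>_def algebra_simps)
    also have "\<dots> \<le> 2 ^ (CARD('n) - 1) * \<epsilon> ^ (CARD('n) - 1) * B2"
      using step.hyps(4) eps by (intro mult_left_mono) auto
    finally show ?thesis .
  qed
  ultimately show ?case by blast
qed

section \<open>Cut-off on the lattice\<close>

definition sup_norm :: "('n::finite \<Rightarrow> int) \<Rightarrow> int" where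
  "sup_norm x = Max (range (\<lambda>i. \<bar>x i\<bar>))"

lemma abs_le_sup_norm: "\<bar>x i\<bar> \<le> sup_norm x"
  by (simp add: sup_norm_def)

lemma sup_norm_attained: "\<exists>i. \<bar>x i\<bar> = sup_norm x"
proof -
  have "sup_norm x \<in> range (\<lambda>i. \<bar>x i\<bar>)" unfolding sup_norm_def by (intro Max_in) auto
  then show ?thesis by auto
qed

lemma sup_norm_shift: "\<bar>sup_norm (shift i x) - sup_norm x\<bar> \<le> 1"
proof -
  obtain j where j: "\<bar>shift i x j\<bar> = sup_norm (shift i x)" using sup_norm_attained by blast
  obtain k where k: "\<bar>x k\<bar> = sup_norm x" using sup_norm_attained by blast
  have "\<bar>shift i x j\<bar> \<le> \<bar>x j\<bar> + 1" "\<bar>x k\<bar> \<le> \<bar>shift i x k\<bar> + 1" by (auto simp: shift_def)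
  then show ?thesis using abs_le_sup_norm[of x j] abs_le_sup_norm[of "shift i x" k] j k by linarith
qed

text \<open>A slope 1/N over a cube of side comparable to N is the scaling at which the Poincare
  inequality pays for the cut-off.\<close>

definition cutoff :: "nat \<Rightarrow> ('n::finite \<Rightarrow> int) \<Rightarrow> real" where
  "cutoff N x = max 0 (min 1 (2 - of_int (sup_norm x) / real N))"

text \<open>The points of sup norm at most 2 N + 1, a layer wider than the support of the cut-off,
  so that every edge on which a truncated function changes has both ends inside.\<close>

definition cutoff_cube :: "nat \<Rightarrow> ('n::finite \<Rightarrow> int) set" where
  "cutoff_cube N = cube (\<lambda>_. - int (2 * N + 1)) (4 * N + 3)"

lemma cutoff_bounds: "0 \<le> cutoff N x" "cutoff N x \<le> 1"
  by (auto simp: cutoff_def)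

lemma cutoff_shift: "0 < N \<Longrightarrow> \<bar>cutoff N (shift i x) - cutoff N x\<bar> \<le> 1 / real N"
proof -
  assume N: "0 < N"
  have "\<bar>of_int (sup_norm (shift i x) - sup_norm x) :: real\<bar> \<le> 1"
    using sup_norm_shift[of i x] by linarith
  then have "\<bar>of_int (sup_norm (shift i x)) / real N - of_int (sup_norm x) / real N\<bar> \<le> 1 / real N"
    using N by (simp add: diff_divide_distrib[symmetric] abs_divide divide_right_mono)
  then show ?thesis unfolding cutoff_def by linarith
qed

lemma cutoff_eq_1: "sup_norm x \<le> int N \<Longrightarrow> 0 < N \<Longrightarrow> cutoff N x = 1"
proof -
  assume N: "sup_norm x \<le> int N" "0 < N"
  then have "real_of_int (sup_norm x) \<le> real N" by linarith
  then have "of_int (sup_norm x) / real N \<le> 1" using N by (simp add: divide_le_eq)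
  then show ?thesis by (simp add: cutoff_def)
qed

lemma cutoff_nonzero: "cutoff N x \<noteq> 0 \<Longrightarrow> 0 < N \<Longrightarrow> sup_norm x \<le> 2 * int N"
proof (rule ccontr)
  assume N: "cutoff N x \<noteq> 0" "0 < N" "\<not> sup_norm x \<le> 2 * int N"
  then have "real_of_int (sup_norm x) \<ge> 2 * real N" by linarith
  then have "of_int (sup_norm x) / real N \<ge> 2" using N by (simp add: le_divide_eq)
  then show False using N by (simp add: cutoff_def)
qed

lemma cutoff_cube_iff: "x \<in> cutoff_cube N \<longleftrightarrow> sup_norm x \<le> 2 * int N + 1"
proof
  obtain i where i: "\<bar>x i\<bar> = sup_norm x" using sup_norm_attained by blast
  assume "x \<in> cutoff_cube N"
  then have "- int (2 * N + 1) \<le> x i \<and> x i < - int (2 * N + 1) + int (4 * N + 3)"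
    unfolding cutoff_cube_def cube_def by blast
  then show "sup_norm x \<le> 2 * int N + 1" using i by linarith
next
  assume "sup_norm x \<le> 2 * int N + 1"
  then have *: "\<bar>x i\<bar> \<le> 2 * int N + 1" for i using abs_le_sup_norm[of x i] by linarith
  have "- int (2 * N + 1) \<le> x i \<and> x i < - int (2 * N + 1) + int (4 * N + 3)" for i
    using *[of i] by (intro conjI; linarith)
  then show "x \<in> cutoff_cube N" unfolding cutoff_cube_def cube_def by blast
qed

lemma cutoff_edge_in_cube:
  assumes "0 < N" "cutoff N (shift i x) \<noteq> 0 \<or> cutoff N x \<noteq> 0"
  shows "x \<in> cutoff_cube N" "shift i x \<in> cutoff_cube N"
  using assms cutoff_nonzero[of N x] cutoff_nonzero[of N "shift i x"] sup_norm_shift[of i x]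
  unfolding cutoff_cube_iff by linarith+

lemma cutoff_edge_differ:
  assumes "0 < N" "cutoff N (shift i x) \<noteq> cutoff N x"
  shows "int N \<le> sup_norm x"
  using assms cutoff_eq_1[of x N] cutoff_eq_1[of "shift i x" N] sup_norm_shift[of i x] by linarith

text \<open>The deviation from the mean is at most the mean of the deviations, so the two-point form
  of the Poincare inequality applies after division by the number of points.\<close>

lemma sum_abs_diff_mean_le:
  fixes c :: "'n::finite \<Rightarrow> int"
  assumes s: "0 < s"
  shows "(\<Sum>x\<in>cube c s. \<bar>a x - (\<Sum>y\<in>cube c s. a y) / card (cube c s)\<bar>) \<le> real s * variation (cube c s) a"
proof -
  let ?Q = "cube c s"
  have q: "0 < real (card ?Q)" using s by (simp add: card_cube)
  have "\<bar>a x - (\<Sum>y\<in>?Q. a y) / card ?Q\<bar> \<le> (\<Sum>y\<in>?Q. \<bar>a y - a x\<bar>) / card ?Q" for x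
  proof -
    have "a x - (\<Sum>y\<in>?Q. a y) / card ?Q = - ((\<Sum>y\<in>?Q. a y - a x) / card ?Q)"
    proof -
      have "(\<Sum>y\<in>?Q. a y - a x) = (\<Sum>y\<in>?Q. a y) - real (card ?Q) * a x" by (simp add: sum_subtractf)
      moreover have "real (card ?Q) \<noteq> 0" using q by linarith
      ultimately show ?thesis
        by (simp only: diff_divide_distrib nonzero_mult_div_cancel_left minus_diff_eq simp_thms)
    qed
    then have "\<bar>a x - (\<Sum>y\<in>?Q. a y) / card ?Q\<bar> = \<bar>\<Sum>y\<in>?Q. a y - a x\<bar> / card ?Q" by (simp add: abs_divide)
    also have "\<dots> \<le> (\<Sum>y\<in>?Q. \<bar>a y - a x\<bar>) / card ?Q" by (intro divide_right_mono sum_abs) simp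
    finally show ?thesis .
  qed
  then have "(\<Sum>x\<in>?Q. \<bar>a x - (\<Sum>y\<in>?Q. a y) / card ?Q\<bar>) \<le> (\<Sum>x\<in>?Q. (\<Sum>y\<in>?Q. \<bar>a y - a x\<bar>) / card ?Q)"
    by (intro sum_mono)
  also have "\<dots> = (\<Sum>x\<in>?Q. \<Sum>y\<in>?Q. \<bar>a y - a x\<bar>) / card ?Q" by (rule sum_divide_distrib[symmetric])
  also have "\<dots> \<le> (real (card ?Q) * real s * variation ?Q a) / card ?Q"
    by (intro divide_right_mono lattice_poincare) simp
  also have "\<dots> = real s * variation ?Q a"
  proof -
    have "real (card ?Q) \<noteq> 0" using q by linarith
    then show ?thesis by (simp only: mult.assoc nonzero_mult_div_cancel_left simp_thms)
  qed
  finally show ?thesis .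
qed

lemma cutoff_leibniz:
  "b (shift i x) * cutoff N (shift i x) - b x * cutoff N x =
    cutoff N (shift i x) * (b (shift i x) - b x) + (cutoff N (shift i x) - cutoff N x) * b x"
  by (simp add: algebra_simps)

text \<open>A discrete Leibniz rule: one term carries the differences of \<open>b\<close>, the other
  the slope of the cut-off. \<open>V\<close> may exceed the cut-off cube by far, because edges
  leaving that cube contribute nothing.\<close>

lemma dir_variation_cutoff_le:
  fixes b :: "('n::finite \<Rightarrow> int) \<Rightarrow> real"
  assumes N: "0 < N" and V: "finite V"
  shows "dir_variation V i (\<lambda>x. b x * cutoff N x) \<le>
    dir_variation (cutoff_cube N) i b + (\<Sum>x\<in>cutoff_cube N. \<bar>b x\<bar>) / real N"
proof -
  let ?W = "cutoff_cube N :: ('n \<Rightarrow> int) set" and ?g = "\<lambda>x. b x * cutoff N x"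
  have fW: "finite ?W" by (simp add: cutoff_cube_def)
  define D where "D x = (if x \<in> ?W \<and> shift i x \<in> ?W then \<bar>b (shift i x) - b x\<bar> else 0) + (if x \<in> ?W then \<bar>b x\<bar> / real N else 0)" for x
  have D0: "0 \<le> D x" for x by (simp add: D_def)
  have le: "\<bar>?g (shift i x) - ?g x\<bar> \<le> D x" for x
  proof (cases "cutoff N (shift i x) = 0 \<and> cutoff N x = 0")
    case False
    then have W: "x \<in> ?W" "shift i x \<in> ?W" using cutoff_edge_in_cube[OF N, of i x] by auto
    have "\<bar>?g (shift i x) - ?g x\<bar> \<le> \<bar>cutoff N (shift i x) * (b (shift i x) - b x)\<bar> + \<bar>(cutoff N (shift i x) - cutoff N x) * b x\<bar>"
      unfolding cutoff_leibniz by (rule abs_triangle_ineq)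
    also have "\<dots> \<le> 1 * \<bar>b (shift i x) - b x\<bar> + 1 / real N * \<bar>b x\<bar>"
      unfolding abs_mult using cutoff_bounds[of N "shift i x"] cutoff_shift[OF N, of i x] by (intro add_mono mult_right_mono) auto
    finally show ?thesis using W by (simp add: D_def)
  qed (use D0 in simp)
  have "dir_variation V i ?g \<le> (\<Sum>x\<in>{x \<in> V. shift i x \<in> V}. D x)"
    unfolding dir_variation_def by (intro sum_mono le)
  also have "\<dots> \<le> (\<Sum>x\<in>V \<union> ?W. D x)" using V fW D0 by (intro sum_mono2) auto
  also have "\<dots> = (\<Sum>x\<in>?W. D x)" using V fW by (intro sum.mono_neutral_right) (auto simp: D_def)
  also have "\<dots> = (\<Sum>x\<in>?W. if shift i x \<in> ?W then \<bar>b (shift i x) - b x\<bar> else 0) + (\<Sum>x\<in>?W. \<bar>b x\<bar> / real N)"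
    by (simp add: D_def sum.distrib)
  also have "(\<Sum>x\<in>?W. if shift i x \<in> ?W then \<bar>b (shift i x) - b x\<bar> else 0) = dir_variation ?W i b"
    unfolding dir_variation_def using fW by (simp add: sum.inter_filter)
  finally show ?thesis by (simp add: sum_divide_distrib)
qed

text \<open>The slope 1/N meets the Poincare constant 4 N + 3, at most 7 N, so the cost is
  independent of N; each of the d directions pays 7 variations. The second bound is also what
  controls the cut-off error in the weak limit.\<close>

lemma variation_cutoff_le:
  fixes a :: "('n::finite \<Rightarrow> int) \<Rightarrow> real"
  assumes N: "0 < N" and V: "finite V"
    and m: "m = (\<Sum>y\<in>cutoff_cube N. a y) / card (cutoff_cube N :: ('n \<Rightarrow> int) set)"
  shows "variation V (\<lambda>x. (a x - m) * cutoff N x) \<le> (1 + 7 * real CARD('n)) * variation (cutoff_cube N) a"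
    and "(\<Sum>x\<in>cutoff_cube N. \<bar>a x - m\<bar>) / real N \<le> 7 * variation (cutoff_cube N) a"
proof -
  let ?W = "cutoff_cube N :: ('n \<Rightarrow> int) set"
  have "(\<Sum>x\<in>?W. \<bar>a x - m\<bar>) \<le> real (4 * N + 3) * variation ?W a"
    unfolding m cutoff_cube_def by (rule sum_abs_diff_mean_le) simp
  also have "\<dots> \<le> (7 * real N) * variation ?W a"
    using N by (intro mult_right_mono variation_nonneg) auto
  finally show 1: "(\<Sum>x\<in>?W. \<bar>a x - m\<bar>) / real N \<le> 7 * variation ?W a"
    using N by (simp add: divide_le_eq mult_ac)
  have "variation V (\<lambda>x. (a x - m) * cutoff N x) \<le> (\<Sum>i\<in>UNIV. dir_variation ?W i (\<lambda>x. a x - m) + 7 * variation ?W a)"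
    unfolding variation_def[of V]
    by (intro sum_mono order.trans[OF dir_variation_cutoff_le[OF N V]] add_left_mono 1)
  also have "\<dots> = variation ?W a + real CARD('n) * (7 * variation ?W a)"
    by (simp add: sum.distrib variation_def dir_variation_def)
  finally show "variation V (\<lambda>x. (a x - m) * cutoff N x) \<le> (1 + 7 * real CARD('n)) * variation ?W a"
    by (simp add: algebra_simps)
qed

lemma box_sum_cutoff:
  fixes a :: "('n::finite \<Rightarrow> int) \<Rightarrow> real" and l :: 'n
  assumes N: "0 < N" and m: "m = (\<Sum>y\<in>cutoff_cube N. a y) / card (cutoff_cube N :: ('n \<Rightarrow> int) set)"
  shows "box_sum l (\<lambda>x. (a x - m) * cutoff N x) (2 ^ (CARD('n) + 3) * (1 + 7 * real CARD('n)) * variation (cutoff_cube N) a)"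
proof -
  let ?g = "\<lambda>x. (a x - m) * cutoff N x" and ?W = "cutoff_cube N :: ('n \<Rightarrow> int) set"
  define s where "s = 4 * N + 3"
  \<comment> \<open>A convenient exponent with 2^k \<ge> 2 s. The dyadic cube then contains
    \<open>cutoff_cube N\<close> and is at least twice as wide, so the support has density at most
    1/2.\<close>
  define k where "k = 2 * s"
  let ?Q = "cube (\<lambda>_::'n. - int (2 * N + 1)) (2 ^ k)"
  have sk: "2 * s \<le> 2 ^ k" unfolding k_def using less_exp[of "2 * s"] by simp
  have supp: "{x. ?g x \<noteq> 0} \<subseteq> ?W" using cutoff_edge_in_cube(1)[OF N] by auto
  have "int s \<le> int (2 ^ k)" using sk by linarith
  then have "?W \<subseteq> ?Q"
    unfolding cutoff_cube_def s_def[symmetric] cube_def by (auto intro: less_le_trans simp del: of_nat_power)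
  moreover have "2 * card {x. ?g x \<noteq> 0} \<le> card ?Q"
  proof -
    have "card {x. ?g x \<noteq> 0} \<le> card ?W" using supp by (intro card_mono) (simp_all add: cutoff_cube_def)
    also have "card ?W = s ^ CARD('n)" by (simp add: cutoff_cube_def card_cube s_def)
    finally have "2 * card {x. ?g x \<noteq> 0} \<le> 2 * s ^ CARD('n)" by simp
    also have "\<dots> \<le> 2 ^ CARD('n) * s ^ CARD('n)" using self_le_power[of "2::nat" "CARD('n)"] by (intro mult_right_mono) auto
    also have "\<dots> = (2 * s) ^ CARD('n)" by (simp add: power_mult_distrib)
    also have "\<dots> \<le> (2 ^ k) ^ CARD('n)" using sk by (intro power_mono) auto
    finally show ?thesis by (simp only: card_cube)
  qed
  ultimately have "box_sum l ?g (2 ^ (CARD('n) + 3) * variation ?Q ?g)"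
    using supp by (intro box_sum_variation) auto
  moreover have "2 ^ (CARD('n) + 3) * variation ?Q ?g \<le> 2 ^ (CARD('n) + 3) * ((1 + 7 * real CARD('n)) * variation ?W a)"
    by (intro mult_left_mono variation_cutoff_le[OF N _ m]) auto
  ultimately show ?thesis unfolding mult.assoc by (rule box_sum_mono)
qed

section \<open>Functions vanishing at infinity\<close>

lemma vanishing_far:
  fixes f :: "'a::real_normed_vector \<Rightarrow> real"
  assumes "(f \<longlongrightarrow> 0) at_infinity" "0 < \<delta>"
  shows "\<exists>R. \<forall>y. R \<le> norm y \<longrightarrow> \<bar>f y\<bar> < \<delta>"
  using tendstoD[OF assms] by (auto simp: eventually_at_infinity)

lemma vanishing_bounded:
  fixes f :: "'a::euclidean_space \<Rightarrow> real"
  assumes f: "continuous_on UNIV f" "(f \<longlongrightarrow> 0) at_infinity"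
  shows "\<exists>B. \<forall>y. \<bar>f y\<bar> \<le> B"
proof -
  obtain R where R: "\<And>y. R \<le> norm y \<Longrightarrow> \<bar>f y\<bar> < 1" using vanishing_far[OF f(2), of 1] by auto
  have "bounded (f ` cball 0 R)"
    using f(1) by (intro compact_imp_bounded compact_continuous_image) (auto intro: continuous_on_subset)
  then obtain B where "\<forall>x\<in>cball 0 R. \<bar>f x\<bar> \<le> B" unfolding bounded_iff by auto
  then have B: "\<bar>f y\<bar> \<le> B" if "norm y \<le> R" for y using that by simp
  have "\<bar>f y\<bar> \<le> max B 1" for y
    using R[of y] B[of y] by (cases "norm y \<le> R") (auto simp: le_max_iff_disj less_imp_le)
  then show ?thesis by blast
qed

text \<open>Compactness on the ball of radius R + 1 and smallness outside radius R; steps shorter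
  than 1 keep two nearby points together in one of these regions.\<close>

lemma vanishing_uniformly_continuous:
  fixes f :: "'a::euclidean_space \<Rightarrow> real"
  assumes f: "continuous_on UNIV f" "(f \<longlongrightarrow> 0) at_infinity" and d: "0 < \<delta>"
  shows "\<exists>r>0. \<forall>y y'. norm (y - y') < r \<longrightarrow> \<bar>f y - f y'\<bar> < \<delta>"
proof -
  obtain R where R: "\<And>y. R \<le> norm y \<Longrightarrow> \<bar>f y\<bar> < \<delta> / 2" using vanishing_far[OF f(2), of "\<delta> / 2"] d by auto
  have "uniformly_continuous_on (cball 0 (R + 1)) f"
    using f(1) by (intro compact_uniformly_continuous) (auto intro: continuous_on_subset)
  then obtain r where r: "0 < r" "\<And>y y'. norm y \<le> R + 1 \<Longrightarrow> norm y' \<le> R + 1 \<Longrightarrow> norm (y' - y) < r \<Longrightarrow> \<bar>f y' - f y\<bar> < \<delta>"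
    unfolding uniformly_continuous_on_def using d by (auto simp: dist_norm dest!: spec[of _ \<delta>])
  have "\<bar>f y - f y'\<bar> < \<delta>" if yy: "norm (y - y') < min r 1" for y y'
  proof (cases "norm y \<le> R + 1 \<and> norm y' \<le> R + 1")
    case True then show ?thesis using r(2)[of y' y] yy by auto
  next
    case False
    have "norm y \<le> norm y' + norm (y - y')" "norm y' \<le> norm y + norm (y - y')"
      using norm_triangle_sub[of y y'] norm_triangle_sub[of y' y] by (auto simp: norm_minus_commute)
    then have "R \<le> norm y" "R \<le> norm y'" using False yy by auto
    then show ?thesis using R[of y] R[of y'] by linarith
  qed
  then show ?thesis using r(1) by (intro exI[of _ "min r 1"]) auto
qed

section \<open>Discretised gradients\<close>

lemma component_finite_measures:
  assumes "\<nu> \<in> finite_measures"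
  shows "component i \<nu> \<in> finite_measures" "total_variation (component i \<nu>) UNIV \<le> total_variation \<nu> UNIV"
proof -
  show le: "total_variation (component i \<nu>) UNIV \<le> total_variation \<nu> UNIV"
    unfolding total_variation_def component_def
    by (intro SUP_mono bexI suminf_le ennreal_leI) (auto intro!: component_le_norm_cart)
  have "(\<lambda>j. component i \<nu> (F j)) sums component i \<nu> (\<Union>j. F j)"
    if "range F \<subseteq> sets borel" "disjoint_family F" for F :: "nat \<Rightarrow> 'a set"
    unfolding component_def
    by (intro bounded_linear.sums[OF bounded_linear_vec_nth] finite_measure_sums[OF assms] that)
  moreover have "component i \<nu> A = 0" if "A \<notin> sets borel" for A
    using finite_measure_nonborel[OF assms that] by (simp add: component_def)
  moreover have "total_variation (component i \<nu>) UNIV < \<infinity>"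
    using le total_variation_finite[OF assms, of UNIV] by auto
  ultimately show "component i \<nu> \<in> finite_measures" by (simp add: finite_measures_def)
qed

lemma tv_component_le: "\<nu> \<in> finite_measures \<Longrightarrow> tv (component i \<nu>) UNIV \<le> tv \<nu> UNIV"
  unfolding tv_def using component_finite_measures(2) total_variation_finite[of \<nu> UNIV] by (intro enn2real_mono) auto

context
  fixes B A :: "real \<Rightarrow> real" and \<epsilon> :: real and N :: nat
    and u :: "real^'n::finite \<Rightarrow> real" and \<nu> :: "(real^'n) set \<Rightarrow> real^'n"
  assumes B: "smooth_step 1 B" and A: "smooth_step 2 A" and dA: "\<And>s. (A has_real_derivative window B s) (at s)"
    and eps: "0 < \<epsilon>" and N: "0 < N"
    and u: "locally_integrable u" and nu: "\<nu> \<in> finite_measures" and grad: "distributional_gradient u \<nu>"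
begin

abbreviation (input) "avg \<equiv> lattice_average B \<epsilon> u"

lemma edge_bump_measurable: "edge_bump B A \<epsilon> i x \<in> borel_measurable borel"
  by (intro borel_measurable_continuous_onI continuous_edge_bump[OF B A dA eps])

text \<open>Each scaled difference is the integral of one edge bump against a component of
  \<open>\<nu>\<close>. For a fixed direction these bumps sum to at most 1, so the total variation
  is spent at most once per direction, uniformly in \<open>\<epsilon>\<close> and
  \<open>W\<close>.\<close>

lemma variation_lattice_average_le:
  assumes "finite W"
  shows "\<epsilon> ^ (CARD('n) - 1) * variation W avg \<le> real CARD('n) * tv \<nu> UNIV"
proof -
  have "\<epsilon> ^ (CARD('n) - 1) * dir_variation W i avg \<le> tv \<nu> UNIV" for i
  proof -
    let ?S = "{x \<in> W. shift i x \<in> W}"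
    have "\<epsilon> ^ (CARD('n) - 1) * dir_variation W i avg = (\<Sum>x\<in>?S. \<bar>signed_integral (component i \<nu>) (edge_bump B A \<epsilon> i x)\<bar>)"
      unfolding dir_variation_def sum_distrib_left lattice_average_diff[OF B A dA eps u grad, symmetric]
      using eps by (intro sum.cong refl) (simp add: abs_mult)
    also have "\<dots> \<le> 1 * tv (component i \<nu>) UNIV"
    proof (rule sum_abs_signed_integral_le[OF component_finite_measures(1)[OF nu]])
      show "(\<Sum>x\<in>?S. \<bar>edge_bump B A \<epsilon> i x y\<bar>) \<le> 1" for y
        using sum_edge_bump_le_1[OF B A dA eps, of ?S i y] assms by (simp add: abs_of_nonneg[OF edge_bump_nonneg[OF B A dA eps]])
    qed (use assms edge_bump_measurable in auto)
    also have "\<dots> \<le> tv \<nu> UNIV" using tv_component_le[OF nu] by simp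
    finally show ?thesis .
  qed
  then have "(\<Sum>i\<in>UNIV. \<epsilon> ^ (CARD('n) - 1) * dir_variation W i avg) \<le> (\<Sum>i\<in>(UNIV::'n set). tv \<nu> UNIV)"
    by (intro sum_mono)
  then show ?thesis by (simp add: variation_def sum_distrib_left)
qed

text \<open>Constants are invisible to the gradient, but cutting off a large constant would create
  variation that has no counterpart in \<open>\<nu>\<close>; subtracting the mean prevents
  this.\<close>

definition "centre = (\<Sum>y\<in>cutoff_cube N. avg y) / card (cutoff_cube N :: ('n \<Rightarrow> int) set)"

definition "localised x = (avg x - centre) * cutoff N x"

text \<open>The powers of \<open>\<epsilon>\<close> cancel: the atoms cost \<epsilon>^(d-1) times
  the lattice variation, precisely the quantity bounded by the total variation of
  \<open>\<nu>\<close>.\<close>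

lemma localised_atoms:
  "\<exists>K c m. (\<forall>i::nat. is_atom (real CARD('n) - 1) (m i)) \<and>
    (\<forall>X. density_sm (diff_density \<epsilon> l localised) X = (\<Sum>i=1..K. c i * m i X)) \<and>
    (\<Sum>i=1..K. \<bar>c i\<bar>) \<le> 2 ^ (2 * CARD('n) + 2) * (1 + 7 * real CARD('n)) * real CARD('n) * tv \<nu> UNIV"
proof -
  let ?v = "variation (cutoff_cube N) avg"
  have "box_sum l localised (2 ^ (CARD('n) + 3) * (1 + 7 * real CARD('n)) * ?v)"
    unfolding localised_def[abs_def] by (rule box_sum_cutoff[OF N centre_def])
  from box_sum_atoms[OF eps this] obtain K :: nat and c m where *:
    "\<forall>i. is_atom (real CARD('n) - 1) (m i)"
    "\<forall>X. density_sm (diff_density \<epsilon> l localised) X = (\<Sum>i=1..K. c i * m i X)"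
    "(\<Sum>i=1..K. \<bar>c i\<bar>) \<le> 2 ^ (CARD('n) - 1) * \<epsilon> ^ (CARD('n) - 1) * (2 ^ (CARD('n) + 3) * (1 + 7 * real CARD('n)) * ?v)"
    by blast
  note *(3)
  also have "2 ^ (CARD('n) - 1) * \<epsilon> ^ (CARD('n) - 1) * (2 ^ (CARD('n) + 3) * (1 + 7 * real CARD('n)) * ?v) =
     2 ^ (2 * CARD('n) + 2) * (1 + 7 * real CARD('n)) * (\<epsilon> ^ (CARD('n) - 1) * ?v)"
  proof -
    have "CARD('n) - 1 + (CARD('n) + 3) = 2 * CARD('n) + 2" using zero_less_card_finite[where 'a='n] by linarith
    then have "(2::real) ^ (2 * CARD('n) + 2) = 2 ^ (CARD('n) - 1) * 2 ^ (CARD('n) + 3)" by (metis power_add)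
    then show ?thesis by (simp only: mult_ac)
  qed
  also have "\<dots> \<le> 2 ^ (2 * CARD('n) + 2) * (1 + 7 * real CARD('n)) * (real CARD('n) * tv \<nu> UNIV)"
    by (intro mult_left_mono variation_lattice_average_le) (auto simp: cutoff_cube_def)
  finally show ?thesis using *(1,2) by (intro exI[of _ K] exI[of _ c] exI[of _ m]) (simp add: mult.assoc)
qed

text \<open>Since differences of averages are integrals of bumps against \<open>\<nu>\<close>, the integral of \<open>f\<close> against the
  discretised gradient is that of a smoothed \<open>K\<close> against \<open>\<nu>\<close>, up to the cut-off error; the bumps being a
  partition of unity, \<open>K\<close> is uniformly close to \<open>f\<close>.\<close>

lemma localised_weak_error:
  assumes f: "continuous_on UNIV f" and bd: "\<And>y. \<bar>f y\<bar> \<le> M"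
    and far: "\<And>y. R \<le> norm y \<Longrightarrow> \<bar>f y\<bar> < \<delta>"
    and unif: "\<And>y y'. norm (y - y') < r \<Longrightarrow> \<bar>f y - f y'\<bar> < \<delta>"
    and r: "3 * \<epsilon> * real CARD('n) < r" and R: "R \<le> \<epsilon> * (real N - 4)" and d: "0 < \<delta>"
  shows "\<bar>(LINT y|lborel. f y * diff_density \<epsilon> l localised y) - signed_integral (component l \<nu>) f\<bar>
    \<le> (4 + 7 * real CARD('n)) * tv \<nu> UNIV * \<delta>"
proof -
  let ?W = "cutoff_cube N :: ('n \<Rightarrow> int) set" and ?g = localised and ?d = "CARD('n) - 1"
  let ?SI = "signed_integral (component l \<nu>)" and ?w = "edge_bump B A \<epsilon> l"
  note cf = component_finite_measures(1)[OF nu, of l]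
  have fm: "f \<in> borel_measurable borel" by (rule borel_measurable_continuous_onI[OF f])
  have fW: "finite ?W" by (simp add: cutoff_cube_def)
  define b where "b x = avg x - centre" for x
  define I where "I x = (LINT y|lborel. indicator {y. cell \<epsilon> y = x} y * f y)" for x
  \<comment> \<open>The mean of \<open>f\<close> over the cell at \<open>shift l z\<close>, where
    the backward difference reads off the edge from \<open>z\<close> to
    \<open>shift l z\<close>.\<close>
  define F where "F z = I (shift l z) / \<epsilon> ^ CARD('n)" for z
  define k where "k z = cutoff N (shift l z) * F z" for z
  have epsd: "\<epsilon> ^ CARD('n) = \<epsilon> * \<epsilon> ^ ?d" by (simp add: power_Suc[symmetric] del: power_Suc)

  have cell2: "\<epsilon> * of_int (z j) \<le> y $ j" "y $ j \<le> \<epsilon> * (of_int (z j) + 2)" if "cell \<epsilon> y = shift l z" for y z j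
  proof -
    have 1: "\<epsilon> * of_int (shift l z j) \<le> y $ j" "y $ j < \<epsilon> * (of_int (shift l z j) + 1)"
      using that cell_eq_iff[OF eps] by blast+
    have 2: "of_int (z j) \<le> (of_int (shift l z j) :: real)" "of_int (shift l z j) + 1 \<le> (of_int (z j) + 2 :: real)"
      by (auto simp: shift_def)
    have "\<epsilon> * of_int (z j) \<le> \<epsilon> * of_int (shift l z j)" "\<epsilon> * (of_int (shift l z j) + 1) \<le> \<epsilon> * (of_int (z j) + 2)"
      using 2 eps by (auto intro!: mult_left_mono simp del: of_int_add)
    then show "\<epsilon> * of_int (z j) \<le> y $ j" "y $ j \<le> \<epsilon> * (of_int (z j) + 2)" using 1 by linarith+
  qed
  have bump3: "\<epsilon> * of_int (z j) \<le> y $ j" "y $ j \<le> \<epsilon> * (of_int (z j) + 3)" if "?w z y \<noteq> 0" for y z j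
    using edge_bump_box[OF B A dA eps that] by (auto simp: mem_box_cart)
  \<comment> \<open>Cell and bump both lie in the cube of side 3 \<epsilon> with corner \<epsilon>
    z, and the norm is at most the sum of the coordinate differences; hence the hypothesis relating
    \<open>\<epsilon>\<close> and \<open>r\<close>.\<close>
  have near: "\<bar>F z - f y\<bar> \<le> \<delta>" if w: "?w z y \<noteq> 0" for z y
    unfolding F_def I_def
  proof (rule abs_cell_average_le[OF eps fm _ bd])
    fix y' assume y': "cell \<epsilon> y' = shift l z"
    have "\<bar>(y' - y) $ j\<bar> \<le> 3 * \<epsilon>" for j
      using cell2[OF y', of j] bump3[OF w, of j] eps by (auto simp: algebra_simps)
    then have "(\<Sum>j\<in>UNIV. \<bar>(y' - y) $ j\<bar>) \<le> (\<Sum>j\<in>(UNIV::'n set). 3 * \<epsilon>)" by (intro sum_mono)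
    then have "norm (y' - y) \<le> 3 * \<epsilon> * real CARD('n)" using norm_le_l1_cart[of "y' - y"] by (simp add: mult_ac)
    then show "\<bar>f y' - f y\<bar> \<le> \<delta>" using unif[of y' y] r by linarith
  qed
  \<comment> \<open>Such \<open>z\<close> are where the cut-off may vary. Their cells are at
    distance at least \<epsilon> (N - 2) from the origin, where \<open>f\<close> is already below
    \<delta>.\<close>
  have farF: "\<bar>F z\<bar> \<le> \<delta>" if z: "int N \<le> sup_norm z" for z
  proof -
    have "\<bar>I (shift l z) / \<epsilon> ^ CARD('n) - 0\<bar> \<le> \<delta>"
      unfolding I_def
    proof (rule abs_cell_average_le[OF eps fm _ bd])
      fix y assume y: "cell \<epsilon> y = shift l z"
      obtain j where j: "\<bar>z j\<bar> = sup_norm z" using sup_norm_attained by blast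
      have "real N \<le> \<bar>of_int (z j)\<bar>" using j z by linarith
      then have "real N - 2 \<le> of_int (z j) \<or> of_int (z j) + 2 \<le> - (real N - 2)" using N by linarith
      then have "\<epsilon> * (real N - 2) \<le> \<epsilon> * of_int (z j) \<or> \<epsilon> * (of_int (z j) + 2) \<le> \<epsilon> * (- (real N - 2))"
        using eps by (auto simp: mult_le_cancel_left)
      then have "\<epsilon> * (real N - 2) \<le> \<bar>y $ j\<bar>" using cell2[OF y, of j] by (auto simp: algebra_simps)
      moreover have "\<epsilon> * (real N - 4) \<le> \<epsilon> * (real N - 2)" using eps by (intro mult_left_mono) auto
      ultimately have "R \<le> norm y" using R component_le_norm_cart[of y j] by linarith
      then show "\<bar>f y - 0\<bar> \<le> \<delta>" using far by (simp add: less_imp_le)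
    qed
    then show ?thesis by (simp add: F_def)
  qed

  have "(LINT y|lborel. f y * diff_density \<epsilon> l ?g y) = (\<Sum>x\<in>shift l ` ?W. backward_diff \<epsilon> l ?g x * I x)"
    unfolding diff_density_def I_def
  proof (rule integral_step_function[OF eps _ _ fm bd])
    show "{x. backward_diff \<epsilon> l ?g x \<noteq> 0} \<subseteq> shift l ` ?W"
    proof
      fix x assume "x \<in> {x. backward_diff \<epsilon> l ?g x \<noteq> 0}"
      then have "cutoff N (shift l (unshift l x)) \<noteq> 0 \<or> cutoff N (unshift l x) \<noteq> 0"
        by (auto simp: backward_diff_def localised_def)
      then have "unshift l x \<in> ?W" by (rule cutoff_edge_in_cube(1)[OF N])
      then show "x \<in> shift l ` ?W" by (intro image_eqI[of _ _ "unshift l x"]) auto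
    qed
  qed (use fW in simp)
  also have "\<dots> = (\<Sum>z\<in>?W. backward_diff \<epsilon> l ?g (shift l z) * I (shift l z))"
    by (subst sum.reindex) (auto intro: inj_on_subset[OF inj_shift])
  \<comment> \<open>The Leibniz rule splits each edge term: a difference of averages is an exact
    pairing with \<open>\<nu>\<close>, while a difference of the cut-off goes into the
    error.\<close>
  also have "\<dots> = (\<Sum>z\<in>?W. k z * ?SI (?w z) + \<epsilon> ^ ?d * ((cutoff N (shift l z) - cutoff N z) * b z) * F z)"
  proof (intro sum.cong refl)
    fix z
    have "backward_diff \<epsilon> l ?g (shift l z) * I (shift l z) = \<epsilon> ^ ?d * (?g (shift l z) - ?g z) * F z"
      using eps by (simp add: backward_diff_def F_def epsd)
    also have "?g (shift l z) - ?g z = cutoff N (shift l z) * (b (shift l z) - b z) + (cutoff N (shift l z) - cutoff N z) * b z"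
      unfolding localised_def b_def[symmetric] by (rule cutoff_leibniz)
    also have "\<epsilon> ^ ?d * \<dots> * F z = k z * (\<epsilon> ^ ?d * (b (shift l z) - b z)) + \<epsilon> ^ ?d * ((cutoff N (shift l z) - cutoff N z) * b z) * F z"
      unfolding k_def by (simp add: algebra_simps)
    also have "\<epsilon> ^ ?d * (b (shift l z) - b z) = ?SI (?w z)"
      unfolding b_def using lattice_average_diff[OF B A dA eps u grad, of l z] by simp
    finally show "backward_diff \<epsilon> l ?g (shift l z) * I (shift l z) =
       k z * ?SI (?w z) + \<epsilon> ^ ?d * ((cutoff N (shift l z) - cutoff N z) * b z) * F z" .
  qed
  finally have main: "(LINT y|lborel. f y * diff_density \<epsilon> l ?g y) =
      (\<Sum>z\<in>?W. k z * ?SI (?w z)) + (\<Sum>z\<in>?W. \<epsilon> ^ ?d * ((cutoff N (shift l z) - cutoff N z) * b z) * F z)"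
    by (simp add: sum.distrib)

  have "\<bar>\<Sum>z\<in>?W. \<epsilon> ^ ?d * ((cutoff N (shift l z) - cutoff N z) * b z) * F z\<bar> \<le> (\<Sum>z\<in>?W. \<epsilon> ^ ?d * \<delta> * (\<bar>b z\<bar> / real N))"
  proof (rule order.trans[OF sum_abs], rule sum_mono)
    fix z
    have "\<bar>cutoff N (shift l z) - cutoff N z\<bar> * \<bar>F z\<bar> \<le> 1 / real N * \<delta>"
    proof (cases "cutoff N (shift l z) = cutoff N z")
      case False
      then have "\<bar>F z\<bar> \<le> \<delta>" using farF cutoff_edge_differ[OF N] by blast
      then show ?thesis using cutoff_shift[OF N, of l z] by (intro mult_mono) auto
    qed (use d in simp)
    then have "\<epsilon> ^ ?d * \<bar>b z\<bar> * (\<bar>cutoff N (shift l z) - cutoff N z\<bar> * \<bar>F z\<bar>) \<le> \<epsilon> ^ ?d * \<bar>b z\<bar> * (1 / real N * \<delta>)"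
      using eps by (intro mult_left_mono) auto
    then show "\<bar>\<epsilon> ^ ?d * ((cutoff N (shift l z) - cutoff N z) * b z) * F z\<bar> \<le> \<epsilon> ^ ?d * \<delta> * (\<bar>b z\<bar> / real N)"
      using eps by (simp add: abs_mult mult_ac)
  qed
  also have "\<dots> = \<epsilon> ^ ?d * \<delta> * ((\<Sum>z\<in>?W. \<bar>b z\<bar>) / real N)"
    by (simp add: sum_distrib_left sum_divide_distrib)
  also have "\<dots> \<le> \<epsilon> ^ ?d * \<delta> * (7 * variation ?W avg)"
    unfolding b_def using eps d by (intro mult_left_mono variation_cutoff_le(2)[OF N finite.emptyI centre_def]) auto
  also have "\<dots> = 7 * \<delta> * (\<epsilon> ^ ?d * variation ?W avg)" by simp
  also have "\<dots> \<le> 7 * \<delta> * (real CARD('n) * tv \<nu> UNIV)"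
    using d by (intro mult_left_mono variation_lattice_average_le fW) auto
  finally have rest: "\<bar>\<Sum>z\<in>?W. \<epsilon> ^ ?d * ((cutoff N (shift l z) - cutoff N z) * b z) * F z\<bar> \<le> 7 * \<delta> * (real CARD('n) * tv \<nu> UNIV)" .

  define K where "K y = (\<Sum>z\<in>?W. k z * ?w z y)" for y
  have wb: "\<bar>?w z y\<bar> \<le> 1" for z y
    by (simp add: abs_of_nonneg[OF edge_bump_nonneg[OF B A dA eps]] edge_bump_le_1[OF B A dA eps])
  have kw: "\<bar>k z * ?w z y\<bar> \<le> \<bar>k z\<bar>" for z y
    using mult_left_mono[OF wb, of "\<bar>k z\<bar>" z y] by (simp add: abs_mult)
  have Km: "K \<in> borel_measurable borel"
    unfolding K_def[abs_def] using edge_bump_measurable by (intro borel_measurable_sum borel_measurable_times) auto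
  have Kb: "\<bar>K y\<bar> \<le> (\<Sum>z\<in>?W. \<bar>k z\<bar>)" for y
    unfolding K_def by (intro order.trans[OF sum_abs] sum_mono kw)
  have SIK: "?SI K = (\<Sum>z\<in>?W. k z * ?SI (?w z))"
  proof -
    have "?SI K = (\<Sum>z\<in>?W. ?SI (\<lambda>y. k z * ?w z y))"
      unfolding K_def[abs_def] by (rule signed_integral_sum[OF cf fW _ kw]) (intro borel_measurable_times edge_bump_measurable, simp)
    then show ?thesis by (simp only: signed_integral_cmult)
  qed
  have sum_le: "(\<Sum>z\<in>?W. ?w z y) \<le> 1" for y by (rule sum_edge_bump_le_1[OF B A dA eps fW])
  have Kf: "\<bar>K y + (- 1) * f y\<bar> \<le> 4 * \<delta>" for y
  proof -
    have split: "K y + (- 1) * f y = (\<Sum>z\<in>?W. (k z - f y) * ?w z y) - (1 - (\<Sum>z\<in>?W. ?w z y)) * f y"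
    proof -
      have "(\<Sum>z\<in>?W. (k z - f y) * ?w z y) = K y - f y * (\<Sum>z\<in>?W. ?w z y)"
        by (simp only: K_def left_diff_distrib sum_subtractf sum_distrib_left)
      then show ?thesis by (simp add: algebra_simps)
    qed
    have bound: "\<bar>\<Sum>z\<in>?W. (k z - f y) * ?w z y\<bar> \<le> c" if c: "\<And>z. ?w z y \<noteq> 0 \<Longrightarrow> \<bar>k z - f y\<bar> \<le> c" "0 \<le> c" for c
    proof -
      have "\<bar>\<Sum>z\<in>?W. (k z - f y) * ?w z y\<bar> \<le> (\<Sum>z\<in>?W. c * ?w z y)"
      proof (rule order.trans[OF sum_abs], rule sum_mono)
        fix z show "\<bar>(k z - f y) * ?w z y\<bar> \<le> c * ?w z y"
          using c(1)[of z] edge_bump_nonneg[OF B A dA eps, of l z y]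
          by (cases "?w z y = 0") (auto simp: abs_mult intro: mult_right_mono)
      qed
      also have "\<dots> = c * (\<Sum>z\<in>?W. ?w z y)" by (simp add: sum_distrib_left)
      also have "\<dots> \<le> c * 1" using sum_le c(2) by (intro mult_left_mono)
      finally show ?thesis by simp
    qed
    \<comment> \<open>Far out \<open>f\<close> is itself below \<delta>, so neither the cut-off nor
      an incomplete partition of unity does harm: 3 \<delta> plus \<delta>. Nearer to the origin the
      margin of 4 mesh widths makes the cut-off 1 on all bumps alive at \<open>y\<close> and their
      sum 1, leaving only \<delta>.\<close>
    show ?thesis
    proof (cases "R \<le> norm y")
      case True
      then have fy: "\<bar>f y\<bar> \<le> \<delta>" using far less_imp_le by blast
      have "\<bar>k z - f y\<bar> \<le> 3 * \<delta>" if "?w z y \<noteq> 0" for z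
      proof -
        have "\<bar>k z\<bar> \<le> 1 * \<bar>F z\<bar>"
          unfolding k_def abs_mult using cutoff_bounds[of N "shift l z"] by (intro mult_right_mono) auto
        then show ?thesis using near[OF that] fy by linarith
      qed
      then have "\<bar>\<Sum>z\<in>?W. (k z - f y) * ?w z y\<bar> \<le> 3 * \<delta>" using d by (intro bound) auto
      moreover have "\<bar>(1 - (\<Sum>z\<in>?W. ?w z y)) * f y\<bar> \<le> 1 * \<delta>"
        unfolding abs_mult using sum_le[of y] fy sum_nonneg[OF edge_bump_nonneg[OF B A dA eps]]
        by (intro mult_mono) auto
      ultimately show ?thesis unfolding split by linarith
    next
      case False
      have yj: "\<bar>y $ j\<bar> < \<epsilon> * (real N - 4)" for j
        using component_le_norm_cart[of y j] False R by linarith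
      have yj': "\<bar>y $ j / \<epsilon>\<bar> < real N - 4" for j
        using yj[of j] eps by (simp add: abs_divide divide_less_eq mult.commute)
      have yj'': "4 - real N < y $ j / \<epsilon>" "y $ j / \<epsilon> < real N - 4" for j
        using yj'[of j] by linarith+
      have "cutoff N (shift l z) = 1" if w: "?w z y \<noteq> 0" for z
      proof (rule cutoff_eq_1[OF _ N])
        obtain j where j: "\<bar>shift l z j\<bar> = sup_norm (shift l z)" using sup_norm_attained by blast
        have "\<bar>real_of_int (z j)\<bar> < real N - 1"
          using edge_bump_nonzero[OF B A dA eps w, of j] yj'[of j] by linarith
        then have "\<bar>z j\<bar> < int N - 1" by linarith
        then show "sup_norm (shift l z) \<le> int N" unfolding j[symmetric] by (auto simp: shift_def)
      qed
      then have "\<bar>\<Sum>z\<in>?W. (k z - f y) * ?w z y\<bar> \<le> \<delta>" using near d by (intro bound) (auto simp: k_def)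
      moreover have "(\<Sum>z\<in>?W. ?w z y) = 1"
        unfolding cutoff_cube_def
      proof (rule sum_edge_bump_eq_1[OF B A dA eps])
        show "real_of_int (- int (2 * N + 1)) \<le> y $ j / \<epsilon> - 2" for j
          using yj''[of j] by simp
        show "y $ j / \<epsilon> \<le> real_of_int (- int (2 * N + 1)) + real (4 * N + 3)" for j
          using yj''[of j] by simp
      qed
      ultimately show ?thesis unfolding split using d by simp
    qed
  qed
  have Mf: "\<bar>(- 1) * f y\<bar> \<le> M" for y using bd[of y] by simp
  have "?SI (\<lambda>y. K y + (- 1) * f y) = ?SI K + ?SI (\<lambda>y. (- 1) * f y)"
    by (rule signed_integral_add[OF cf Km Kb _ Mf]) (use fm in measurable)
  also have "\<dots> = ?SI K - ?SI f" by (simp only: signed_integral_cmult)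
  finally have "\<bar>?SI K - ?SI f\<bar> = \<bar>?SI (\<lambda>y. K y + (- 1) * f y)\<bar>" by simp
  also have "\<dots> \<le> 4 * \<delta> * tv (component l \<nu>) UNIV"
    by (rule abs_signed_integral_le[OF cf _ Kf]) (use fm Km in measurable)
  also have "\<dots> \<le> 4 * \<delta> * tv \<nu> UNIV" using d tv_component_le[OF nu] by (intro mult_left_mono) auto
  finally have "\<bar>?SI K - ?SI f\<bar> \<le> 4 * \<delta> * tv \<nu> UNIV" .
  then show ?thesis using rest unfolding main SIK by (simp add: algebra_simps)
qed

end

section \<open>Assembling the representation\<close>

lemma slow_reindexing:
  fixes K :: "nat \<Rightarrow> nat"
  shows "\<exists>\<sigma>. filterlim \<sigma> at_top sequentially \<and> (\<forall>\<^sub>F n in sequentially. K (\<sigma> n) \<le> n)"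
proof (intro exI conjI)
  define S where "S n = {j. j \<le> n \<and> (j = 0 \<or> K j \<le> n)}" for n
  have S: "finite (S n)" "0 \<in> S n" for n by (auto simp: S_def)
  have "Max (S n) \<in> S n" for n using S[of n] by (intro Max_in) auto
  moreover have "K j \<le> n" if "j \<in> S n" "K 0 \<le> n" for j n using that by (auto simp: S_def)
  ultimately have "K (Max (S n)) \<le> n" if "K 0 \<le> n" for n using that by blast
  then show "\<forall>\<^sub>F n in sequentially. K (Max (S n)) \<le> n"
    by (rule eventually_sequentiallyI)
  show "filterlim (\<lambda>n. Max (S n)) at_top sequentially"
    unfolding filterlim_at_top
  proof
    fix Z
    have "Z \<le> Max (S n)" if "max Z (K Z) \<le> n" for n
      using S(1)[of n] that by (intro Max_ge) (auto simp: S_def)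
    then show "\<forall>\<^sub>F n in sequentially. Z \<le> Max (S n)" by (rule eventually_sequentiallyI)
  qed
qed

lemma weak_star_approximation:
  fixes u :: "real^'n::finite \<Rightarrow> real" and l :: 'n
  assumes u: "locally_integrable u" and nu: "\<nu> \<in> finite_measures" and grad: "distributional_gradient u \<nu>"
  shows "\<exists>(K :: nat \<Rightarrow> nat) c m.
    (\<forall>n i. is_atom (real CARD('n) - 1) (m n i)) \<and>
    (\<forall>n. (\<Sum>i=1..K n. \<bar>c n i\<bar>) \<le> 2 ^ (2 * CARD('n) + 2) * (1 + 7 * real CARD('n)) * real CARD('n) * tv \<nu> UNIV) \<and>
    weak_star_limit (\<lambda>n X. \<Sum>i=1..K n. c n i * m n i X) (component l \<nu>)"
proof -
  obtain B A where BA: "smooth_step 1 B" "smooth_step 2 A" "\<And>s. (A has_real_derivative window B s) (at s)"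
    using smooth_step_pair by blast
  \<comment> \<open>The mesh width tends to 0 while \<epsilon> N = n + 1, the radius of the cut-off
    in space, tends to infinity.\<close>
  define \<epsilon> where "\<epsilon> n = 1 / real (Suc n)" for n
  define N where "N n = Suc n * Suc n" for n
  have eps: "0 < \<epsilon> n" and N: "0 < N n" for n by (simp_all add: \<epsilon>_def N_def)
  note ctx = BA eps N u nu grad
  define h where "h n = (diff_density (\<epsilon> n) l (localised B (\<epsilon> n) (N n) u) :: real^'n \<Rightarrow> real)" for n
  have hi: "integrable lborel (h n)" for n
  proof -
    have "{x. localised B (\<epsilon> n) (N n) u x \<noteq> 0} \<subseteq> cutoff_cube (N n)"
      using cutoff_edge_in_cube(1)[OF N[of n]] by (auto simp: localised_def[OF ctx])
    then have "finite {x. localised B (\<epsilon> n) (N n) u x \<noteq> 0}"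
      by (rule finite_subset) (simp add: cutoff_cube_def)
    then show ?thesis unfolding h_def by (rule integrable_diff_density[OF eps])
  qed
  define Q where "Q n (K::nat) c m \<longleftrightarrow> (\<forall>i::nat. is_atom (real CARD('n) - 1) (m i)) \<and>
    (\<forall>X. density_sm (h n) X = (\<Sum>i=1..K. c i * m i X)) \<and>
    (\<Sum>i=1..K. \<bar>c i\<bar>) \<le> 2 ^ (2 * CARD('n) + 2) * (1 + 7 * real CARD('n)) * real CARD('n) * tv \<nu> UNIV" for n K c m
  have "\<exists>K c m. Q n K c m" for n
    unfolding Q_def h_def by (rule localised_atoms[OF ctx])
  then obtain K c m where "\<And>n. Q n (K n) (c n) (m n)" by metis
  then have Kcm: "\<And>n i. is_atom (real CARD('n) - 1) (m n i)"
      "\<And>n X. density_sm (h n) X = (\<Sum>i=1..K n. c n i * m n i X)"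
      "\<And>n. (\<Sum>i=1..K n. \<bar>c n i\<bar>) \<le> 2 ^ (2 * CARD('n) + 2) * (1 + 7 * real CARD('n)) * real CARD('n) * tv \<nu> UNIV"
    unfolding Q_def by blast+
  have "weak_star_limit (\<lambda>n. density_sm (h n)) (component l \<nu>)"
    unfolding weak_star_limit_def
  proof (intro allI impI)
    fix f :: "real^'n \<Rightarrow> real" assume f: "continuous_on UNIV f" "(f \<longlongrightarrow> 0) at_infinity"
    obtain M where M: "\<And>y. \<bar>f y\<bar> \<le> M" using vanishing_bounded[OF f] by blast
    have SI: "signed_integral (density_sm (h n)) f = (LINT y|lborel. f y * h n y)" for n
      by (rule signed_integral_density_sm[OF hi borel_measurable_continuous_onI[OF f(1)] M])
    define D where "D = (4 + 7 * real CARD('n)) * tv \<nu> UNIV"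
    have D: "0 \<le> D" by (simp add: D_def)
    show "(\<lambda>n. signed_integral (density_sm (h n)) f) \<longlonglongrightarrow> signed_integral (component l \<nu>) f"
    proof (rule LIMSEQ_I)
      fix e :: real assume e: "0 < e"
      \<comment> \<open>The added 1 covers the case D = 0 and makes D \<delta> strictly smaller than
        e.\<close>
      define \<delta> where "\<delta> = e / (D + 1)"
      have \<delta>: "0 < \<delta>" using e D by (simp add: \<delta>_def)
      obtain R where R: "\<And>y. R \<le> norm y \<Longrightarrow> \<bar>f y\<bar> < \<delta>" using vanishing_far[OF f(2) \<delta>] by blast
      obtain r where r: "0 < r" "\<And>y y'. norm (y - y') < r \<Longrightarrow> \<bar>f y - f y'\<bar> < \<delta>"
        using vanishing_uniformly_continuous[OF f \<delta>] by blast
      \<comment> \<open>The second entry makes 3 \<epsilon> d smaller than r. The 4 in the first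
        pays for the margin: \<epsilon> (N - 4) is n + 1 - 4 \<epsilon>, and \<epsilon> is at most
        1.\<close>
      obtain n0 :: nat where n0: "max (R + 4) (3 * real CARD('n) / r) < real n0" using reals_Archimedean2 by blast
      have "norm (signed_integral (density_sm (h n)) f - signed_integral (component l \<nu>) f) < e" if n: "n0 \<le> n" for n
      proof -
        have n1: "R + 4 < real (Suc n)" "3 * real CARD('n) / r < real (Suc n)" using n0 n by auto
        have "3 * \<epsilon> n * real CARD('n) < r"
          using n1(2) r(1) by (simp add: \<epsilon>_def divide_simps mult_ac)
        moreover have "R \<le> \<epsilon> n * (real (N n) - 4)"
        proof -
          have "\<epsilon> n * (real (N n) - 4) = real (Suc n) - 4 * \<epsilon> n"
            unfolding \<epsilon>_def N_def of_nat_mult by (simp add: right_diff_distrib del: of_nat_Suc)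
          moreover have "\<epsilon> n \<le> 1" by (simp add: \<epsilon>_def)
          ultimately show ?thesis using n1(1) by linarith
        qed
        ultimately have "\<bar>(LINT y|lborel. f y * h n y) - signed_integral (component l \<nu>) f\<bar> \<le> D * \<delta>"
          unfolding h_def D_def by (intro localised_weak_error[OF ctx f(1) M R r(2) _ _ \<delta>])
        also have "\<dots> < e" using D e by (simp add: \<delta>_def divide_less_eq)
        finally show ?thesis by (simp add: SI)
      qed
      then show "\<exists>no. \<forall>n\<ge>no. norm (signed_integral (density_sm (h n)) f - signed_integral (component l \<nu>) f) < e"
        by blast
    qed
  qed
  moreover have "(\<lambda>n. density_sm (h n)) = (\<lambda>n X. \<Sum>i=1..K n. c n i * m n i X)"
    using Kcm(2) by (intro ext)
  ultimately show ?thesis using Kcm(1,3) by auto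
qed

text \<open>The definition asks for exactly \<open>n\<close> atoms at stage \<open>n\<close>: advance slowly through the
  approximations and pad with zero coefficients.\<close>

lemma atomic_representation_of_approximation:
  fixes m :: "nat \<Rightarrow> nat \<Rightarrow> (real^'n::finite) set \<Rightarrow> real" and K :: "nat \<Rightarrow> nat"
  assumes atom: "\<And>n i. is_atom \<beta> (m n i)" and bound: "\<And>n. (\<Sum>i=1..K n. \<bar>c n i\<bar>) \<le> C" "0 \<le> C"
    and lim: "weak_star_limit (\<lambda>n X. \<Sum>i=1..K n. c n i * m n i X) \<mu>"
  shows "\<exists>c' m'. atomic_representation \<beta> \<mu> c' m' \<and> limsup (\<lambda>n. ennreal (\<Sum>i=1..n. \<bar>c' i n\<bar>)) \<le> ennreal C"
proof -
  obtain \<sigma> where \<sigma>: "filterlim \<sigma> at_top sequentially" "\<forall>\<^sub>F n in sequentially. K (\<sigma> n) \<le> n"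
    using slow_reindexing by blast
  \<comment> \<open>If stage \<open>n\<close> has no room for all the atoms called for, every
    coefficient is 0. This happens for finitely many \<open>n\<close> only and keeps the bound
    \<open>C\<close> valid at every stage.\<close>
  define c' where "c' i n = (if i \<le> K (\<sigma> n) \<and> K (\<sigma> n) \<le> n then c (\<sigma> n) i else 0)" for i n
  define m' where "m' i n = m (\<sigma> n) i" for i n
  have eq: "(\<Sum>i=1..n. F (c' i n) i) = (if K (\<sigma> n) \<le> n then \<Sum>i=1..K (\<sigma> n). F (c (\<sigma> n) i) i else 0)"
    if F0: "\<And>i. F 0 i = 0" for F :: "real \<Rightarrow> nat \<Rightarrow> real" and n
  proof (cases "K (\<sigma> n) \<le> n")
    case True
    then have "(\<Sum>i=1..n. F (c' i n) i) = (\<Sum>i=1..K (\<sigma> n). F (c (\<sigma> n) i) i)"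
      using F0 by (intro sum.mono_neutral_cong_right) (auto simp: c'_def)
    then show ?thesis using True by simp
  qed (simp add: c'_def F0)
  have sum: "(\<Sum>i=1..n. \<bar>c' i n\<bar>) \<le> C" for n
    using eq[of "\<lambda>a _. \<bar>a\<bar>" n] bound by auto
  then have le: "limsup (\<lambda>n. ennreal (\<Sum>i=1..n. \<bar>c' i n\<bar>)) \<le> ennreal C"
    by (intro Limsup_bounded always_eventually allI ennreal_leI)
  have ev: "\<forall>\<^sub>F n in sequentially. (\<lambda>X. \<Sum>i=1..K (\<sigma> n). c (\<sigma> n) i * m (\<sigma> n) i X) = (\<lambda>X. \<Sum>i=1..n. c' i n * m' i n X)"
    using \<sigma>(2)
  proof (rule eventually_mono)
    fix n assume "K (\<sigma> n) \<le> n"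
    then show "(\<lambda>X. \<Sum>i=1..K (\<sigma> n). c (\<sigma> n) i * m (\<sigma> n) i X) = (\<lambda>X. \<Sum>i=1..n. c' i n * m' i n X)"
      using eq[of "\<lambda>a i. a * m (\<sigma> n) i X" n for X] by (intro ext) (simp add: m'_def)
  qed
  have "weak_star_limit (\<lambda>n X. \<Sum>i=1..n. c' i n * m' i n X) \<mu>"
    unfolding weak_star_limit_def
  proof (intro allI impI)
    fix f :: "real^'n \<Rightarrow> real" assume f: "continuous_on UNIV f" "(f \<longlongrightarrow> 0) at_infinity"
    have "(\<lambda>n. signed_integral (\<lambda>X. \<Sum>i=1..K n. c n i * m n i X) f) \<longlonglongrightarrow> signed_integral \<mu> f"
      using lim f unfolding weak_star_limit_def by blast
    from filterlim_compose[OF this \<sigma>(1)]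
    show "(\<lambda>n. signed_integral (\<lambda>X. \<Sum>i=1..n. c' i n * m' i n X) f) \<longlonglongrightarrow> signed_integral \<mu> f"
      by (rule Lim_transform_eventually) (use ev in \<open>auto elim: eventually_mono\<close>)
  qed
  moreover have "limsup (\<lambda>n. ennreal (\<Sum>i=1..n. \<bar>c' i n\<bar>)) < \<infinity>"
    using le by (rule order.strict_trans1) simp
  ultimately have "atomic_representation \<beta> \<mu> c' m'"
    using atom unfolding atomic_representation_def m'_def by blast
  then show ?thesis using le by blast
qed

theorem corollary1p5:
  assumes "CARD('n::finite) \<ge> 2"
  shows "\<exists>C::real. C > 0 \<and>
    (\<forall>(l::'n) (u::real^'n \<Rightarrow> real) (Du::(real^'n) set \<Rightarrow> real^'n).
       u \<in> BV_dot \<longrightarrow> Du \<in> finite_measures \<longrightarrow> distributional_gradient u Du \<longrightarrow>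
         component l Du \<in> DS (real CARD('n) - 1) \<and>
         DS_norm (real CARD('n) - 1) (component l Du) \<le> ennreal C * total_variation Du UNIV)"
proof (intro exI conjI allI impI)
  let ?C = "2 ^ (2 * CARD('n) + 2) * (1 + 7 * real CARD('n)) * real CARD('n)"
  show "0 < ?C" by (simp add: add_pos_nonneg)
  fix l :: 'n and u :: "real^'n \<Rightarrow> real" and Du :: "(real^'n) set \<Rightarrow> real^'n"
  assume u: "u \<in> BV_dot" and Du: "Du \<in> finite_measures" and grad: "distributional_gradient u Du"
  from u have "locally_integrable u" by (simp add: BV_dot_def)
  from weak_star_approximation[OF this Du grad, of l] obtain K :: "nat \<Rightarrow> nat" and c m where
    "\<And>n i. is_atom (real CARD('n) - 1) (m n i)" "\<And>n. (\<Sum>i=1..K n. \<bar>c n i\<bar>) \<le> ?C * tv Du UNIV"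
    "weak_star_limit (\<lambda>n X. \<Sum>i=1..K n. c n i * m n i X) (component l Du)" by blast
  from atomic_representation_of_approximation[OF this(1,2) _ this(3)] obtain c' m' where
    rep: "atomic_representation (real CARD('n) - 1) (component l Du) c' m'"
    and le: "limsup (\<lambda>n. ennreal (\<Sum>i=1..n. \<bar>c' i n\<bar>)) \<le> ennreal (?C * tv Du UNIV)" by auto
  show "component l Du \<in> DS (real CARD('n) - 1)"
    using component_finite_measures(1)[OF Du] rep unfolding DS_def by blast
  have "DS_norm (real CARD('n) - 1) (component l Du) \<le> limsup (\<lambda>n. ennreal (\<Sum>i=1..n. \<bar>c' i n\<bar>))"
    unfolding DS_norm_def using rep by (intro Inf_lower) blast
  also note le
  also have "ennreal (?C * tv Du UNIV) = ennreal ?C * total_variation Du UNIV"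
    using ennreal_tv[OF Du, of UNIV] by (subst ennreal_mult) auto
  finally show "DS_norm (real CARD('n) - 1) (component l Du) \<le> ennreal ?C * total_variation Du UNIV" .
qed

end
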